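(* In the rough volatility model described in the context, the rates $v_n(H)=n^{-1/(4H+2)}$ and $w_n(H)=n^{-1/(4H+2)}\ln(n)$ are lower rates of convergence for estimating $H$ and $\eta$ respectively over $\mathcal D$; that is, there exists $c>0$ such that $$\liminf_{n\to\infty}\inf_{\widehat H_n}\sup_{(H,\eta)\in\mathcal D}\mathbb P_{H,\eta}\big(v_n(H)^{-1}|\widehat H_n-H|\ge c\big)>0\quad\text{and}\quad \liminf_{n\to\infty}\inf_{\widehat \eta_n}\sup_{(H,\eta)\in\mathcal D}\mathbb P_{H,\eta}\big(w_n(H)^{-1}|\widehat \eta_n-\eta|\ge c\big)>0,$$ where the infima are over all $\mathcal A^n$-measurable random variables.
   Context: Let $\mathcal D$ be a compact subset of $(0,3/4)\times(0,\infty)$. For $(H,\eta)\in\mathcal D$, under $\mathbb P_{H,\eta}$, let $B$ be a standard Brownian motion and $W^H$ an independent fractional Brownian motion with Hurst index $H$; set $\sigma_t^2=\exp(\eta W^H_t)$ and $S_t=S_0+\int_0^t\sigma_u\,dB_u$ ($S_0$ deterministic). Let $n=2^N$. The data are $(S_{i/n})_{0\le i\le n}$ and $\mathcal A^n$ denotes the $\sigma$-algebra they generate.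
   Formalization: The compact set D is additionally assumed to have non-empty interior; without this the claim fails, e.g. for D a single point, where a constant estimator has zero error. *)

theory Defs
  imports "HOL-Probability.Probability"
begin

text \<open>Centered (jointly) Gaussian process indexed by I with covariance C, defined via
  characteristic functions of finite linear combinations (allows degenerate laws).\<close>
definition centered_gaussian_process ::
  "'a measure \<Rightarrow> 'i set \<Rightarrow> ('i \<Rightarrow> 'a \<Rightarrow> real) \<Rightarrow> ('i \<Rightarrow> 'i \<Rightarrow> real) \<Rightarrow> bool" where
  "centered_gaussian_process M I X C \<longleftrightarrow>
     prob_space M \<and> (\<forall>i\<in>I. X i \<in> borel_measurable M) \<and>
     (\<forall>J (a :: 'i \<Rightarrow> real) (u :: real). finite J \<longrightarrow> J \<subseteq> I \<longrightarrow>
        char (distr M borel (\<lambda>\<omega>. \<Sum>j\<in>J. a j * X j \<omega>)) u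
          = complex_of_real (exp (- (u\<^sup>2 * (\<Sum>i\<in>J. \<Sum>j\<in>J. a i * a j * C i j)) / 2)))"

definition brownian_motion :: "'a measure \<Rightarrow> (real \<Rightarrow> 'a \<Rightarrow> real) \<Rightarrow> bool" where
  "brownian_motion M B \<longleftrightarrow>
     centered_gaussian_process M {0..} B (\<lambda>s t. min s t) \<and>
     (\<forall>\<omega>\<in>space M. continuous_on {0..} (\<lambda>t. B t \<omega>))"

definition fbm_cov :: "real \<Rightarrow> real \<Rightarrow> real \<Rightarrow> real" where
  "fbm_cov H s t = (\<bar>s\<bar> powr (2*H) + \<bar>t\<bar> powr (2*H) - \<bar>t - s\<bar> powr (2*H)) / 2"

definition fractional_brownian_motion :: "'a measure \<Rightarrow> real \<Rightarrow> (real \<Rightarrow> 'a \<Rightarrow> real) \<Rightarrow> bool" where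
  "fractional_brownian_motion M H W \<longleftrightarrow>
     centered_gaussian_process M {0..} W (fbm_cov H) \<and>
     (\<forall>\<omega>\<in>space M. continuous_on {0..} (\<lambda>t. W t \<omega>))"

definition dyadic_riemann_sum ::
  "(real \<Rightarrow> 'a \<Rightarrow> real) \<Rightarrow> (real \<Rightarrow> 'a \<Rightarrow> real) \<Rightarrow> real \<Rightarrow> nat \<Rightarrow> 'a \<Rightarrow> real" where
  "dyadic_riemann_sum sig B t m \<omega> =
     (let K = nat \<lfloor>2^m * t\<rfloor> in
       (\<Sum>k<K. sig (real k / 2^m) \<omega> * (B (real (Suc k) / 2^m) \<omega> - B (real k / 2^m) \<omega>))
       + sig (real K / 2^m) \<omega> * (B t \<omega> - B (real K / 2^m) \<omega>))"

text \<open>Rough volatility model under P_{H,eta}: B Brownian motion, W fBm independent of B,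
  sigma_t^2 = exp(eta W_t), and S_t = S_0 + Ito integral of sigma dB, the Ito integral of the
  continuous adapted integrand being the limit in probability of left Riemann sums.\<close>
definition rough_vol_model ::
  "'a measure \<Rightarrow> real \<Rightarrow> real \<Rightarrow> real \<Rightarrow> (real \<Rightarrow> 'a \<Rightarrow> real) \<Rightarrow> (real \<Rightarrow> 'a \<Rightarrow> real)
     \<Rightarrow> (real \<Rightarrow> 'a \<Rightarrow> real) \<Rightarrow> bool" where
  "rough_vol_model M H \<eta> S0 B W S \<longleftrightarrow>
     prob_space M \<and> brownian_motion M B \<and> fractional_brownian_motion M H W \<and>
     prob_space.indep_var M
        (PiM {0..} (\<lambda>_. borel)) (\<lambda>\<omega>. \<lambda>t\<in>{0..}. B t \<omega>)
        (PiM {0..} (\<lambda>_. borel)) (\<lambda>\<omega>. \<lambda>t\<in>{0..}. W t \<omega>) \<and>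
     (\<forall>t\<ge>0. S t \<in> borel_measurable M) \<and>
     (\<forall>t\<ge>0. \<forall>\<epsilon>>0.
        (\<lambda>m. measure M {\<omega>\<in>space M.
            \<bar>dyadic_riemann_sum (\<lambda>u \<omega>. sqrt (exp (\<eta> * W u \<omega>))) B t m \<omega> - (S t \<omega> - S0)\<bar> > \<epsilon>})
        \<longlonglongrightarrow> 0)"

definition obs :: "nat \<Rightarrow> (real \<Rightarrow> 'a \<Rightarrow> real) \<Rightarrow> 'a \<Rightarrow> (nat \<Rightarrow> real)" where
  "obs n S \<omega> = (\<lambda>i\<in>{..n}. S (real i / real n) \<omega>)"

text \<open>Estimators: A^n-measurable random variables = Borel functions of the observation vector.\<close>
definition estimators :: "nat \<Rightarrow> ((nat \<Rightarrow> real) \<Rightarrow> real) set" where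
  "estimators n = borel_measurable (PiM {..n} (\<lambda>_. borel))"

definition rate_v :: "nat \<Rightarrow> real \<Rightarrow> real" where
  "rate_v n H = real n powr (- 1 / (4 * H + 2))"

definition rate_w :: "nat \<Rightarrow> real \<Rightarrow> real" where
  "rate_w n H = real n powr (- 1 / (4 * H + 2)) * ln (real n)"

end

theory Submission
  imports Defs "HOL-Probability.Probability"
begin

text \<open>
  By Le Cam's two-point method it suffices to find, for large \<open>n\<close>, parameters whose data laws are at total variation
  distance at most one half. Fix an interior point \<open>(H, \<eta>)\<close> and put \<open>H' = H - h\<close> with \<open>h\<close> a small multiple of
  \<open>n powr (- 1 / (4 H + 2))\<close>, and \<open>\<eta>' = \<eta> J powr (- h)\<close>, where \<open>J\<close> is about \<open>n powr (1 / (2 H + 1))\<close>.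

  On \<open>[0, 1]\<close> fractional Brownian motion is the sum of a Gaussian linear drift and an independent Fourier series, because
  \<open>t powr (2 H) - H t\<^sup>2\<close> has negative cosine coefficients. The coefficients of the two models differ at frequency
  \<open>m\<close> by a relative error of order \<open>h (1 + \<bar>ln (m / J)\<bar>)\<close>. Up to frequency \<open>J\<close> the Hellinger distance of the coefficient
  vectors is of order \<open>h\<^sup>2 J\<close>. Above \<open>J\<close> both series use the same Gaussian variables; given the volatility
  the increments of \<open>S\<close> are independent Gaussians, and the Hellinger distance of the two conditional laws is of order
  \<open>n\<close> times the mean square distance of the coupled paths, that is \<open>n h\<^sup>2 J powr (- 2 H)\<close>. Both orders are
  constant for the chosen \<open>J\<close>.

  Truncating the series and discretizing the integrals is harmless, because pointwise convergence of characteristic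
  functions implies convergence in total variation after Gaussian smoothing.
\<close>

section \<open>Gaussian vectors on finite products\<close>

text \<open>Two obstacles shape the argument. Neither the volatility path nor the observed
  increments have a tractable density, so every estimate is made for truncated series and Riemann
  sums, with constants that depend neither on the truncation level nor on the mesh; only bounds for
  continuous tests are carried through the two limits, and Borel sets are recovered at the end.
  Moreover no single comparison serves all frequencies: a relative error bounded away from 0 at
  infinitely many frequencies makes the coefficient laws mutually singular, while coupling the low
  frequencies as well would move the path too far for n observations. The multiple H of t^2 is the
  one for which the derivative of t^(2H) - H t^2 vanishes at t = 1. The even 2-periodic extension
  then has no corner at 1, and no alternating term of order m^(-2) is left in the coefficients; for
  H > 1/2 such a term would dominate and spoil their sign. At H = 1/2 the integral formulas used for
  the coefficients lose their uniform bounds, so the two Hurst indices are kept on one side of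
  1/2.\<close>

definition gauss :: "nat set \<Rightarrow> (nat \<Rightarrow> real) measure" where
  "gauss I = PiM I (\<lambda>_. std_normal_distribution)"

lemma sets_gauss [simp, measurable_cong]: "sets (gauss I) = sets (PiM I (\<lambda>_. borel))"
  unfolding gauss_def by (intro sets_PiM_cong) auto

lemma space_gauss [simp]: "space (gauss I) = space (PiM I (\<lambda>_. borel :: real measure))"
  by (rule sets_eq_imp_space_eq) simp

interpretation std_normal: prob_space std_normal_distribution
  using real_dist_normal_dist by (simp add: real_distribution_def)

lemma prob_space_gauss: "prob_space (gauss I)"
  unfolding gauss_def by (intro prob_space_PiM) unfold_locales

section \<open>Densities and images of finite product measures; Gaussian translations and
  moments\<close>

lemma PiM_density:
  fixes f :: "'i \<Rightarrow> 'a \<Rightarrow> ennreal"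
  assumes I: "finite I" and M: "\<And>i. sigma_finite_measure (M i)"
    and D: "\<And>i. sigma_finite_measure (density (M i) (f i))"
    and f[measurable]: "\<And>i. f i \<in> borel_measurable (M i)"
  shows "PiM I (\<lambda>i. density (M i) (f i)) = density (PiM I M) (\<lambda>x. \<Prod>i\<in>I. f i (x i))"
proof -
  interpret M: product_sigma_finite M
    using M by (simp add: product_sigma_finite_def)
  interpret D: product_sigma_finite "\<lambda>i. density (M i) (f i)"
    using D by (simp add: product_sigma_finite_def)
  have "density (PiM I M) (\<lambda>x. \<Prod>i\<in>I. f i (x i)) = PiM I (\<lambda>i. density (M i) (f i))"
  proof (rule D.PiM_eqI[OF I])
    show "sets (density (PiM I M) (\<lambda>x. \<Prod>i\<in>I. f i (x i))) = sets (PiM I (\<lambda>i. density (M i) (f i)))"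
      by (simp, intro sets_PiM_cong) auto
  next
    fix A assume "\<And>i. i \<in> I \<Longrightarrow> A i \<in> sets (density (M i) (f i))"
    then have A[measurable]: "\<And>i. i \<in> I \<Longrightarrow> A i \<in> sets (M i)" by simp
    have "emeasure (density (PiM I M) (\<lambda>x. \<Prod>i\<in>I. f i (x i))) (Pi\<^sub>E I A)
        = (\<integral>\<^sup>+x. (\<Prod>i\<in>I. f i (x i)) * indicator (Pi\<^sub>E I A) x \<partial>PiM I M)"
      by (intro emeasure_density) (use I in auto)
    also have "\<dots> = (\<integral>\<^sup>+x. (\<Prod>i\<in>I. f i (x i) * indicator (A i) (x i)) \<partial>PiM I M)"
    proof (rule nn_integral_cong)
      fix x assume x: "x \<in> space (PiM I M)"
      then have "indicator (Pi\<^sub>E I A) x = (\<Prod>i\<in>I. indicator (A i) (x i) :: ennreal)"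
        using I by (cases "x \<in> Pi\<^sub>E I A") (auto simp: space_PiM PiE_iff indicator_def prod_zero_iff)
      then show "(\<Prod>i\<in>I. f i (x i)) * indicator (Pi\<^sub>E I A) x
          = (\<Prod>i\<in>I. f i (x i) * indicator (A i) (x i))"
        by (simp add: prod.distrib)
    qed
    also have "\<dots> = (\<Prod>i\<in>I. \<integral>\<^sup>+x. f i x * indicator (A i) x \<partial>M i)"
      by (intro M.product_nn_integral_prod) (use I in auto)
    also have "\<dots> = (\<Prod>i\<in>I. emeasure (density (M i) (f i)) (A i))"
      by (intro prod.cong refl) (simp add: emeasure_density)
    finally show "emeasure (density (PiM I M) (\<lambda>x. \<Prod>i\<in>I. f i (x i))) (Pi\<^sub>E I A)
        = (\<Prod>i\<in>I. emeasure (density (M i) (f i)) (A i))" .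
  qed
  then show ?thesis by simp
qed

lemma distr_PiM_componentwise:
  assumes I: "finite I" and M: "\<And>i. prob_space (M i)"
    and f[measurable]: "\<And>i. f i \<in> measurable (M i) (N i)"
  shows "distr (PiM I M) (PiM I N) (\<lambda>x. \<lambda>i\<in>I. f i (x i)) = PiM I (\<lambda>i. distr (M i) (N i) (f i))"
proof -
  interpret M: product_sigma_finite M
    using M by (simp add: product_sigma_finite_def prob_space_imp_sigma_finite)
  interpret D: product_sigma_finite "\<lambda>i. distr (M i) (N i) (f i)"
    using M by (simp add: product_sigma_finite_def prob_space_imp_sigma_finite prob_space.prob_space_distr)
  show ?thesis
  proof (rule D.PiM_eqI[OF I])
    show "sets (distr (PiM I M) (PiM I N) (\<lambda>x. \<lambda>i\<in>I. f i (x i)))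
        = sets (PiM I (\<lambda>i. distr (M i) (N i) (f i)))"
      by (simp, intro sets_PiM_cong) auto
  next
    fix A assume "\<And>i. i \<in> I \<Longrightarrow> A i \<in> sets (distr (M i) (N i) (f i))"
    then have A[measurable]: "\<And>i. i \<in> I \<Longrightarrow> A i \<in> sets (N i)" by simp
    have "(\<lambda>x. \<lambda>i\<in>I. f i (x i)) -` Pi\<^sub>E I A \<inter> space (PiM I M)
        = Pi\<^sub>E I (\<lambda>i. f i -` A i \<inter> space (M i))"
      by (auto simp: space_PiM PiE_iff)
    then have "emeasure (distr (PiM I M) (PiM I N) (\<lambda>x. \<lambda>i\<in>I. f i (x i))) (Pi\<^sub>E I A)
        = emeasure (PiM I M) (Pi\<^sub>E I (\<lambda>i. f i -` A i \<inter> space (M i)))"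
      using I by (subst emeasure_distr) auto
    also have "\<dots> = (\<Prod>i\<in>I. emeasure (M i) (f i -` A i \<inter> space (M i)))"
      using I by (intro M.emeasure_PiM) auto
    also have "\<dots> = (\<Prod>i\<in>I. emeasure (distr (M i) (N i) (f i)) (A i))"
      by (intro prod.cong refl) (simp add: emeasure_distr)
    finally show "emeasure (distr (PiM I M) (PiM I N) (\<lambda>x. \<lambda>i\<in>I. f i (x i))) (Pi\<^sub>E I A)
        = (\<Prod>i\<in>I. emeasure (distr (M i) (N i) (f i)) (A i))" .
  qed
qed

text \<open>Cameron-Martin in dimension one: completing the square in the density of the shifted
  normal law leaves the factor exp(y x - y^2/2).\<close>

lemma distr_std_normal_translate:
  "distr std_normal_distribution borel (\<lambda>x. y + x)
     = density std_normal_distribution (\<lambda>x. ennreal (exp (y * x - y\<^sup>2 / 2)))"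
proof -
  have "distr std_normal_distribution borel (\<lambda>x. y + x) = density lborel (\<lambda>x. ennreal (normal_density y 1 x))"
  proof -
    have "distributed std_normal_distribution lborel (\<lambda>x. x) (\<lambda>x. ennreal (normal_density 0 1 x))"
      by (auto simp: distributed_def distr_id2)
    from std_normal.normal_density_affine[OF this, of 1 y]
    have "distributed std_normal_distribution lborel (\<lambda>x. y + 1 * x) (\<lambda>x. ennreal (normal_density (y + 1 * 0) (\<bar>1\<bar> * 1) x))"
      by simp
    then have "distr std_normal_distribution lborel (\<lambda>x. y + x) = density lborel (\<lambda>x. ennreal (normal_density y 1 x))"
      by (simp add: distributed_def)
    moreover have "distr std_normal_distribution lborel (\<lambda>x. y + x) = distr std_normal_distribution borel (\<lambda>x. y + x)"
      by (intro distr_cong) auto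
    ultimately show ?thesis by simp
  qed
  also have "\<dots> = density lborel (\<lambda>x. ennreal (std_normal_density x) * ennreal (exp (y * x - y\<^sup>2 / 2)))"
  proof (intro arg_cong[where f="density lborel"] ext)
    fix x :: real
    have "exp (- (x - y)\<^sup>2 / 2) = exp (- x\<^sup>2 / 2) * exp (y * x - y\<^sup>2 / 2)"
      unfolding exp_add[symmetric] by (simp add: power2_eq_square field_simps)
    then show "ennreal (normal_density y 1 x) = ennreal (std_normal_density x) * ennreal (exp (y * x - y\<^sup>2 / 2))"
      by (simp add: ennreal_mult[symmetric] normal_density_def)
  qed
  also have "\<dots> = density std_normal_distribution (\<lambda>x. ennreal (exp (y * x - y\<^sup>2 / 2)))"
    by (subst density_density_eq) auto
  finally show ?thesis .
qed

lemma distr_gauss_translate: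
  assumes I: "finite I"
  shows "distr (gauss I) (PiM I (\<lambda>_. borel)) (\<lambda>z. \<lambda>i\<in>I. y i + z i)
     = density (gauss I) (\<lambda>z. ennreal (exp (\<Sum>i\<in>I. y i * z i - (y i)\<^sup>2 / 2)))"
proof -
  have "distr (gauss I) (PiM I (\<lambda>_. borel)) (\<lambda>z. \<lambda>i\<in>I. y i + z i)
      = PiM I (\<lambda>i. distr std_normal_distribution borel (\<lambda>x. y i + x))"
    unfolding gauss_def by (rule distr_PiM_componentwise[OF I]) (auto intro: std_normal.prob_space_axioms)
  also have "\<dots> = PiM I (\<lambda>i. density std_normal_distribution (\<lambda>x. ennreal (exp (y i * x - (y i)\<^sup>2 / 2))))"
    by (simp add: distr_std_normal_translate)
  also have "\<dots> = density (gauss I) (\<lambda>z. \<Prod>i\<in>I. ennreal (exp (y i * z i - (y i)\<^sup>2 / 2)))"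
    unfolding gauss_def
  proof (rule PiM_density[OF I])
    show "sigma_finite_measure (density std_normal_distribution (\<lambda>x. ennreal (exp (y i * x - (y i)\<^sup>2 / 2))))" for i
      unfolding distr_std_normal_translate[symmetric]
      by (intro prob_space_imp_sigma_finite std_normal.prob_space_distr) auto
  qed (auto intro: std_normal.sigma_finite_measure_axioms)
  also have "\<dots> = density (gauss I) (\<lambda>z. ennreal (exp (\<Sum>i\<in>I. y i * z i - (y i)\<^sup>2 / 2)))"
    using I by (simp add: prod_ennreal exp_sum)
  finally show ?thesis .
qed

lemma integral_gauss_translate:
  fixes F :: "(nat \<Rightarrow> real) \<Rightarrow> real"
  assumes I: "finite I" and F[measurable]: "F \<in> borel_measurable (PiM I (\<lambda>_. borel))"
  shows "(\<integral>z. F (\<lambda>i\<in>I. y i + z i) \<partial>gauss I)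
     = (\<integral>z. exp (\<Sum>i\<in>I. y i * z i - (y i)\<^sup>2 / 2) * F z \<partial>gauss I)"
proof -
  have "(\<integral>z. F (\<lambda>i\<in>I. y i + z i) \<partial>gauss I)
      = (\<integral>z. F z \<partial>distr (gauss I) (PiM I (\<lambda>_. borel)) (\<lambda>z. \<lambda>i\<in>I. y i + z i))"
    by (subst integral_distr) auto
  also have "\<dots> = (\<integral>z. exp (\<Sum>i\<in>I. y i * z i - (y i)\<^sup>2 / 2) * F z \<partial>gauss I)"
    unfolding distr_gauss_translate[OF I] by (subst integral_density) auto
  finally show ?thesis .
qed

text \<open>Read off from the translation formula: an image of a probability measure has mass one,
  so the translation density integrates to one. No Gaussian integral is evaluated.\<close>

lemma std_normal_exp_moment:
  "integrable std_normal_distribution (\<lambda>x. exp (a * x))"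
  "(\<integral>x. exp (a * x) \<partial>std_normal_distribution) = exp (a\<^sup>2 / 2)"
proof -
  interpret P: prob_space "density std_normal_distribution (\<lambda>x. ennreal (exp (a * x - a\<^sup>2 / 2)))"
    unfolding distr_std_normal_translate[symmetric]
    by (intro std_normal.prob_space_distr) auto
  have eq: "exp (a * x) = exp (a\<^sup>2 / 2) * exp (a * x - a\<^sup>2 / 2)" for x
    unfolding exp_add[symmetric] by simp
  have 1: "integrable (density std_normal_distribution (\<lambda>x. ennreal (exp (a * x - a\<^sup>2 / 2)))) (\<lambda>_. 1::real)"
    by simp
  have 2: "integrable std_normal_distribution (\<lambda>x. exp (a * x - a\<^sup>2 / 2))"
    using 1 by (subst (asm) integrable_density) auto
  show "integrable std_normal_distribution (\<lambda>x. exp (a * x))"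
    unfolding eq using 2 by (rule integrable_mult_right)
  have "(\<integral>x. 1 \<partial>density std_normal_distribution (\<lambda>x. ennreal (exp (a * x - a\<^sup>2 / 2))))
      = (\<integral>x. exp (a * x - a\<^sup>2 / 2) *\<^sub>R (1::real) \<partial>std_normal_distribution)"
    by (rule integral_density) auto
  then have 3: "(\<integral>x. exp (a * x - a\<^sup>2 / 2) \<partial>std_normal_distribution) = 1"
    by (simp add: P.prob_space[simplified])
  show "(\<integral>x. exp (a * x) \<partial>std_normal_distribution) = exp (a\<^sup>2 / 2)"
    unfolding eq[abs_def] by (simp add: 3)
qed

lemma gauss_exp_moment:
  assumes I: "finite I"
  shows "integrable (gauss I) (\<lambda>z. exp (\<Sum>i\<in>I. a i * z i))"
    and "(\<integral>z. exp (\<Sum>i\<in>I. a i * z i) \<partial>gauss I) = exp ((\<Sum>i\<in>I. (a i)\<^sup>2) / 2)"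
proof -
  interpret product_sigma_finite "\<lambda>i::nat. std_normal_distribution"
    by (simp add: product_sigma_finite_def std_normal.sigma_finite_measure_axioms)
  have eq: "exp (\<Sum>i\<in>I. a i * z i) = (\<Prod>i\<in>I. exp (a i * z i))" for z
    using I by (simp add: exp_sum)
  show "integrable (gauss I) (\<lambda>z. exp (\<Sum>i\<in>I. a i * z i))"
    unfolding eq gauss_def using std_normal_exp_moment by (intro product_integrable_prod I) auto
  have "(\<integral>z. exp (\<Sum>i\<in>I. a i * z i) \<partial>gauss I) = (\<Prod>i\<in>I. exp ((a i)\<^sup>2 / 2))"
    unfolding eq gauss_def using std_normal_exp_moment
    by (subst product_integral_prod[OF I, where f = "\<lambda>i x. exp (a i * x)"]) auto
  then show "(\<integral>z. exp (\<Sum>i\<in>I. a i * z i) \<partial>gauss I) = exp ((\<Sum>i\<in>I. (a i)\<^sup>2) / 2)"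
    using I by (simp add: exp_sum sum_divide_distrib)
qed

lemma gauss_char:
  assumes I: "finite I"
  shows "(\<integral>z. iexp (\<Sum>i\<in>I. a i * z i) \<partial>gauss I) = complex_of_real (exp (- (\<Sum>i\<in>I. (a i)\<^sup>2) / 2))"
proof -
  interpret product_sigma_finite "\<lambda>i::nat. std_normal_distribution"
    by (simp add: product_sigma_finite_def std_normal.sigma_finite_measure_axioms)
  have eq: "iexp (\<Sum>i\<in>I. a i * z i) = (\<Prod>i\<in>I. iexp (a i * z i))" for z
    using I by (simp add: exp_sum sum_distrib_left)
  have "(\<integral>z. iexp (\<Sum>i\<in>I. a i * z i) \<partial>gauss I) = (\<Prod>i\<in>I. char std_normal_distribution (a i))"
    unfolding eq gauss_def char_def
    by (subst product_integral_prod[OF I, where f = "\<lambda>i x. iexp (a i * x)"])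
       (auto intro!: std_normal.integrable_const_bound[where B=1])
  also have "\<dots> = complex_of_real (\<Prod>i\<in>I. exp (- (a i)\<^sup>2 / 2))"
    by (simp add: char_std_normal_distribution)
  also have "\<dots> = complex_of_real (exp (- (\<Sum>i\<in>I. (a i)\<^sup>2) / 2))"
    using I by (simp add: exp_sum[symmetric] sum_divide_distrib sum_negf[symmetric] del: of_real_exp)
  finally show ?thesis .
qed

section \<open>Bounds for tests from the Hellinger affinity\<close>

lemma hellinger_test_bound:
  fixes F r :: "'a \<Rightarrow> real"
  assumes P: "prob_space P" and Q: "prob_space (density P (\<lambda>x. ennreal (r x)))"
    and [measurable]: "r \<in> borel_measurable P" "F \<in> borel_measurable P"
    and r0: "\<And>x. 0 \<le> r x" and F: "\<And>x. x \<in> space P \<Longrightarrow> 0 \<le> F x \<and> F x \<le> 1" and c: "0 < c"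
  shows "\<bar>(\<integral>x. F x \<partial>P) - (\<integral>x. F x \<partial>density P (\<lambda>x. ennreal (r x)))\<bar>
      \<le> 2 * c + (1 - (\<integral>x. sqrt (r x) \<partial>P)) / c"
proof -
  interpret P: prob_space P by (rule P)
  interpret Q: prob_space "density P (\<lambda>x. ennreal (r x))" by (rule Q)
  have 1: "integrable (density P (\<lambda>x. ennreal (r x))) (\<lambda>_. 1::real)" by simp
  then have ir[simp]: "integrable P r"
    using r0 by (subst (asm) integrable_density) auto
  have "(\<integral>x. 1 \<partial>density P (\<lambda>x. ennreal (r x))) = (\<integral>x. r x *\<^sub>R (1::real) \<partial>P)"
    using r0 by (intro integral_density) auto
  then have r1: "(\<integral>x. r x \<partial>P) = 1"
    using Q.prob_space by simp
  have isq[simp]: "integrable P (\<lambda>x. sqrt (r x))"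
  proof (rule Bochner_Integration.integrable_bound[where f="\<lambda>x. 1 + r x"])
    show "AE x in P. norm (sqrt (r x)) \<le> norm (1 + r x)"
    proof (rule AE_I2)
      fix x
      have "sqrt (r x) \<le> 1 + r x"
        using r0[of x] by (intro real_le_lsqrt) (auto simp: power2_eq_square algebra_simps)
      then show "norm (sqrt (r x)) \<le> norm (1 + r x)" using r0[of x] by simp
    qed
  qed auto
  have F_abs: "\<bar>F x\<bar> \<le> 1" if "x \<in> space P" for x using F[OF that] by simp
  have iF: "integrable P F"
    using F_abs by (intro P.integrable_const_bound[where B=1]) auto
  have irF: "integrable P (\<lambda>x. r x * F x)"
    by (rule Bochner_Integration.integrable_bound[OF ir])
       (use F_abs r0 in \<open>auto simp: abs_mult intro!: AE_I2 mult_left_le\<close>)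
  \<comment> \<open>With s = sqrt r the left side is at most |1 - s| (1 + s). Young's inequality
    with a free weight \<open>c\<close> takes the place of Cauchy-Schwarz: the resulting bound is
    affine in the Hellinger deficit, so errors from several comparisons can be added and
    \<open>c\<close> is fixed only at the very end.\<close>
  have pt: "\<bar>F x - r x * F x\<bar> \<le> ((1 + r x - 2 * sqrt (r x)) / c + 2 * c * (1 + r x)) / 2"
    if x: "x \<in> space P" for x
  proof -
    define s where "s = sqrt (r x)"
    have s: "0 \<le> s" "r x = s\<^sup>2" using r0[of x] by (auto simp: s_def)
    have "F x - r x * F x = (1 - s) * (1 + s) * F x"
      unfolding s(2) by (simp add: power2_eq_square algebra_simps)
    then have "\<bar>F x - r x * F x\<bar> \<le> \<bar>1 - s\<bar> * (1 + s)"
      using F_abs[OF x] s by (simp add: abs_mult mult_left_le)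
    also have "\<dots> \<le> ((1 - s)\<^sup>2 / c + c * (1 + s)\<^sup>2) / 2"
    proof -
      have "0 \<le> (\<bar>1 - s\<bar> - c * (1 + s))\<^sup>2 / c" using c by simp
      also have "\<dots> = (1 - s)\<^sup>2 / c + c * (1 + s)\<^sup>2 - 2 * (\<bar>1 - s\<bar> * (1 + s))"
      proof -
        have "(\<bar>1 - s\<bar> - c * (1 + s))\<^sup>2 = (1 - s)\<^sup>2 + c * (c * (1 + s)\<^sup>2 - 2 * (\<bar>1 - s\<bar> * (1 + s)))"
          unfolding power2_diff by (simp add: power2_eq_square algebra_simps)
        then show ?thesis using c by (simp add: add_divide_distrib)
      qed
      finally show ?thesis by simp
    qed
    also have "c * (1 + s)\<^sup>2 \<le> 2 * c * (1 + r x)"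
    proof -
      have "0 \<le> (1 - s)\<^sup>2" by simp
      then have "(1 + s)\<^sup>2 \<le> 2 * (1 + s\<^sup>2)" by (simp add: power2_eq_square algebra_simps)
      then show ?thesis using c s by (simp add: mult.assoc mult.left_commute)
    qed
    also have "(1 - s)\<^sup>2 = 1 + s\<^sup>2 - 2 * s"
      by (simp add: power2_eq_square algebra_simps)
    also have "\<dots> = 1 + r x - 2 * sqrt (r x)"
      by (simp add: s_def r0)
    finally show ?thesis by (simp add: divide_right_mono)
  qed
  have "(\<integral>x. F x \<partial>density P (\<lambda>x. ennreal (r x))) = (\<integral>x. r x * F x \<partial>P)"
    using r0 by (subst integral_density) auto
  then have "\<bar>(\<integral>x. F x \<partial>P) - (\<integral>x. F x \<partial>density P (\<lambda>x. ennreal (r x)))\<bar>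
      = \<bar>\<integral>x. F x - r x * F x \<partial>P\<bar>"
    using iF irF by simp
  also have "\<dots> \<le> (\<integral>x. \<bar>F x - r x * F x\<bar> \<partial>P)"
    by (rule integral_abs_bound)
  also have "\<dots> \<le> (\<integral>x. ((1 + r x - 2 * sqrt (r x)) / c + 2 * c * (1 + r x)) / 2 \<partial>P)"
    using iF irF pt by (intro integral_mono) auto
  also have "\<dots> = 2 * c + (1 - (\<integral>x. sqrt (r x) \<partial>P)) / c"
    using r1 P.prob_space c by (simp add: field_simps)
  finally show ?thesis .
qed

lemma distr_std_normal_scale:
  assumes s: "0 < s"
  shows "distr std_normal_distribution borel (\<lambda>x. s * x) = density lborel (\<lambda>x. ennreal (normal_density 0 s x))"
proof -
  have "distributed std_normal_distribution lborel (\<lambda>x. x) (\<lambda>x. ennreal (normal_density 0 1 x))"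
    by (auto simp: distributed_def distr_id2)
  from std_normal.normal_density_affine[OF this, of s 0] s
  have "distr std_normal_distribution lborel (\<lambda>x. s * x) = density lborel (\<lambda>x. ennreal (normal_density 0 s x))"
    by (simp add: distributed_def)
  moreover have "distr std_normal_distribution lborel (\<lambda>x. s * x) = distr std_normal_distribution borel (\<lambda>x. s * x)"
    by (intro distr_cong) auto
  ultimately show ?thesis by simp
qed

text \<open>The geometric mean of two centred normal densities is a multiple of a third one, and
  that multiple is the affinity.\<close>

lemma normal_hellinger_affinity:
  assumes s: "0 < s" and t: "0 < t"
  shows "(\<integral>x. sqrt (normal_density 0 t x / normal_density 0 s x) \<partial>density lborel (\<lambda>x. ennreal (normal_density 0 s x)))
       = sqrt (2 * s * t / (s\<^sup>2 + t\<^sup>2))"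
proof -
  \<comment> \<open>The reciprocal of \<open>q\<close> squared is the mean of the reciprocals of the
    two variances, as averaging the two exponents demands.\<close>
  define q where "q = sqrt (2 * s\<^sup>2 * t\<^sup>2 / (s\<^sup>2 + t\<^sup>2))"
  have st: "0 < s\<^sup>2 + t\<^sup>2" using s by (simp add: add_pos_nonneg)
  have q: "0 < q" and q2: "q\<^sup>2 = 2 * s\<^sup>2 * t\<^sup>2 / (s\<^sup>2 + t\<^sup>2)"
    unfolding q_def using s t st by (auto intro!: divide_pos_pos)
  have pt: "normal_density 0 s x * sqrt (normal_density 0 t x / normal_density 0 s x)
      = sqrt (2 * s * t / (s\<^sup>2 + t\<^sup>2)) * normal_density 0 q x" for x
  proof -
    have "(normal_density 0 s x * sqrt (normal_density 0 t x / normal_density 0 s x))\<^sup>2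
        = normal_density 0 s x * normal_density 0 t x"
    proof -
      have p: "0 < normal_density 0 s x" "0 < normal_density 0 t x"
        using normal_density_pos s t by auto
      then have "(sqrt (normal_density 0 t x / normal_density 0 s x))\<^sup>2 = normal_density 0 t x / normal_density 0 s x"
        by (intro real_sqrt_pow2) simp
      note eq = this
      show ?thesis unfolding power_mult_distrib eq using p by (simp add: power2_eq_square)
    qed
    also have "\<dots> = (1 / (sqrt (2 * pi * s\<^sup>2) * sqrt (2 * pi * t\<^sup>2))) * exp (- x\<^sup>2 / (2 * s\<^sup>2) + - x\<^sup>2 / (2 * t\<^sup>2))"
      unfolding normal_density_def exp_add by simp
    also have "sqrt (2 * pi * s\<^sup>2) * sqrt (2 * pi * t\<^sup>2) = 2 * pi * s * t"
    proof -
      have "sqrt (2 * pi * s\<^sup>2) * sqrt (2 * pi * t\<^sup>2) = sqrt ((2 * pi * s * t)\<^sup>2)"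
        unfolding real_sqrt_mult[symmetric] by (simp add: power2_eq_square algebra_simps)
      then show ?thesis using s t by simp
    qed
    also have "- x\<^sup>2 / (2 * s\<^sup>2) + - x\<^sup>2 / (2 * t\<^sup>2) = 2 * (- x\<^sup>2 / (2 * q\<^sup>2))"
      unfolding q2 using s t st by (simp add: field_simps)
    also have "1 / (2 * pi * s * t) = (2 * s * t / (s\<^sup>2 + t\<^sup>2)) * (1 / (2 * pi * q\<^sup>2))"
    proof -
      have eq: "1 / (2 * pi * a) = (2 * a / d) * (1 / (2 * pi * (2 * a\<^sup>2 / d)))" if "a \<noteq> 0" "d \<noteq> 0" for a d :: real
        using that by (simp add: power2_eq_square)
      show ?thesis
        using eq[of "s * t" "s\<^sup>2 + t\<^sup>2"] s t st unfolding q2 by (simp only: power_mult_distrib mult.assoc) simp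
    qed
    also have "(2 * s * t / (s\<^sup>2 + t\<^sup>2)) * (1 / (2 * pi * q\<^sup>2)) * exp (2 * (- x\<^sup>2 / (2 * q\<^sup>2)))
        = (sqrt (2 * s * t / (s\<^sup>2 + t\<^sup>2)) * normal_density 0 q x)\<^sup>2"
    proof -
      have A: "(sqrt (2 * s * t / (s\<^sup>2 + t\<^sup>2)))\<^sup>2 = 2 * s * t / (s\<^sup>2 + t\<^sup>2)"
        using s t st by (intro real_sqrt_pow2 divide_nonneg_pos) auto
      have B: "(1 / sqrt (2 * pi * q\<^sup>2))\<^sup>2 = 1 / (2 * pi * q\<^sup>2)"
        by (simp add: power_divide)
      show ?thesis
        unfolding exp_double normal_density_def power_mult_distrib A B by simp
    qed
    finally show ?thesis
      using normal_density_nonneg s t st by (subst (asm) power2_eq_iff_nonneg) (auto intro!: mult_nonneg_nonneg)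
  qed
  have "(\<integral>x. sqrt (normal_density 0 t x / normal_density 0 s x) \<partial>density lborel (\<lambda>x. ennreal (normal_density 0 s x)))
      = (\<integral>x. sqrt (2 * s * t / (s\<^sup>2 + t\<^sup>2)) * normal_density 0 q x \<partial>lborel)"
    by (subst integral_density) (auto simp: pt)
  also have "\<dots> = sqrt (2 * s * t / (s\<^sup>2 + t\<^sup>2))"
    using q by (simp add: integral_normal_density)
  finally show ?thesis .
qed

lemma one_minus_prod_le:
  fixes a :: "'i \<Rightarrow> real"
  assumes "finite I" "\<And>i. i \<in> I \<Longrightarrow> 0 \<le> a i \<and> a i \<le> 1"
  shows "1 - (\<Prod>i\<in>I. a i) \<le> (\<Sum>i\<in>I. 1 - a i)"
  using assms
proof (induction I rule: finite_induct)
  case (insert j I)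
  have p: "0 \<le> prod a I" "prod a I \<le> 1" using insert by (auto intro!: prod_nonneg prod_le_1)
  have "1 - a j * prod a I = (1 - a j) * prod a I + (1 - prod a I)" by (simp add: algebra_simps)
  also have "(1 - a j) * prod a I \<le> 1 - a j" using insert.prems[of j] p by (intro mult_left_le) auto
  finally show ?case using insert by simp
qed simp

text \<open>The affinity of a product is the product of the affinities, and one minus a product is
  at most the sum of the deficits. Each deficit has the form 1 - sqrt a with a in [0, 1], hence is
  at most 1 - a, which is exactly the summand on the right.\<close>

lemma gauss_scale_test_bound:
  fixes F :: "(nat \<Rightarrow> real) \<Rightarrow> real"
  assumes I: "finite I" and st: "\<And>i. i \<in> I \<Longrightarrow> 0 < s i \<and> 0 < t i"
    and F[measurable]: "F \<in> borel_measurable (PiM I (\<lambda>_. borel))"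
    and F01: "\<And>x. x \<in> space (PiM I (\<lambda>_. borel :: real measure)) \<Longrightarrow> 0 \<le> F x \<and> F x \<le> 1" and c: "0 < c"
  shows "\<bar>(\<integral>z. F (\<lambda>i\<in>I. s i * z i) \<partial>gauss I) - (\<integral>z. F (\<lambda>i\<in>I. t i * z i) \<partial>gauss I)\<bar>
      \<le> 2 * c + (\<Sum>i\<in>I. (s i - t i)\<^sup>2 / ((s i)\<^sup>2 + (t i)\<^sup>2)) / c"
proof -
  \<comment> \<open>The value 1 off \<open>I\<close> makes every factor a probability measure,
    because the product constructions quantify over all indices.\<close>
  define s' t' where "s' = (\<lambda>i. if i \<in> I then s i else 1)" and "t' = (\<lambda>i. if i \<in> I then t i else 1)"
  have pos: "0 < s' i" "0 < t' i" for i using st by (auto simp: s'_def t'_def)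
  define N where "N = (\<lambda>s. density lborel (\<lambda>x. ennreal (normal_density 0 s x)))"
  define r where "r = (\<lambda>i x. normal_density 0 (t' i) x / normal_density 0 (s' i) x)"
  have r0: "0 \<le> r i x" for i x by (auto simp: r_def normal_density_nonneg)
  have [measurable]: "r i \<in> borel_measurable borel" for i by (auto simp: r_def)
  have setsN[simp, measurable_cong]: "sets (N a) = sets borel" for a by (simp add: N_def)
  have prob: "prob_space (N a)" if "0 < a" for a
    unfolding N_def distr_std_normal_scale[OF that, symmetric] by (intro std_normal.prob_space_distr) auto
  have Nr: "N (t' i) = density (N (s' i)) (\<lambda>x. ennreal (r i x))" for i
  proof -
    have "normal_density 0 (t' i) x = normal_density 0 (s' i) x * r i x" for x
      using normal_density_pos[OF pos(1)[of i], of 0 x] by (simp add: r_def)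
    then show ?thesis
      unfolding N_def by (subst density_density_eq) (auto simp: ennreal_mult[symmetric] r0)
  qed
  have scale: "(\<integral>z. F (\<lambda>i\<in>I. a i * z i) \<partial>gauss I) = (\<integral>x. F x \<partial>PiM I (\<lambda>i. N (a' i)))"
    if "\<And>i. 0 < a' i" "\<And>i. i \<in> I \<Longrightarrow> a' i = a i" for a a'
  proof -
    have "(\<integral>z. F (\<lambda>i\<in>I. a i * z i) \<partial>gauss I) = (\<integral>z. F (\<lambda>i\<in>I. a' i * z i) \<partial>gauss I)"
      using that(2) by (auto cong: restrict_cong)
    also have "\<dots> = (\<integral>x. F x \<partial>distr (gauss I) (PiM I (\<lambda>_. borel)) (\<lambda>z. \<lambda>i\<in>I. a' i * z i))"
      by (subst integral_distr) auto
    also have "distr (gauss I) (PiM I (\<lambda>_. borel)) (\<lambda>z. \<lambda>i\<in>I. a' i * z i)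
        = PiM I (\<lambda>i. distr std_normal_distribution borel (\<lambda>x. a' i * x))"
      unfolding gauss_def by (rule distr_PiM_componentwise[OF I]) (auto intro: std_normal.prob_space_axioms)
    also have "\<dots> = PiM I (\<lambda>i. N (a' i))"
      using that(1) by (simp add: distr_std_normal_scale N_def)
    finally show ?thesis .
  qed
  have Pt: "PiM I (\<lambda>i. N (t' i)) = density (PiM I (\<lambda>i. N (s' i))) (\<lambda>x. ennreal (\<Prod>i\<in>I. r i (x i)))"
  proof -
    have "PiM I (\<lambda>i. N (t' i)) = PiM I (\<lambda>i. density (N (s' i)) (\<lambda>x. ennreal (r i x)))" by (simp add: Nr)
    also have "\<dots> = density (PiM I (\<lambda>i. N (s' i))) (\<lambda>x. \<Prod>i\<in>I. ennreal (r i (x i)))"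
      by (rule PiM_density[OF I]) (auto simp: Nr[symmetric] prob pos prob_space_imp_sigma_finite)
    finally show ?thesis by (simp add: prod_ennreal r0)
  qed
  have PiM_sets[measurable_cong]: "sets (PiM I (\<lambda>i. N (s' i))) = sets (PiM I (\<lambda>_. borel))"
    by (intro sets_PiM_cong) auto
  have sp: "space (PiM I (\<lambda>i. N (s' i))) = space (PiM I (\<lambda>_. borel :: real measure))"
    by (rule sets_eq_imp_space_eq[OF PiM_sets])
  interpret product_sigma_finite "\<lambda>i. N (s' i)"
    using prob pos by (simp add: product_sigma_finite_def prob_space_imp_sigma_finite)
  have "(\<integral>x. sqrt (\<Prod>i\<in>I. r i (x i)) \<partial>PiM I (\<lambda>i. N (s' i)))
      = (\<integral>x. (\<Prod>i\<in>I. sqrt (r i (x i))) \<partial>PiM I (\<lambda>i. N (s' i)))"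
  proof -
    have "sqrt (\<Prod>i\<in>I. a i) = (\<Prod>i\<in>I. sqrt (a i))" for a :: "nat \<Rightarrow> real"
      using I by (induction I rule: finite_induct) (auto simp: real_sqrt_mult)
    then show ?thesis by simp
  qed
  also have "\<dots> = (\<Prod>i\<in>I. \<integral>x. sqrt (r i x) \<partial>N (s' i))"
  proof (rule product_integral_prod[OF I])
    fix i assume "i \<in> I"
    \<comment> \<open>Integrability comes from the value: the Bochner integral of a function that is
      not integrable is 0, and the affinity is positive.\<close>
    have ne: "(\<integral>x. sqrt (r i x) \<partial>N (s' i)) = sqrt (2 * s' i * t' i / ((s' i)\<^sup>2 + (t' i)\<^sup>2))"
      unfolding r_def N_def by (rule normal_hellinger_affinity[OF pos])
    also have "\<dots> \<noteq> 0" using pos[of i] by (auto simp: add_pos_pos less_imp_neq[THEN not_sym] add_nonneg_eq_0_iff)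
    finally show "integrable (N (s' i)) (\<lambda>x. sqrt (r i x))"
      using not_integrable_integral_eq by blast
  qed
  also have "\<dots> = (\<Prod>i\<in>I. sqrt (2 * s' i * t' i / ((s' i)\<^sup>2 + (t' i)\<^sup>2)))"
    unfolding r_def N_def by (simp add: normal_hellinger_affinity[OF pos])
  finally have rho: "(\<integral>x. sqrt (\<Prod>i\<in>I. r i (x i)) \<partial>PiM I (\<lambda>i. N (s' i)))
      = (\<Prod>i\<in>I. sqrt (2 * s' i * t' i / ((s' i)\<^sup>2 + (t' i)\<^sup>2)))" .
  have aff: "0 \<le> sqrt (2 * s' i * t' i / ((s' i)\<^sup>2 + (t' i)\<^sup>2)) \<and> sqrt (2 * s' i * t' i / ((s' i)\<^sup>2 + (t' i)\<^sup>2)) \<le> 1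
     \<and> 1 - sqrt (2 * s' i * t' i / ((s' i)\<^sup>2 + (t' i)\<^sup>2)) \<le> (s' i - t' i)\<^sup>2 / ((s' i)\<^sup>2 + (t' i)\<^sup>2)" for i
  proof -
    define a where "a = 2 * s' i * t' i / ((s' i)\<^sup>2 + (t' i)\<^sup>2)"
    have d: "0 < (s' i)\<^sup>2 + (t' i)\<^sup>2" using pos[of i] by (simp add: add_pos_pos)
    have e: "(s' i - t' i)\<^sup>2 / ((s' i)\<^sup>2 + (t' i)\<^sup>2) = 1 - a"
    proof -
      have "(s' i - t' i)\<^sup>2 = ((s' i)\<^sup>2 + (t' i)\<^sup>2) - 2 * s' i * t' i"
        by (simp add: power2_eq_square algebra_simps)
      then show ?thesis using d pos[of i] by (simp add: a_def diff_divide_distrib)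
    qed
    have a0: "0 \<le> a" using d pos[of i] by (simp add: a_def)
    have "0 \<le> (s' i - t' i)\<^sup>2 / ((s' i)\<^sup>2 + (t' i)\<^sup>2)" using d by simp
    then have a1: "a \<le> 1" unfolding e by simp
    have "a \<le> sqrt a" using a0 a1 by (intro real_le_rsqrt) (simp add: power2_eq_square mult_left_le)
    then show ?thesis unfolding e a_def[symmetric] using a0 a1 by simp
  qed
  have prob_s: "prob_space (PiM I (\<lambda>i. N (s' i)))" "prob_space (PiM I (\<lambda>i. N (t' i)))"
    using prob pos by (auto intro!: prob_space_PiM)
  have "(\<integral>z. F (\<lambda>i\<in>I. s i * z i) \<partial>gauss I) = (\<integral>x. F x \<partial>PiM I (\<lambda>i. N (s' i)))"
    by (rule scale) (use st in \<open>auto simp: s'_def\<close>)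
  moreover have "(\<integral>z. F (\<lambda>i\<in>I. t i * z i) \<partial>gauss I) = (\<integral>x. F x \<partial>PiM I (\<lambda>i. N (t' i)))"
    by (rule scale) (use st in \<open>auto simp: t'_def\<close>)
  moreover have "\<bar>(\<integral>x. F x \<partial>PiM I (\<lambda>i. N (s' i))) - (\<integral>x. F x \<partial>PiM I (\<lambda>i. N (t' i)))\<bar>
      \<le> 2 * c + (1 - (\<integral>x. sqrt (\<Prod>i\<in>I. r i (x i)) \<partial>PiM I (\<lambda>i. N (s' i)))) / c"
    unfolding Pt
    using prob_s c F01 r0 by (intro hellinger_test_bound) (auto simp: Pt[symmetric] sp intro!: prod_nonneg)
  moreover have "(1 - (\<integral>x. sqrt (\<Prod>i\<in>I. r i (x i)) \<partial>PiM I (\<lambda>i. N (s' i)))) / c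
      \<le> (\<Sum>i\<in>I. (s i - t i)\<^sup>2 / ((s i)\<^sup>2 + (t i)\<^sup>2)) / c"
  proof (rule divide_right_mono)
    have "1 - (\<integral>x. sqrt (\<Prod>i\<in>I. r i (x i)) \<partial>PiM I (\<lambda>i. N (s' i)))
        \<le> (\<Sum>i\<in>I. 1 - sqrt (2 * s' i * t' i / ((s' i)\<^sup>2 + (t' i)\<^sup>2)))"
      unfolding rho using aff by (intro one_minus_prod_le I) auto
    also have "\<dots> \<le> (\<Sum>i\<in>I. (s' i - t' i)\<^sup>2 / ((s' i)\<^sup>2 + (t' i)\<^sup>2))"
      using aff by (intro sum_mono) auto
    also have "\<dots> = (\<Sum>i\<in>I. (s i - t i)\<^sup>2 / ((s i)\<^sup>2 + (t i)\<^sup>2))"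
      by (intro sum.cong) (auto simp: s'_def t'_def)
    finally show "1 - (\<integral>x. sqrt (\<Prod>i\<in>I. r i (x i)) \<partial>PiM I (\<lambda>i. N (s' i)))
        \<le> (\<Sum>i\<in>I. (s i - t i)\<^sup>2 / ((s i)\<^sup>2 + (t i)\<^sup>2))" .
  qed (use c in simp)
  ultimately show ?thesis by linarith
qed

section \<open>Characteristic functions and passage to the limit\<close>

definition vchar :: "nat set \<Rightarrow> (nat \<Rightarrow> real) measure \<Rightarrow> (nat \<Rightarrow> real) \<Rightarrow> complex" where
  "vchar I P u = (\<integral>x. iexp (\<Sum>i\<in>I. u i * x i) \<partial>P)"

definition prob_vec :: "nat set \<Rightarrow> (nat \<Rightarrow> real) measure \<Rightarrow> bool" where
  "prob_vec I P \<longleftrightarrow> finite I \<and> prob_space P \<and> sets P = sets (PiM I (\<lambda>_. borel))"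

text \<open>Density of the law of X + s Z with respect to the law of s Z, evaluated at the point s
  z, where X has law \<open>P\<close> and Z is an independent standard Gaussian vector.\<close>

definition gauss_shift_density :: "nat set \<Rightarrow> real \<Rightarrow> (nat \<Rightarrow> real) measure \<Rightarrow> (nat \<Rightarrow> real) \<Rightarrow> real" where
  "gauss_shift_density I s P z = (\<integral>x. exp (\<Sum>i\<in>I. x i / s * z i - (x i / s)\<^sup>2 / 2) \<partial>P)"

lemma prob_vecD:
  assumes "prob_vec I P"
  shows "finite I" "prob_space P" "sets P = sets (PiM I (\<lambda>_. borel))"
    "space P = space (PiM I (\<lambda>_. borel :: real measure))"
  using assms by (auto simp: prob_vec_def intro!: sets_eq_imp_space_eq)

lemma pair_sigma_finite_prob: "prob_space A \<Longrightarrow> prob_space B \<Longrightarrow> pair_sigma_finite A B"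
  by (simp add: pair_sigma_finite_def prob_space_imp_sigma_finite)

lemma integrable_pair_bounded:
  fixes f :: "'a \<times> 'b \<Rightarrow> 'c::{banach, second_countable_topology}"
  assumes "prob_space A" "prob_space B" and "f \<in> borel_measurable (A \<Otimes>\<^sub>M B)"
    and "\<And>x y. x \<in> space A \<Longrightarrow> y \<in> space B \<Longrightarrow> norm (f (x, y)) \<le> K"
  shows "integrable (A \<Otimes>\<^sub>M B) f"
proof -
  interpret AB: prob_space "A \<Otimes>\<^sub>M B"
    using assms by (intro prob_space_pair)
  show ?thesis
    using assms by (intro AB.integrable_const_bound[where B=K]) (auto simp: space_pair_measure)
qed

lemma Fubini_bounded:
  fixes f :: "'a \<Rightarrow> 'b \<Rightarrow> 'c::{banach, second_countable_topology}"
  assumes "prob_space A" "prob_space B" and "case_prod f \<in> borel_measurable (A \<Otimes>\<^sub>M B)"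
    and "\<And>x y. x \<in> space A \<Longrightarrow> y \<in> space B \<Longrightarrow> norm (f x y) \<le> K"
  shows "(\<integral>x. \<integral>y. f x y \<partial>B \<partial>A) = (\<integral>y. \<integral>x. f x y \<partial>A \<partial>B)"
proof -
  interpret pair_sigma_finite A B using assms by (intro pair_sigma_finite_prob)
  show ?thesis
    using assms by (intro Fubini_integral[symmetric] integrable_pair_bounded[where K=K]) auto
qed

text \<open>exp(-|x/s - z|^2 / 2) is a Gaussian average of characters; exchanging the integrals
  exposes the characteristic function of \<open>P\<close>. The smoothed density is thus an integral
  of \<open>vchar\<close> against a fixed finite measure, which is what makes it stable under
  pointwise convergence of characteristic functions.\<close>

lemma gauss_shift_density_vchar:
  assumes P: "prob_vec I P"
  shows "complex_of_real (gauss_shift_density I s P z)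
    = complex_of_real (exp ((\<Sum>i\<in>I. (z i)\<^sup>2) / 2)) * (\<integral>u. iexp (\<Sum>i\<in>I. - z i * u i) * vchar I P (\<lambda>i. u i / s) \<partial>gauss I)"
proof -
  note [measurable_cong] = prob_vecD(3)[OF P]
  have I: "finite I" and pP: "prob_space P" using prob_vecD[OF P] by auto
  have 1: "complex_of_real (exp (\<Sum>i\<in>I. x i / s * z i - (x i / s)\<^sup>2 / 2))
      = complex_of_real (exp ((\<Sum>i\<in>I. (z i)\<^sup>2) / 2)) * (\<integral>u. iexp (\<Sum>i\<in>I. (x i / s - z i) * u i) \<partial>gauss I)" for x :: "nat \<Rightarrow> real"
  proof -
    have "(\<Sum>i\<in>I. x i / s * z i - (x i / s)\<^sup>2 / 2) = (\<Sum>i\<in>I. (z i)\<^sup>2) / 2 + - (\<Sum>i\<in>I. (x i / s - z i)\<^sup>2) / 2"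
      by (simp add: sum_divide_distrib sum_negf[symmetric] sum.distrib[symmetric] power2_diff diff_divide_distrib add_divide_distrib)
    then show ?thesis
      unfolding gauss_char[OF I] by (simp only: exp_add of_real_mult)
  qed
  have "complex_of_real (gauss_shift_density I s P z)
      = (\<integral>x. complex_of_real (exp (\<Sum>i\<in>I. x i / s * z i - (x i / s)\<^sup>2 / 2)) \<partial>P)"
    by (simp add: gauss_shift_density_def)
  also have "\<dots> = exp ((\<Sum>i\<in>I. (z i)\<^sup>2) / 2) * (\<integral>x. \<integral>u. iexp (\<Sum>i\<in>I. (x i / s - z i) * u i) \<partial>gauss I \<partial>P)"
    unfolding 1 by simp
  also have "(\<integral>x. \<integral>u. iexp (\<Sum>i\<in>I. (x i / s - z i) * u i) \<partial>gauss I \<partial>P)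
      = (\<integral>u. \<integral>x. iexp (\<Sum>i\<in>I. (x i / s - z i) * u i) \<partial>P \<partial>gauss I)"
    by (rule Fubini_bounded[where K=1]) (auto simp: pP prob_space_gauss)
  also have "\<dots> = (\<integral>u. iexp (\<Sum>i\<in>I. - z i * u i) * vchar I P (\<lambda>i. u i / s) \<partial>gauss I)"
  proof (rule Bochner_Integration.integral_cong[OF refl])
    fix u
    have "iexp (\<Sum>i\<in>I. (x i / s - z i) * u i) = iexp (\<Sum>i\<in>I. - z i * u i) * iexp (\<Sum>i\<in>I. u i / s * x i)" for x :: "nat \<Rightarrow> real"
      unfolding exp_add[symmetric] distrib_left[symmetric] of_real_add[symmetric] sum.distrib[symmetric]
      by (simp add: algebra_simps)
    then show "(\<integral>x. iexp (\<Sum>i\<in>I. (x i / s - z i) * u i) \<partial>P) = iexp (\<Sum>i\<in>I. - z i * u i) * vchar I P (\<lambda>i. u i / s)"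
      unfolding vchar_def by simp
  qed
  finally show ?thesis .
qed

text \<open>For fixed x the translation formula with shift x/s moves the noise back to the origin,
  and integrating over x collects the exponential factors. The kernel is positive with mean one in z
  for every x, which supplies the integrability for Fubini.\<close>

lemma gauss_shift_density:
  fixes F :: "(nat \<Rightarrow> real) \<Rightarrow> real"
  assumes P: "prob_vec I P" and s: "0 < s"
    and F[measurable]: "F \<in> borel_measurable (PiM I (\<lambda>_. borel))"
    and F_bd: "\<And>x. x \<in> space (PiM I (\<lambda>_. borel :: real measure)) \<Longrightarrow> \<bar>F x\<bar> \<le> K"
  shows "(\<integral>x. \<integral>z. F (\<lambda>i\<in>I. x i + s * z i) \<partial>gauss I \<partial>P)
      = (\<integral>z. gauss_shift_density I s P z * F (\<lambda>i\<in>I. s * z i) \<partial>gauss I)"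
    and "integrable (gauss I) (gauss_shift_density I s P)"
proof -
  note [measurable_cong] = prob_vecD(3)[OF P]
  have I: "finite I" and pP: "prob_space P" using prob_vecD[OF P] by auto
  interpret P: prob_space P by (rule pP)
  interpret G: prob_space "gauss I" by (rule prob_space_gauss)
  interpret PG: pair_sigma_finite P "gauss I" by (rule pair_sigma_finite_prob) (unfold_locales)
  define e where "e = (\<lambda>(x :: nat \<Rightarrow> real) z. exp (\<Sum>i\<in>I. x i / s * z i - (x i / s)\<^sup>2 / 2))"
  have e_eq: "e x z = exp (- (\<Sum>i\<in>I. (x i / s)\<^sup>2 / 2)) * exp (\<Sum>i\<in>I. x i / s * z i)" for x z
    unfolding e_def exp_add[symmetric] by (simp add: sum_subtractf)
  have e_int: "integrable (gauss I) (e x)" "(\<integral>z. e x z \<partial>gauss I) = 1" for x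
  proof -
    have "integrable (gauss I) (\<lambda>z. exp (- (\<Sum>i\<in>I. (x i / s)\<^sup>2 / 2)) * exp (\<Sum>i\<in>I. x i / s * z i))"
      by (intro integrable_mult_right gauss_exp_moment I)
    then show "integrable (gauss I) (e x)" by (simp only: e_eq[abs_def])
    show "(\<integral>z. e x z \<partial>gauss I) = 1"
      unfolding e_eq integral_mult_right_zero gauss_exp_moment(2)[OF I]
      by (simp only: exp_add[symmetric] sum_divide_distrib) simp
  qed
  have [measurable]: "(\<lambda>(x, z). e x z) \<in> borel_measurable (P \<Otimes>\<^sub>M gauss I)"
    unfolding e_def by measurable
  have e_pair: "integrable (P \<Otimes>\<^sub>M gauss I) (\<lambda>(x, z). e x z)"
  proof (rule PG.Fubini_integrable)
    have "\<bar>e x z\<bar> = e x z" for x z by (simp add: e_def)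
    then show "integrable P (\<lambda>x. \<integral>z. norm (case (x, z) of (x, z) \<Rightarrow> e x z) \<partial>gauss I)"
      by (simp add: e_int(2))
  qed (auto simp: e_int)
  show "integrable (gauss I) (gauss_shift_density I s P)"
    using PG.integrable_snd[OF e_pair] by (simp add: gauss_shift_density_def[abs_def] e_def)
  have Fs[simp]: "\<bar>F (\<lambda>i\<in>I. s * z i)\<bar> \<le> K" for z
    by (rule F_bd) (auto simp: space_PiM)
  have eF_pair: "integrable (P \<Otimes>\<^sub>M gauss I) (\<lambda>(x, z). e x z * F (\<lambda>i\<in>I. s * z i))"
  proof (rule Bochner_Integration.integrable_bound[OF integrable_mult_left[OF e_pair, of K]])
    show "AE x in P \<Otimes>\<^sub>M gauss I. norm (case x of (x, z) \<Rightarrow> e x z * F (\<lambda>i\<in>I. s * z i)) \<le> norm ((case x of (x, z) \<Rightarrow> e x z) * K)"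
      using Fs by (auto simp: abs_mult e_def intro!: AE_I2 mult_left_mono order_trans[OF Fs] abs_ge_self)
  qed measurable
  have "(\<integral>z. F (\<lambda>i\<in>I. x i + s * z i) \<partial>gauss I) = (\<integral>z. e x z * F (\<lambda>i\<in>I. s * z i) \<partial>gauss I)" for x
  proof -
    have "(\<integral>z. F (\<lambda>i\<in>I. x i + s * z i) \<partial>gauss I)
        = (\<integral>z. (\<lambda>y. F (\<lambda>i\<in>I. s * y i)) (\<lambda>i\<in>I. x i / s + z i) \<partial>gauss I)"
      using s by (intro Bochner_Integration.integral_cong refl arg_cong[where f=F]) (auto simp: fun_eq_iff field_simps restrict_def)
    also have "\<dots> = (\<integral>z. e x z * F (\<lambda>i\<in>I. s * z i) \<partial>gauss I)"
      unfolding e_def by (rule integral_gauss_translate[OF I]) measurable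
    finally show ?thesis .
  qed
  then have "(\<integral>x. \<integral>z. F (\<lambda>i\<in>I. x i + s * z i) \<partial>gauss I \<partial>P) = (\<integral>x. \<integral>z. e x z * F (\<lambda>i\<in>I. s * z i) \<partial>gauss I \<partial>P)"
    by simp
  also have "\<dots> = (\<integral>z. \<integral>x. e x z * F (\<lambda>i\<in>I. s * z i) \<partial>P \<partial>gauss I)"
    by (rule PG.Fubini_integral[symmetric]) (use eF_pair in simp)
  also have "\<dots> = (\<integral>z. gauss_shift_density I s P z * F (\<lambda>i\<in>I. s * z i) \<partial>gauss I)"
    by (simp add: gauss_shift_density_def e_def)
  finally show "(\<integral>x. \<integral>z. F (\<lambda>i\<in>I. x i + s * z i) \<partial>gauss I \<partial>P)
      = (\<integral>z. gauss_shift_density I s P z * F (\<lambda>i\<in>I. s * z i) \<partial>gauss I)" .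
qed

text \<open>Dominated convergence in the formula through \<open>vchar\<close> gives pointwise
  convergence of the smoothed densities; all of them integrate to one, so Scheffe upgrades this to
  L1. The conclusion is convergence in total variation of the smoothed laws.\<close>

lemma smoothed_Levy:
  fixes F :: "(nat \<Rightarrow> real) \<Rightarrow> real"
  assumes Pk: "\<And>k. prob_vec I (Pk k)" and P: "prob_vec I P"
    and conv: "\<And>u. (\<lambda>k. vchar I (Pk k) u) \<longlonglongrightarrow> vchar I P u" and s: "0 < s"
    and F[measurable]: "F \<in> borel_measurable (PiM I (\<lambda>_. borel))"
    and F_bd: "\<And>x. x \<in> space (PiM I (\<lambda>_. borel :: real measure)) \<Longrightarrow> \<bar>F x\<bar> \<le> K"
  shows "(\<lambda>k. \<integral>x. \<integral>z. F (\<lambda>i\<in>I. x i + s * z i) \<partial>gauss I \<partial>Pk k)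
      \<longlonglongrightarrow> (\<integral>x. \<integral>z. F (\<lambda>i\<in>I. x i + s * z i) \<partial>gauss I \<partial>P)"
proof -
  have I: "finite I" using prob_vecD[OF P] by auto
  interpret G: prob_space "gauss I" by (rule prob_space_gauss)
  define r where "r = gauss_shift_density I s"
  have r_nonneg: "0 \<le> r Q z" for Q z
    unfolding r_def gauss_shift_density_def by (intro Bochner_Integration.integral_nonneg) auto
  have vchar_le: "norm (vchar I Q u) \<le> 1" if "prob_vec I Q" for Q u
  proof -
    interpret Q: prob_space Q using prob_vecD[OF that] by simp
    note [measurable_cong] = prob_vecD(3)[OF that]
    show ?thesis
      using Bochner_Integration.integral_norm_bound[of Q "\<lambda>x. iexp (\<Sum>i\<in>I. u i * x i)"] Q.prob_space
      by (simp add: vchar_def)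
  qed
  have [measurable]: "(\<lambda>u. vchar I Q (\<lambda>i. u i / s)) \<in> borel_measurable (gauss I)" if "prob_vec I Q" for Q
  proof -
    interpret Q: prob_space Q using prob_vecD[OF that] by simp
    note [measurable_cong] = prob_vecD(3)[OF that]
    show ?thesis unfolding vchar_def by measurable
  qed
  have r_int: "integrable (gauss I) (r Q)" "(\<integral>z. r Q z \<partial>gauss I) = 1" if Q: "prob_vec I Q" for Q
  proof -
    interpret Q: prob_space Q using prob_vecD[OF Q] by simp
    show "integrable (gauss I) (r Q)"
      unfolding r_def by (rule gauss_shift_density(2)[OF Q s, of "\<lambda>_. 1" 1]) auto
    show "(\<integral>z. r Q z \<partial>gauss I) = 1"
      using gauss_shift_density(1)[OF Q s, of "\<lambda>_. 1" 1] G.prob_space Q.prob_space by (simp add: r_def)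
  qed
  have r_conv: "(\<lambda>k. r (Pk k) z) \<longlonglongrightarrow> r P z" for z
  proof -
    have "(\<lambda>k. (\<integral>u. iexp (\<Sum>i\<in>I. - z i * u i) * vchar I (Pk k) (\<lambda>i. u i / s) \<partial>gauss I))
        \<longlonglongrightarrow> (\<integral>u. iexp (\<Sum>i\<in>I. - z i * u i) * vchar I P (\<lambda>i. u i / s) \<partial>gauss I)"
    proof (rule integral_dominated_convergence[where w="\<lambda>_. 1"])
      show "AE u in gauss I. (\<lambda>k. iexp (\<Sum>i\<in>I. - z i * u i) * vchar I (Pk k) (\<lambda>i. u i / s))
          \<longlonglongrightarrow> iexp (\<Sum>i\<in>I. - z i * u i) * vchar I P (\<lambda>i. u i / s)"
        by (intro AE_I2 tendsto_mult tendsto_const conv)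
      show "AE u in gauss I. norm (iexp (\<Sum>i\<in>I. - z i * u i) * vchar I (Pk k) (\<lambda>i. u i / s)) \<le> 1" for k
        using vchar_le[OF Pk] by (intro AE_I2) (auto simp: norm_mult)
    qed (use Pk P in auto)
    then have "(\<lambda>k. complex_of_real (r (Pk k) z)) \<longlonglongrightarrow> complex_of_real (r P z)"
      unfolding r_def gauss_shift_density_vchar[OF Pk] gauss_shift_density_vchar[OF P]
      by (intro tendsto_mult tendsto_const)
    then show ?thesis by (simp add: tendsto_of_real_iff)
  qed
  have nn: "(\<integral>\<^sup>+z. norm (r Q z) \<partial>gauss I) = 1" if "prob_vec I Q" for Q
    using r_int[OF that] r_nonneg by (simp add: nn_integral_eq_integral)
  have "(\<lambda>k. \<integral>\<^sup>+z. norm (r (Pk k) z - r P z) \<partial>gauss I) \<longlonglongrightarrow> 0"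
    by (rule Scheffe_lemma2) (use r_int Pk P r_conv nn in auto)
  then have L1: "(\<lambda>k. \<integral>z. \<bar>r (Pk k) z - r P z\<bar> \<partial>gauss I) \<longlonglongrightarrow> 0"
  proof -
    have "(\<integral>\<^sup>+z. norm (r (Pk k) z - r P z) \<partial>gauss I) = ennreal (\<integral>z. \<bar>r (Pk k) z - r P z\<bar> \<partial>gauss I)" for k
      using r_int[OF Pk] r_int[OF P] by (subst nn_integral_eq_integral) auto
    with \<open>(\<lambda>k. \<integral>\<^sup>+z. norm (r (Pk k) z - r P z) \<partial>gauss I) \<longlonglongrightarrow> 0\<close> show ?thesis
      by (simp add: ennreal_tendsto_0_iff)
  qed
  have Fs[simp]: "\<bar>F (\<lambda>i\<in>I. s * z i)\<bar> \<le> K" for z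
    by (rule F_bd) (auto simp: space_PiM)
  have rF: "integrable (gauss I) (\<lambda>z. r Q z * F (\<lambda>i\<in>I. s * z i))" if "prob_vec I Q" for Q
    by (rule Bochner_Integration.integrable_bound[OF integrable_mult_left[OF r_int(1)[OF that], of K]])
       (use r_int[OF that] Fs in \<open>auto simp: abs_mult r_nonneg intro!: AE_I2 mult_left_mono order_trans[OF Fs]\<close>)
  have "(\<lambda>k. (\<integral>z. r (Pk k) z * F (\<lambda>i\<in>I. s * z i) \<partial>gauss I) - (\<integral>z. r P z * F (\<lambda>i\<in>I. s * z i) \<partial>gauss I)) \<longlonglongrightarrow> 0"
  proof (rule Lim_null_comparison[OF always_eventually tendsto_mult_left_zero[OF L1, of K]], rule allI)
    fix k
    have "norm ((\<integral>z. r (Pk k) z * F (\<lambda>i\<in>I. s * z i) \<partial>gauss I) - (\<integral>z. r P z * F (\<lambda>i\<in>I. s * z i) \<partial>gauss I))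
        = norm (\<integral>z. (r (Pk k) z - r P z) * F (\<lambda>i\<in>I. s * z i) \<partial>gauss I)"
      using rF Pk P by (simp add: left_diff_distrib)
    also have "\<dots> \<le> (\<integral>z. \<bar>r (Pk k) z - r P z\<bar> * K \<partial>gauss I)"
    proof (rule order_trans[OF Bochner_Integration.integral_norm_bound integral_mono])
      show "integrable (gauss I) (\<lambda>z. norm ((r (Pk k) z - r P z) * F (\<lambda>i\<in>I. s * z i)))"
        unfolding left_diff_distrib using rF[OF Pk] rF[OF P] by (intro integrable_norm Bochner_Integration.integrable_diff)
    qed (use r_int[OF Pk] r_int[OF P] in \<open>auto simp: abs_mult intro!: mult_left_mono\<close>)
    finally show "norm ((\<integral>z. r (Pk k) z * F (\<lambda>i\<in>I. s * z i) \<partial>gauss I) - (\<integral>z. r P z * F (\<lambda>i\<in>I. s * z i) \<partial>gauss I))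
        \<le> (\<integral>z. \<bar>r (Pk k) z - r P z\<bar> \<partial>gauss I) * K" by simp
  qed
  then show ?thesis
    using gauss_shift_density(1)[OF Pk s F F_bd] gauss_shift_density(1)[OF P s F F_bd]
    by (simp add: r_def LIM_zero_iff)
qed

lemma prob_vec_bounded_integrable:
  fixes F :: "(nat \<Rightarrow> real) \<Rightarrow> 'b::{banach, second_countable_topology}"
  assumes P: "prob_vec I P" and F: "F \<in> borel_measurable (PiM I (\<lambda>_. borel))"
    and F_bd: "\<And>x. x \<in> space (PiM I (\<lambda>_. borel :: real measure)) \<Longrightarrow> norm (F x) \<le> K"
  shows "integrable P F"
proof -
  interpret P: prob_space P using prob_vecD[OF P] by simp
  note [measurable_cong] = prob_vecD(3)[OF P]
  show ?thesis
    using F F_bd prob_vecD(4)[OF P] by (intro P.integrable_const_bound[where B=K]) (auto cong: measurable_cong_sets)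
qed

lemma norm_expectation_le:
  fixes f :: "'a \<Rightarrow> 'b::{banach, second_countable_topology}"
  assumes "prob_space M" and [measurable]: "f \<in> borel_measurable M"
    and f: "\<And>x. x \<in> space M \<Longrightarrow> norm (f x) \<le> K"
  shows "norm (\<integral>x. f x \<partial>M) \<le> K"
proof -
  interpret prob_space M by fact
  have "norm (\<integral>x. f x \<partial>M) \<le> (\<integral>x. norm (f x) \<partial>M)" by (rule Bochner_Integration.integral_norm_bound)
  also have "\<dots> \<le> K"
    using f by (intro integral_le_const integrable_norm integrable_const_bound[where B=K]) auto
  finally show ?thesis .
qed

lemma integrable_gauss_abs:
  assumes I: "finite I" and i: "i \<in> I"
  shows "integrable (gauss I) (\<lambda>z. \<bar>z i\<bar>)"
proof (rule Bochner_Integration.integrable_bound)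
  have s: "(\<Sum>j\<in>I. (if j = i then c else 0) * z j) = c * z i" for c and z :: "nat \<Rightarrow> real"
    using I i by (subst sum.remove[OF I i]) (auto intro!: sum.neutral)
  show "integrable (gauss I) (\<lambda>z. exp (1 * z i) + exp (- 1 * z i))"
    using gauss_exp_moment(1)[OF I, of "\<lambda>j. if j = i then 1 else 0"]
      gauss_exp_moment(1)[OF I, of "\<lambda>j. if j = i then - 1 else 0"]
    unfolding s by (rule Bochner_Integration.integrable_add)
  have "\<bar>t\<bar> \<le> exp t + exp (- t)" for t :: real
    using exp_ge_add_one_self[of t] exp_ge_add_one_self[of "- t"] exp_gt_zero[of t] exp_gt_zero[of "- t"] by linarith
  then show "AE z in gauss I. norm \<bar>z i\<bar> \<le> norm (exp (1 * z i) + exp (- 1 * z i))"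
    by (auto intro!: AE_I2 order_trans[OF _ abs_ge_self])
qed (use i in measurable)

text \<open>Noise of scale s changes the mean of a Lipschitz function by at most |L| s times the
  mean of the sum of |z i|. This holds under every law, hence uniformly in k, and the convergence of
  the smoothed means is transferred to the original ones.\<close>

lemma Levy_Lipschitz:
  fixes F :: "(nat \<Rightarrow> real) \<Rightarrow> real"
  assumes Pk: "\<And>k. prob_vec I (Pk k)" and P: "prob_vec I P"
    and conv: "\<And>u. (\<lambda>k. vchar I (Pk k) u) \<longlonglongrightarrow> vchar I P u"
    and F[measurable]: "F \<in> borel_measurable (PiM I (\<lambda>_. borel))"
    and F_bd: "\<And>x. x \<in> space (PiM I (\<lambda>_. borel :: real measure)) \<Longrightarrow> \<bar>F x\<bar> \<le> K"
    and Lip: "\<And>x y. x \<in> space (PiM I (\<lambda>_. borel :: real measure)) \<Longrightarrow>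
        y \<in> space (PiM I (\<lambda>_. borel :: real measure)) \<Longrightarrow> \<bar>F x - F y\<bar> \<le> L * (\<Sum>i\<in>I. \<bar>x i - y i\<bar>)"
  shows "(\<lambda>k. \<integral>x. F x \<partial>Pk k) \<longlonglongrightarrow> (\<integral>x. F x \<partial>P)"
proof (rule LIMSEQ_I)
  fix \<epsilon> :: real assume \<epsilon>: "0 < \<epsilon>"
  have I: "finite I" using prob_vecD[OF P] by auto
  interpret G: prob_space "gauss I" by (rule prob_space_gauss)
  define m where "m = (\<integral>z. (\<Sum>i\<in>I. \<bar>z i\<bar>) \<partial>gauss I)"
  have m: "0 \<le> m" unfolding m_def by (intro Bochner_Integration.integral_nonneg sum_nonneg) auto
  \<comment> \<open>One third of \<open>\<epsilon>\<close> pays for the smoothing error under each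
    of the two laws, one third for the smoothed convergence. The summand 1 keeps the denominator
    positive.\<close>
  define s where "s = \<epsilon> / (3 * (\<bar>L\<bar> * m + 1))"
  have "0 \<le> \<bar>L\<bar> * m" using m by simp
  then have s: "0 < s" and sm: "\<bar>L\<bar> * s * m < \<epsilon> / 3"
    using \<epsilon> unfolding s_def by (auto simp: field_simps add_pos_nonneg intro!: divide_pos_pos mult_pos_pos)
  have close: "\<bar>(\<integral>x. \<integral>z. F (\<lambda>i\<in>I. x i + s * z i) \<partial>gauss I \<partial>Q) - (\<integral>x. F x \<partial>Q)\<bar> < \<epsilon> / 3" if Q: "prob_vec I Q" for Q
  proof -
    interpret Q: prob_space Q using prob_vecD[OF Q] by simp
    note [measurable_cong] = prob_vecD(3)[OF Q]
    have sp: "(\<lambda>i\<in>I. x i + s * z i) \<in> space (PiM I (\<lambda>_. borel :: real measure))" for x z :: "nat \<Rightarrow> real"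
      by (auto simp: space_PiM)
    have iF: "integrable (gauss I) (\<lambda>z. F (\<lambda>i\<in>I. x i + s * z i))" if "x \<in> space Q" for x
      using F_bd[OF sp] by (intro G.integrable_const_bound[where B=K]) auto
    have pt: "\<bar>(\<integral>z. F (\<lambda>i\<in>I. x i + s * z i) \<partial>gauss I) - F x\<bar> \<le> \<bar>L\<bar> * s * m" if x: "x \<in> space Q" for x
    proof -
      have x': "x \<in> space (PiM I (\<lambda>_. borel :: real measure))" using x prob_vecD(4)[OF Q] by simp
      have int: "integrable (gauss I) (\<lambda>z. \<Sum>i\<in>I. \<bar>z i\<bar>)"
        by (intro Bochner_Integration.integrable_sum integrable_gauss_abs I)
      have "\<bar>(\<integral>z. F (\<lambda>i\<in>I. x i + s * z i) \<partial>gauss I) - F x\<bar> = \<bar>\<integral>z. F (\<lambda>i\<in>I. x i + s * z i) - F x \<partial>gauss I\<bar>"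
        using iF[OF x] G.prob_space by simp
      also have "\<dots> \<le> (\<integral>z. \<bar>F (\<lambda>i\<in>I. x i + s * z i) - F x\<bar> \<partial>gauss I)"
        by (rule integral_abs_bound)
      also have "\<dots> \<le> (\<integral>z. \<bar>L\<bar> * s * (\<Sum>i\<in>I. \<bar>z i\<bar>) \<partial>gauss I)"
      proof (rule integral_mono)
        fix z
        have "\<bar>F (\<lambda>i\<in>I. x i + s * z i) - F x\<bar> \<le> L * (\<Sum>i\<in>I. \<bar>(\<lambda>i\<in>I. x i + s * z i) i - x i\<bar>)"
          by (rule Lip[OF sp x'])
        also have "\<dots> = L * s * (\<Sum>i\<in>I. \<bar>z i\<bar>)"
          using s by (simp add: sum_distrib_left[symmetric] abs_mult mult.assoc)
        also have "\<dots> \<le> \<bar>L\<bar> * s * (\<Sum>i\<in>I. \<bar>z i\<bar>)"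
          using s by (intro mult_right_mono sum_nonneg) auto
        finally show "\<bar>F (\<lambda>i\<in>I. x i + s * z i) - F x\<bar> \<le> \<bar>L\<bar> * s * (\<Sum>i\<in>I. \<bar>z i\<bar>)" .
      qed (use int iF[OF x] in auto)
      finally show ?thesis by (simp add: m_def)
    qed
    have i1: "integrable Q (\<lambda>x. \<integral>z. F (\<lambda>i\<in>I. x i + s * z i) \<partial>gauss I)"
    proof (rule Q.integrable_const_bound[where B=K], rule AE_I2)
      fix x assume "x \<in> space Q"
      show "norm (\<integral>z. F (\<lambda>i\<in>I. x i + s * z i) \<partial>gauss I) \<le> K"
        using iF[OF \<open>x \<in> space Q\<close>] F_bd[OF sp] by (intro norm_expectation_le prob_space_gauss) auto
    qed measurable
    have i2: "integrable Q F" using Q F F_bd by (intro prob_vec_bounded_integrable) auto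
    have "\<bar>(\<integral>x. \<integral>z. F (\<lambda>i\<in>I. x i + s * z i) \<partial>gauss I \<partial>Q) - (\<integral>x. F x \<partial>Q)\<bar>
        = \<bar>\<integral>x. (\<integral>z. F (\<lambda>i\<in>I. x i + s * z i) \<partial>gauss I) - F x \<partial>Q\<bar>"
      using i1 i2 by simp
    also have "\<dots> \<le> (\<integral>x. \<bar>(\<integral>z. F (\<lambda>i\<in>I. x i + s * z i) \<partial>gauss I) - F x\<bar> \<partial>Q)"
      by (rule integral_abs_bound)
    also have "\<dots> \<le> \<bar>L\<bar> * s * m"
      using i1 i2 pt by (intro Q.integral_le_const) auto
    finally show ?thesis using sm by simp
  qed
  obtain k0 where k0: "\<bar>(\<integral>x. \<integral>z. F (\<lambda>i\<in>I. x i + s * z i) \<partial>gauss I \<partial>Pk k)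
      - (\<integral>x. \<integral>z. F (\<lambda>i\<in>I. x i + s * z i) \<partial>gauss I \<partial>P)\<bar> < \<epsilon> / 3" if "k0 \<le> k" for k
    using LIMSEQ_D[OF smoothed_Levy[OF Pk P conv s F F_bd], of "\<epsilon> / 3"] \<epsilon> by auto
  show "\<exists>k0. \<forall>k\<ge>k0. norm ((\<integral>x. F x \<partial>Pk k) - (\<integral>x. F x \<partial>P)) < \<epsilon>"
  proof (intro exI allI impI)
    fix k assume "k0 \<le> k"
    from k0[OF this] close[OF Pk[of k]] close[OF P]
    show "norm ((\<integral>x. F x \<partial>Pk k) - (\<integral>x. F x \<partial>P)) < \<epsilon>" unfolding real_norm_def by linarith
  qed
qed

section \<open>From continuous tests to Borel sets\<close>

lemma measurable_id_PiM_borel: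
  "(\<lambda>x. x) \<in> measurable (PiM I (\<lambda>_. borel :: real measure)) (borel :: (nat \<Rightarrow> real) measure)"
proof -
  \<comment> \<open>A vector of \<open>PiM I\<close> has the constant value \<open>undefined\<close>
    off \<open>I\<close>, so the extra coordinates are measurable too. The full product carries the
    Borel sets of the product topology, which is where continuity and compactness are
    available.\<close>
  have "(\<lambda>x. x) \<in> measurable (PiM I (\<lambda>_. borel :: real measure)) (PiM UNIV (\<lambda>_ :: nat. borel :: real measure))"
  proof (rule measurable_PiM_single')
    fix i :: nat
    show "(\<lambda>x. x i) \<in> borel_measurable (PiM I (\<lambda>_. borel :: real measure))"
    proof (cases "i \<in> I")
      case False
      then have "(\<lambda>x. x i) \<in> borel_measurable (PiM I (\<lambda>_. borel :: real measure)) \<longleftrightarrow>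
          (\<lambda>x. undefined :: real) \<in> borel_measurable (PiM I (\<lambda>_. borel :: real measure))"
        by (intro measurable_cong) (auto simp: space_PiM PiE_def extensional_def)
      then show ?thesis by simp
    qed simp
  qed auto
  then show ?thesis
    using measurable_cong_sets[OF refl sets_PiM_equal_borel] by blast
qed

lemma borel_measurable_continuous_PiM:
  fixes f :: "(nat \<Rightarrow> real) \<Rightarrow> real"
  assumes "continuous_on UNIV f"
  shows "f \<in> borel_measurable (PiM I (\<lambda>_. borel :: real measure))"
  using measurable_compose[OF measurable_id_PiM_borel borel_measurable_continuous_onI[OF assms]] by simp

lemma continuous_vec_translate:
  fixes z :: "nat \<Rightarrow> real"
  shows "continuous_on UNIV (\<lambda>x :: nat \<Rightarrow> real. \<lambda>i\<in>I. x i + z i)"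
proof (rule continuous_on_coordinatewise_then_product)
  fix i
  show "continuous_on UNIV (\<lambda>x :: nat \<Rightarrow> real. (\<lambda>i\<in>I. x i + z i) i)"
    by (cases "i \<in> I") (auto intro!: continuous_intros continuous_on_product_coordinates)
qed

text \<open>Continuous tests are stable under translation, so averaging the bound over translates
  gives it for the laws blurred by s Z. At fixed s the limit in k is allowed because blurred laws
  converge in total variation; afterwards s tends to 0 and continuity of \<open>f\<close> removes
  the blur.\<close>

lemma test_bound_limit:
  fixes f :: "(nat \<Rightarrow> real) \<Rightarrow> real"
  assumes Pk: "\<And>k. prob_vec I (Pk k)" and P: "prob_vec I P" and Qk: "\<And>k. prob_vec I (Qk k)" and Q: "prob_vec I Q"
    and convP: "\<And>u. (\<lambda>k. vchar I (Pk k) u) \<longlonglongrightarrow> vchar I P u"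
    and convQ: "\<And>u. (\<lambda>k. vchar I (Qk k) u) \<longlonglongrightarrow> vchar I Q u"
    and bd: "\<And>k f. continuous_on UNIV f \<Longrightarrow> (\<And>x. 0 \<le> f x \<and> f x \<le> 1) \<Longrightarrow>
        \<bar>(\<integral>x. f x \<partial>Pk k) - (\<integral>x. f x \<partial>Qk k)\<bar> \<le> \<tau>"
    and f: "continuous_on UNIV f" and f01: "\<And>x. 0 \<le> f x \<and> f x \<le> 1"
  shows "\<bar>(\<integral>x. f x \<partial>P) - (\<integral>x. f x \<partial>Q)\<bar> \<le> \<tau>"
proof -
  have I: "finite I" using prob_vecD[OF P] by auto
  interpret G: prob_space "gauss I" by (rule prob_space_gauss)
  have [measurable]: "f \<in> borel_measurable (PiM I (\<lambda>_. borel :: real measure))"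
    by (rule borel_measurable_continuous_PiM[OF f])
  have f_abs: "\<bar>f x\<bar> \<le> 1" for x using f01[of x] by simp
  define sm where "sm = (\<lambda>s R. \<integral>x. \<integral>z. f (\<lambda>i\<in>I. x i + s * z i) \<partial>gauss I \<partial>R)"
  have swap: "sm s R = (\<integral>z. \<integral>x. f (\<lambda>i\<in>I. x i + s * z i) \<partial>R \<partial>gauss I)" if R: "prob_vec I R" for s R
  proof -
    note [measurable_cong] = prob_vecD(3)[OF R]
    show ?thesis
      unfolding sm_def by (rule Fubini_bounded[where K=1]) (use prob_vecD[OF R] f_abs prob_space_gauss in auto)
  qed
  have inner: "integrable (gauss I) (\<lambda>z. \<integral>x. f (\<lambda>i\<in>I. x i + s * z i) \<partial>R)" if R: "prob_vec I R" for s R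
  proof -
    note [measurable_cong] = prob_vecD(3)[OF R]
    interpret R: prob_space R using prob_vecD[OF R] by simp
    show ?thesis
    proof (rule G.integrable_const_bound[where B=1], rule AE_I2)
      fix z
      show "norm (\<integral>x. f (\<lambda>i\<in>I. x i + s * z i) \<partial>R) \<le> 1"
        using f_abs by (intro norm_expectation_le R.prob_space_axioms) auto
    qed measurable
  qed
  have smk: "\<bar>sm s (Pk k) - sm s (Qk k)\<bar> \<le> \<tau>" for s k
  proof -
    have b: "\<bar>(\<integral>x. f (\<lambda>i\<in>I. x i + s * z i) \<partial>Pk k) - (\<integral>x. f (\<lambda>i\<in>I. x i + s * z i) \<partial>Qk k)\<bar> \<le> \<tau>" for z
      by (rule bd) (use f01 in \<open>auto intro!: continuous_on_compose2[OF f] continuous_vec_translate\<close>)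
    have "\<bar>sm s (Pk k) - sm s (Qk k)\<bar>
        = \<bar>\<integral>z. (\<integral>x. f (\<lambda>i\<in>I. x i + s * z i) \<partial>Pk k) - (\<integral>x. f (\<lambda>i\<in>I. x i + s * z i) \<partial>Qk k) \<partial>gauss I\<bar>"
      unfolding swap[OF Pk] swap[OF Qk] using inner Pk Qk by simp
    also have "\<dots> \<le> (\<integral>z. \<bar>(\<integral>x. f (\<lambda>i\<in>I. x i + s * z i) \<partial>Pk k) - (\<integral>x. f (\<lambda>i\<in>I. x i + s * z i) \<partial>Qk k)\<bar> \<partial>gauss I)"
      by (rule integral_abs_bound)
    also have "\<dots> \<le> \<tau>"
      using b inner Pk Qk by (intro G.integral_le_const) auto
    finally show ?thesis .
  qed
  have sm_le: "\<bar>sm s P - sm s Q\<bar> \<le> \<tau>" if s: "0 < s" for s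
  proof (rule LIMSEQ_le_const2)
    show "(\<lambda>k. \<bar>sm s (Pk k) - sm s (Qk k)\<bar>) \<longlonglongrightarrow> \<bar>sm s P - sm s Q\<bar>"
      unfolding sm_def
      by (intro tendsto_rabs tendsto_diff smoothed_Levy[where K=1] Pk P Qk Q convP convQ s) (auto simp: f_abs)
  qed (use smk in auto)
  have lim: "(\<lambda>n. sm (1 / real (Suc n)) R) \<longlonglongrightarrow> (\<integral>x. f x \<partial>R)" if R: "prob_vec I R" for R
  proof -
    note [measurable_cong] = prob_vecD(3)[OF R]
    interpret R: prob_space R using prob_vecD[OF R] by simp
    have pt: "(\<lambda>n. f (\<lambda>i\<in>I. x i + 1 / real (Suc n) * z i)) \<longlonglongrightarrow> f x" if x: "x \<in> space R" for x z
    proof -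
      have "isCont f x" using f by (simp add: continuous_on_eq_continuous_at)
      moreover have "(\<lambda>n. (\<lambda>i\<in>I. x i + 1 / real (Suc n) * z i)) \<longlonglongrightarrow> x"
      proof -
        have "continuous_on UNIV (\<lambda>s :: real. \<lambda>i\<in>I. x i + s * z i)"
        proof (rule continuous_on_coordinatewise_then_product)
          fix i
          show "continuous_on UNIV (\<lambda>s :: real. (\<lambda>i\<in>I. x i + s * z i) i)"
            by (cases "i \<in> I") (auto intro!: continuous_intros)
        qed
        from continuous_on_tendsto_compose[OF this LIMSEQ_Suc[OF lim_1_over_n]]
        have "(\<lambda>n. (\<lambda>i\<in>I. x i + 1 / real (Suc n) * z i)) \<longlonglongrightarrow> (\<lambda>i\<in>I. x i + 0 * z i)"
          by simp
        also have "(\<lambda>i\<in>I. x i + 0 * z i) = x"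
          using x prob_vecD(4)[OF R] by (auto simp: space_PiM PiE_def extensional_def)
        finally show ?thesis .
      qed
      ultimately show ?thesis by (rule isCont_tendsto_compose)
    qed
    have pt2: "(\<lambda>n. \<integral>z. f (\<lambda>i\<in>I. x i + 1 / real (Suc n) * z i) \<partial>gauss I) \<longlonglongrightarrow> f x" if x: "x \<in> space R" for x
    proof -
      have "(\<lambda>n. \<integral>z. f (\<lambda>i\<in>I. x i + 1 / real (Suc n) * z i) \<partial>gauss I) \<longlonglongrightarrow> (\<integral>z. f x \<partial>gauss I)"
        using x by (intro integral_dominated_convergence[where w="\<lambda>_. 1"] AE_I2 pt) (auto simp: f_abs)
      then show ?thesis using G.prob_space by simp
    qed
    show ?thesis
      unfolding sm_def
    proof (rule integral_dominated_convergence[where w="\<lambda>_. 1"])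
      fix n
      show "AE x in R. norm (\<integral>z. f (\<lambda>i\<in>I. x i + 1 / real (Suc n) * z i) \<partial>gauss I) \<le> 1"
        using f_abs by (intro AE_I2 norm_expectation_le prob_space_gauss) auto
    qed (use pt2 in auto)
  qed
  show ?thesis
    using LIMSEQ_le_const2[OF tendsto_rabs[OF tendsto_diff[OF lim[OF P] lim[OF Q]]]] sm_le by auto
qed

text \<open>Tent functions of the distance decrease to the indicator of a compact set, and inner
  regularity passes from compact sets to Borel sets.\<close>

lemma continuous_test_bound_imp_measure:
  assumes P: "prob_vec I P" and Q: "prob_vec I Q"
    and bd: "\<And>f. continuous_on UNIV f \<Longrightarrow> (\<And>x. 0 \<le> f x \<and> f x \<le> 1) \<Longrightarrow>
        \<bar>(\<integral>x. f x \<partial>P) - (\<integral>x. f x \<partial>Q)\<bar> \<le> \<tau>"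
    and A: "A \<in> sets (PiM I (\<lambda>_. borel))"
  shows "\<bar>measure P A - measure Q A\<bar> \<le> \<tau>"
proof -
  \<comment> \<open>Inner regularity is a property of Borel measures on a Polish space, so the laws
    are transported from the extensional functions on \<open>I\<close> to all functions on the
    naturals.\<close>
  define ext where "ext = (\<lambda>R. distr R borel (\<lambda>x. x :: nat \<Rightarrow> real))"
  define A' where "A' = (\<lambda>x :: nat \<Rightarrow> real. restrict x I) -` A"
  have id_meas: "(\<lambda>x. x) \<in> measurable R (borel :: (nat \<Rightarrow> real) measure)" if "prob_vec I R" for R
    using measurable_id_PiM_borel[of I] prob_vecD(3)[OF that] measurable_cong_sets by blast
  have "(\<lambda>x :: nat \<Rightarrow> real. restrict x I) \<in> measurable (PiM UNIV (\<lambda>_. borel)) (PiM I (\<lambda>_. borel))"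
    by measurable
  then have "(\<lambda>x :: nat \<Rightarrow> real. restrict x I) \<in> measurable borel (PiM I (\<lambda>_. borel))"
    using measurable_cong_sets[OF sets_PiM_equal_borel refl] by blast
  from measurable_sets[OF this A] have A'[measurable]: "A' \<in> sets borel" by (simp add: A'_def)
  have ext: "prob_space (ext R)" "sets (ext R) = sets borel" "space (ext R) = UNIV" "measure (ext R) A' = measure R A"
    "\<And>f :: _ \<Rightarrow> real. f \<in> borel_measurable borel \<Longrightarrow> (\<integral>x. f x \<partial>ext R) = (\<integral>x. f x \<partial>R)" if R: "prob_vec I R" for R
  proof -
    interpret R: prob_space R using prob_vecD[OF R] by simp
    show "prob_space (ext R)" unfolding ext_def by (rule R.prob_space_distr[OF id_meas[OF R]])
    show "sets (ext R) = sets borel" "space (ext R) = UNIV" by (auto simp: ext_def)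
    have "A' \<inter> space R = A"
      using sets.sets_into_space[OF A] prob_vecD(4)[OF R] by (auto simp: A'_def space_PiM PiE_def extensional_restrict)
    then show "measure (ext R) A' = measure R A"
      unfolding ext_def using measure_distr[OF id_meas[OF R], of A'] A' by simp
    show "(\<integral>x. f x \<partial>ext R) = (\<integral>x. f x \<partial>R)" if "f \<in> borel_measurable borel" for f :: "_ \<Rightarrow> real"
      unfolding ext_def by (rule integral_distr[OF id_meas[OF R] that])
  qed
  have compact_bd: "\<bar>measure (ext P) C - measure (ext Q) C\<bar> \<le> \<tau>" if C: "compact C" for C
  proof (cases "C = {}")
    case True
    with bd[of "\<lambda>_. 0"] show ?thesis by simp
  next
    case False
    define f where "f = (\<lambda>k (x :: nat \<Rightarrow> real). max 0 (1 - real k * infdist x C))"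
    have fc: "continuous_on UNIV (f k)" for k
      unfolding f_def by (intro continuous_intros)
    have f01: "0 \<le> f k x \<and> f k x \<le> 1" for k x by (auto simp: f_def infdist_nonneg)
    have lim: "(\<lambda>k. \<integral>x. f k x \<partial>R) \<longlonglongrightarrow> measure (ext R) C" if R: "prob_vec I R" for R
    proof -
      interpret E: prob_space "ext R" by (rule ext(1)[OF R])
      note [measurable_cong] = ext(2)[OF R]
      have Cm[measurable]: "C \<in> sets borel" using C by (simp add: compact_imp_closed)
      have "(\<lambda>k. \<integral>x. f k x \<partial>ext R) \<longlonglongrightarrow> (\<integral>x. indicator C x \<partial>ext R)"
      proof (rule integral_dominated_convergence[where w="\<lambda>_. 1"])
        show "f k \<in> borel_measurable (ext R)" for k
          using borel_measurable_continuous_onI[OF fc[of k]] by (simp add: measurable_cong_sets[OF ext(2)[OF R]])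
        show "AE x in ext R. (\<lambda>k. f k x) \<longlonglongrightarrow> indicator C x"
        proof (rule AE_I2)
          fix x
          show "(\<lambda>k. f k x) \<longlonglongrightarrow> indicator C x"
          proof (cases "x \<in> C")
            case True
            then show ?thesis by (simp add: f_def)
          next
            case x: False
            then have d: "0 < infdist x C"
              using C False by (meson compact_imp_closed in_closed_iff_infdist_zero infdist_pos_not_in_closed)
            obtain k0 :: nat where k0: "1 / infdist x C < real k0" using reals_Archimedean2 by blast
            have "f k x = 0" if "k0 \<le> k" for k
            proof -
              have "1 \<le> real k0 * infdist x C" using k0 d by (simp add: field_simps)
              also have "\<dots> \<le> real k * infdist x C" using that d by (intro mult_right_mono) auto
              finally show ?thesis by (simp add: f_def)
            qed
            then have "eventually (\<lambda>k. f k x = 0) sequentially" by (auto simp: eventually_sequentially)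
            with x show ?thesis by (simp add: tendsto_eventually)
          qed
        qed
      qed (use f01 in auto)
      moreover have "(\<integral>x. f k x \<partial>ext R) = (\<integral>x. f k x \<partial>R)" for k
        by (rule ext(5)[OF R borel_measurable_continuous_onI[OF fc]])
      ultimately show ?thesis by simp
    qed
    show ?thesis
      using LIMSEQ_le_const2[OF tendsto_rabs[OF tendsto_diff[OF lim[OF P] lim[OF Q]]]] bd[OF fc f01] by auto
  qed
  have inner: "\<exists>K. K \<subseteq> A' \<and> compact K \<and> measure (ext R) A' < measure (ext R) K + \<epsilon>"
    if R: "prob_vec I R" and \<epsilon>: "0 < \<epsilon>" for R \<epsilon>
  proof -
    interpret E: prob_space "ext R" by (rule ext(1)[OF R])
    show ?thesis
    proof (cases "measure (ext R) A' < \<epsilon>")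
      case True
      then show ?thesis by (intro exI[of _ "{}"]) auto
    next
      case False
      have "ennreal (measure (ext R) A' - \<epsilon>) < emeasure (ext R) A'"
        unfolding E.emeasure_eq_measure using False \<epsilon> by (intro ennreal_lessI) auto
      also have "\<dots> = (SUP K \<in> {K. K \<subseteq> A' \<and> compact K}. emeasure (ext R) K)"
        by (rule inner_regular) (auto simp: ext[OF R] E.emeasure_eq_measure)
      finally obtain K where "K \<subseteq> A'" "compact K" "ennreal (measure (ext R) A' - \<epsilon>) < emeasure (ext R) K"
        by (auto simp: less_SUP_iff)
      then show ?thesis
        unfolding E.emeasure_eq_measure using False by (intro exI[of _ K]) (auto simp: ennreal_less_iff)
    qed
  qed
  have "\<bar>measure (ext P) A' - measure (ext Q) A'\<bar> \<le> \<tau> + \<epsilon>" if \<epsilon>: "0 < \<epsilon>" for \<epsilon>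
  proof -
    interpret P: prob_space "ext P" by (rule ext(1)[OF P])
    interpret Q: prob_space "ext Q" by (rule ext(1)[OF Q])
    \<comment> \<open>One compact set has to serve both laws at once; the union of two separate
      approximations does.\<close>
    obtain K L where K: "K \<subseteq> A'" "compact K" "measure (ext P) A' < measure (ext P) K + \<epsilon>"
      and L: "L \<subseteq> A'" "compact L" "measure (ext Q) A' < measure (ext Q) L + \<epsilon>"
      using inner[OF P \<epsilon>] inner[OF Q \<epsilon>] by blast
    have KL: "compact (K \<union> L)" "K \<union> L \<subseteq> A'" using K L by auto
    have m: "K \<in> sets borel" "L \<in> sets borel" using K(2) L(2) by (auto simp: compact_imp_closed)
    have "measure (ext P) K \<le> measure (ext P) (K \<union> L)" "measure (ext P) (K \<union> L) \<le> measure (ext P) A'"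
      "measure (ext Q) L \<le> measure (ext Q) (K \<union> L)" "measure (ext Q) (K \<union> L) \<le> measure (ext Q) A'"
      using KL m by (auto intro!: P.finite_measure_mono Q.finite_measure_mono simp: ext(2)[OF P] ext(2)[OF Q])
    with compact_bd[OF KL(1)] K(3) L(3) show ?thesis by linarith
  qed
  then have "\<bar>measure (ext P) A' - measure (ext Q) A'\<bar> \<le> \<tau>"
    by (rule field_le_epsilon)
  then show ?thesis by (simp add: ext P Q)
qed

section \<open>Cosine expansion of the fractional Brownian covariance\<close>

lemma abs_exp_diff_le: "\<bar>exp x - exp y\<bar> \<le> \<bar>x - y\<bar> * exp (max x y :: real)"
proof -
  have *: "\<bar>exp x - exp y\<bar> \<le> \<bar>x - y\<bar> * exp (max x y)" if "x \<le> y" for x y :: real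
  proof -
    have "exp y - exp x = exp y * (1 - exp (x - y))" by (simp add: exp_diff right_diff_distrib)
    also have "\<dots> \<le> exp y * (y - x)"
      using exp_ge_add_one_self[of "x - y"] by (intro mult_left_mono) (linarith, simp)
    finally show ?thesis using that by (simp add: max_def mult.commute)
  qed
  show ?thesis using *[of x y] *[of y x] by (cases "x \<le> y") (auto simp: max.commute abs_minus_commute)
qed

text \<open>Differentiating a power in its exponent produces ln u. Near 0 this logarithm costs an
  arbitrarily small power u^(-\<delta>) and a factor 1/\<delta>.\<close>

lemma abs_powr_diff_le_1:
  fixes u e e' e0 \<delta> :: real
  assumes u: "0 < u" "u \<le> 1" and e: "e0 \<le> e" "e0 \<le> e'" and \<delta>: "0 < \<delta>"
  shows "\<bar>u powr e - u powr e'\<bar> \<le> \<bar>e - e'\<bar> / \<delta> * u powr (e0 - \<delta>)"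
proof -
  have ln: "\<bar>ln u\<bar> \<le> u powr (- \<delta>) / \<delta>"
  proof -
    have "ln (1 / u) \<le> (1 / u) powr \<delta> / \<delta>" using u \<delta> by (intro ln_powr_bound) auto
    then show ?thesis using u by (simp add: ln_div powr_minus_divide powr_divide)
  qed
  have "\<bar>u powr e - u powr e'\<bar> \<le> \<bar>e * ln u - e' * ln u\<bar> * exp (max (e * ln u) (e' * ln u))"
    using abs_exp_diff_le[of "e * ln u" "e' * ln u"] u by (simp add: powr_def)
  also have "\<bar>e * ln u - e' * ln u\<bar> = \<bar>e - e'\<bar> * \<bar>ln u\<bar>"
    by (simp add: abs_mult left_diff_distrib[symmetric])
  also have "exp (max (e * ln u) (e' * ln u)) \<le> u powr e0"
    using u e by (auto simp: powr_def mult_right_mono_neg)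
  also have "\<bar>e - e'\<bar> * \<bar>ln u\<bar> * u powr e0 \<le> \<bar>e - e'\<bar> * (u powr (- \<delta>) / \<delta>) * u powr e0"
    using ln by (intro mult_right_mono mult_left_mono) auto
  also have "\<dots> = \<bar>e - e'\<bar> / \<delta> * u powr (e0 - \<delta>)"
    using powr_add[of u e0 "- \<delta>"] by (simp add: mult_ac)
  finally show ?thesis by (simp add: mult_left_mono)
qed

text \<open>The bound near 0, applied at 1/u.\<close>

lemma abs_powr_diff_ge_1:
  fixes u e e' e1 \<delta> :: real
  assumes u: "1 \<le> u" and e: "e \<le> e1" "e' \<le> e1" and \<delta>: "0 < \<delta>"
  shows "\<bar>u powr e - u powr e'\<bar> \<le> \<bar>e - e'\<bar> / \<delta> * u powr (e1 + \<delta>)"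
proof -
  have "\<bar>(1/u) powr (- e) - (1/u) powr (- e')\<bar> \<le> \<bar>- e - - e'\<bar> / \<delta> * (1/u) powr (- e1 - \<delta>)"
    using u e \<delta> by (intro abs_powr_diff_le_1) auto
  moreover have "(1/u) powr (- a) = u powr a" for a
    using u by (simp add: powr_divide powr_minus_divide)
  from this[of "e1 + \<delta>"] this[of e] this[of e']
  have "(1/u) powr (- e1 - \<delta>) = u powr (e1 + \<delta>)" "(1/u) powr (- e) = u powr e" "(1/u) powr (- e') = u powr e'"
    by simp_all
  ultimately show ?thesis by (simp add: abs_minus_commute)
qed

lemma borel_measurable_lebesgue_onI: "f \<in> borel_measurable borel \<Longrightarrow> f \<in> borel_measurable (lebesgue_on S)"
  by (intro measurable_restrict_space1 measurable_completion) simp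

text \<open>The two power majorants are integrated over their full ranges, [0, 1] and [1, infinity),
  so that the upper limit \<open>y\<close> disappears from the bound.\<close>

lemma integral_powr_bounds:
  fixes f :: "real \<Rightarrow> real"
  assumes f: "f \<in> borel_measurable borel" and y: "1 \<le> y"
    and f0: "\<And>u. 0 \<le> u \<Longrightarrow> u \<le> 1 \<Longrightarrow> \<bar>f u\<bar> \<le> A * u powr a" and a: "- 1 < a"
    and f1: "\<And>u. 1 \<le> u \<Longrightarrow> \<bar>f u\<bar> \<le> A' * u powr b" and b: "b < - 1" and A': "0 \<le> A'"
  shows "f integrable_on {0..y}" and "\<bar>integral {0..y} f\<bar> \<le> A / (a + 1) + A' / (- 1 - b)"
proof -
  note fm = borel_measurable_lebesgue_onI[OF f]
  have g0: "((\<lambda>u. A * u powr a) has_integral A * (1 / (a + 1))) {0..1}"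
    using has_integral_mult_right[OF has_integral_powr_from_0[OF a, of 1], of A] by simp
  have "(- (1 powr (b + 1)) / (b + 1)) = 1 / (- 1 - b)" using b by (simp add: field_simps)
  then have g1: "((\<lambda>u. A' * u powr b) has_integral A' * (1 / (- 1 - b))) {1..}"
    using has_integral_mult_right[OF has_integral_powr_to_inf[OF b, of 1], of A'] by (simp only: zero_less_one simp_thms)
  have g1': "(\<lambda>u. A' * u powr b) integrable_on {1..y}"
    by (rule integrable_on_subinterval[OF has_integral_integrable[OF g1]]) auto
  have i0: "f integrable_on {0..1}"
    by (rule measurable_bounded_by_integrable_imp_integrable[OF fm has_integral_integrable[OF g0]]) (auto simp: f0)
  have i1: "f integrable_on {1..y}"
    by (rule measurable_bounded_by_integrable_imp_integrable[OF fm g1']) (auto simp: f1)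
  show i: "f integrable_on {0..y}" using Henstock_Kurzweil_Integration.integrable_combine[OF _ y i0 i1] by simp
  have "\<bar>integral {0..1} f\<bar> \<le> integral {0..1} (\<lambda>u. A * u powr a)"
    using integral_norm_bound_integral[OF i0 has_integral_integrable[OF g0]] f0 by simp
  moreover have "\<bar>integral {1..y} f\<bar> \<le> integral {1..y} (\<lambda>u. A' * u powr b)"
    using integral_norm_bound_integral[OF i1 g1'] f1 by simp
  moreover have "integral {1..y} (\<lambda>u. A' * u powr b) \<le> integral {1..} (\<lambda>u. A' * u powr b)"
    by (rule integral_subset_le[OF _ g1' has_integral_integrable[OF g1]]) (auto simp: A')
  ultimately show "\<bar>integral {0..y} f\<bar> \<le> A / (a + 1) + A' / (- 1 - b)"
    using Henstock_Kurzweil_Integration.integral_combine[OF _ y i] integral_unique[OF g0] integral_unique[OF g1] by simp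
qed

text \<open>Near 0 the kernel \<open>g\<close> contributes the power \<open>d\<close>; at infinity
  it is only bounded and the exponent alone must be integrable. The uses are 1 - cos with d = 2 and
  sin with d = 1. The Lipschitz bound in the exponent is what later makes the Fourier coefficients
  Lipschitz in H.\<close>

lemma powr_kernel_bounds:
  fixes g :: "real \<Rightarrow> real"
  assumes g: "g \<in> borel_measurable borel" and C: "0 \<le> C"
    and g0: "\<And>u. 0 \<le> u \<Longrightarrow> u \<le> 1 \<Longrightarrow> \<bar>g u\<bar> \<le> C * u powr d" and g1: "\<And>u. \<bar>g u\<bar> \<le> C"
    and e0: "- 1 < e0 + d" and e1: "e1 < - 1"
  obtains K where "0 \<le> K"
    "\<And>e y. e0 \<le> e \<Longrightarrow> e \<le> e1 \<Longrightarrow> 1 \<le> y \<Longrightarrow> (\<lambda>u. u powr e * g u) integrable_on {0..y}"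
    "\<And>e y. e0 \<le> e \<Longrightarrow> e \<le> e1 \<Longrightarrow> 1 \<le> y \<Longrightarrow> \<bar>integral {0..y} (\<lambda>u. u powr e * g u)\<bar> \<le> K"
    "\<And>e e' y. e0 \<le> e \<Longrightarrow> e \<le> e1 \<Longrightarrow> e0 \<le> e' \<Longrightarrow> e' \<le> e1 \<Longrightarrow> 1 \<le> y \<Longrightarrow>
       \<bar>integral {0..y} (\<lambda>u. u powr e * g u) - integral {0..y} (\<lambda>u. u powr e' * g u)\<bar> \<le> K * \<bar>e - e'\<bar>"
proof -
  \<comment> \<open>Half of each of the two integrability margins is given to the logarithm that
    arises from varying the exponent; the other half keeps the integrals finite.\<close>
  define \<delta> where "\<delta> = min ((e0 + d + 1) / 2) ((- 1 - e1) / 2)"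
  have \<delta>: "0 < \<delta>" "- 1 < e0 + d - \<delta>" "e1 + \<delta> < - 1"
    using e0 e1 by (auto simp: \<delta>_def min_def field_simps)
  define K1 where "K1 = C / (e0 + d + 1) + C / (- 1 - e1)"
  define K2 where "K2 = C / \<delta> / (e0 + d - \<delta> + 1) + C / \<delta> / (- 1 - (e1 + \<delta>))"
  have K: "0 \<le> K1" "0 \<le> K2"
    using C e0 e1 \<delta> by (auto simp: K1_def K2_def intro!: add_nonneg_nonneg divide_nonneg_nonneg)
  have [measurable]: "g \<in> borel_measurable borel" by (rule g)
  have b1: "(\<lambda>u. u powr e * g u) integrable_on {0..y} \<and> \<bar>integral {0..y} (\<lambda>u. u powr e * g u)\<bar> \<le> K1"
    if e: "e0 \<le> e" "e \<le> e1" and y: "1 \<le> y" for e y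
  proof -
    have p0: "\<bar>u powr e * g u\<bar> \<le> C * u powr (e0 + d)" if u: "0 \<le> u" "u \<le> 1" for u
    proof (cases "u = 0")
      case False
      with u have "u powr e \<le> u powr e0" using e by (intro powr_mono') auto
      then have "\<bar>u powr e * g u\<bar> \<le> u powr e0 * (C * u powr d)"
        unfolding abs_mult using g0[OF u] by (intro mult_mono) auto
      then show ?thesis by (simp add: powr_add mult_ac)
    qed simp
    have p1: "\<bar>u powr e * g u\<bar> \<le> C * u powr e1" if u: "1 \<le> u" for u
    proof -
      have "u powr e \<le> u powr e1" using e u by (intro powr_mono) auto
      then have "\<bar>u powr e * g u\<bar> \<le> u powr e1 * C"
        unfolding abs_mult using g1[of u] by (intro mult_mono) auto
      then show ?thesis by (simp add: mult_ac)
    qed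
    show ?thesis
      using integral_powr_bounds[OF _ y p0 e0 p1 e1 C] unfolding K1_def by auto
  qed
  have b2: "\<bar>integral {0..y} (\<lambda>u. u powr e * g u) - integral {0..y} (\<lambda>u. u powr e' * g u)\<bar> \<le> K2 * \<bar>e - e'\<bar>"
    if e: "e0 \<le> e" "e \<le> e1" "e0 \<le> e'" "e' \<le> e1" and y: "1 \<le> y" for e e' y
  proof -
    have p0: "\<bar>u powr e * g u - u powr e' * g u\<bar> \<le> (\<bar>e - e'\<bar> * (C / \<delta>)) * u powr (e0 + d - \<delta>)"
      if u: "0 \<le> u" "u \<le> 1" for u
    proof (cases "u = 0")
      case False
      with u have "\<bar>u powr e - u powr e'\<bar> \<le> \<bar>e - e'\<bar> / \<delta> * u powr (e0 - \<delta>)"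
        using e \<delta> by (intro abs_powr_diff_le_1) auto
      then have "\<bar>(u powr e - u powr e') * g u\<bar> \<le> (\<bar>e - e'\<bar> / \<delta> * u powr (e0 - \<delta>)) * (C * u powr d)"
        unfolding abs_mult using g0[OF u] \<delta> by (intro mult_mono) auto
      also have "\<dots> = (\<bar>e - e'\<bar> * (C / \<delta>)) * u powr (e0 + d - \<delta>)"
        using powr_add[of u "e0 - \<delta>" d] by (simp add: algebra_simps)
      finally show ?thesis by (simp add: left_diff_distrib)
    qed simp
    have p1: "\<bar>u powr e * g u - u powr e' * g u\<bar> \<le> (\<bar>e - e'\<bar> * (C / \<delta>)) * u powr (e1 + \<delta>)"
      if u: "1 \<le> u" for u
    proof -
      have "\<bar>u powr e - u powr e'\<bar> \<le> \<bar>e - e'\<bar> / \<delta> * u powr (e1 + \<delta>)"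
        using e \<delta> u by (intro abs_powr_diff_ge_1) auto
      then have "\<bar>(u powr e - u powr e') * g u\<bar> \<le> (\<bar>e - e'\<bar> / \<delta> * u powr (e1 + \<delta>)) * C"
        unfolding abs_mult using g1[of u] \<delta> by (intro mult_mono) auto
      then show ?thesis unfolding left_diff_distrib by (simp add: mult_ac)
    qed
    have "integral {0..y} (\<lambda>u. u powr e * g u) - integral {0..y} (\<lambda>u. u powr e' * g u)
        = integral {0..y} (\<lambda>u. u powr e * g u - u powr e' * g u)"
      using b1 e y by (intro integral_diff[symmetric]) auto
    also have "\<bar>\<dots>\<bar> \<le> (\<bar>e - e'\<bar> * (C / \<delta>)) / (e0 + d - \<delta> + 1) + (\<bar>e - e'\<bar> * (C / \<delta>)) / (- 1 - (e1 + \<delta>))"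
      using C \<delta> by (intro integral_powr_bounds(2)[OF _ y p0 \<delta>(2) p1 \<delta>(3)]) auto
    also have "\<dots> = K2 * \<bar>e - e'\<bar>" unfolding K2_def by (simp add: algebra_simps)
    finally show ?thesis .
  qed
  show ?thesis
  proof (rule that[of "max K1 K2"])
    show "0 \<le> max K1 K2" using K by auto
  next
    fix e y assume e: "e0 \<le> e" "e \<le> e1" "1 \<le> (y :: real)"
    show "(\<lambda>u. u powr e * g u) integrable_on {0..y}" using b1[OF e] by simp
    show "\<bar>integral {0..y} (\<lambda>u. u powr e * g u)\<bar> \<le> max K1 K2" using b1[OF e] by auto
  next
    fix e e' y assume "e0 \<le> e" "e \<le> e1" "e0 \<le> e'" "e' \<le> e1" "1 \<le> (y :: real)"
    then have "\<bar>integral {0..y} (\<lambda>u. u powr e * g u) - integral {0..y} (\<lambda>u. u powr e' * g u)\<bar> \<le> K2 * \<bar>e - e'\<bar>"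
      by (rule b2)
    also have "\<dots> \<le> max K1 K2 * \<bar>e - e'\<bar>" by (intro mult_right_mono) auto
    finally show "\<bar>integral {0..y} (\<lambda>u. u powr e * g u) - integral {0..y} (\<lambda>u. u powr e' * g u)\<bar> \<le> max K1 K2 * \<bar>e - e'\<bar>" .
  qed
qed

text \<open>Since u^e decreases, every positive half-wave of the sine outweighs the negative one
  after it. All later periods contribute nonnegatively, and the first one alone gives a bound that
  is uniform in the exponent.\<close>

lemma integral_powr_sin_ge:
  assumes e: "- 2 < e" "e < - 1" and k: "1 \<le> k"
  shows "1 / 16 \<le> integral {0..pi * real k} (\<lambda>u. u powr e * sin u)"
proof -
  define f where "f = (\<lambda>u. u powr e * sin u)"
  have f_int: "f integrable_on {0..y}" if "1 \<le> y" for y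
    unfolding f_def
  proof (rule integral_powr_bounds(1)[where A=1 and a="e+1" and A'=1 and b=e])
    show "\<bar>u powr e * sin u\<bar> \<le> 1 * u powr (e + 1)" if "0 \<le> u" "u \<le> 1" for u
      using that abs_sin_x_le_abs_x[of u] by (cases "u = 0") (auto simp: abs_mult powr_add intro!: mult_left_mono)
    show "\<bar>u powr e * sin u\<bar> \<le> 1 * u powr e" for u
      by (auto simp: abs_mult intro!: mult_left_le)
  qed (use that e in auto)
  have f_int': "f integrable_on {a..b}" if "0 \<le> a" for a b
    by (rule integrable_on_subinterval[OF f_int[of "max b 1"]]) (use that in auto)
  have pair: "integral {2 * pi * real m..2 * pi * real m + 2 * pi} f
      = integral {2 * pi * real m..2 * pi * real m + pi} (\<lambda>u. (u powr e - (u + pi) powr e) * sin u)" for m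
  proof -
    define a where "a = 2 * pi * real m"
    have a: "0 \<le> a" by (simp add: a_def)
    have "integral {a..a + 2 * pi} f = integral {a..a + pi} f + integral {a + pi..a + 2 * pi} f"
      using a by (intro Henstock_Kurzweil_Integration.integral_combine[symmetric] f_int') auto
    also have "integral {a + pi..a + 2 * pi} f = integral {a..a + pi} (f \<circ> (+) pi)"
      using integral_shift_Icc_real[of a "a + pi" f pi] by (simp add: algebra_simps)
    also have "integral {a..a + pi} f + integral {a..a + pi} (f \<circ> (+) pi) = integral {a..a + pi} (\<lambda>u. f u + (f \<circ> (+) pi) u)"
    proof (rule integral_add[symmetric])
      show "(f \<circ> (+) pi) integrable_on {a..a + pi}"
        using f_int'[of "a + pi" "a + 2 * pi"] a has_integral_shift_Icc_real[of f pi _ a "a + pi"]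
        by (auto simp: integrable_on_def algebra_simps)
    qed (use f_int' a in auto)
    finally show ?thesis
      unfolding a_def[symmetric] by (simp add: f_def left_diff_distrib add.commute)
  qed
  have sin_nonneg: "0 \<le> sin u" if "2 * pi * real m \<le> u" "u \<le> 2 * pi * real m + pi" for u m
  proof -
    have "sin u = sin (u - 2 * pi * real m)"
    proof -
      have "2 * pi * real m = 2 * real m * pi" by simp
      then show ?thesis by (simp only: sin_diff sin_2npi cos_2npi)
    qed
    also have "\<dots> \<ge> 0" using that by (intro sin_ge_zero) auto
    finally show ?thesis .
  qed
  have pos: "0 \<le> u powr e - (u + pi) powr e" if "0 < u" for u
    using that e by (auto intro!: powr_mono2' pi_ge_zero)
  have step2: "0 \<le> integral {2 * pi * real m..2 * pi * real m + 2 * pi} f" if m: "1 \<le> m" for m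
    unfolding pair
  proof (rule Henstock_Kurzweil_Integration.integral_nonneg)
    show "0 \<le> (u powr e - (u + pi) powr e) * sin u" if "u \<in> {2 * pi * real m..2 * pi * real m + pi}" for u
    proof -
      have "0 < 2 * pi * real m" using m by auto
      then show ?thesis using that by (intro mult_nonneg_nonneg pos sin_nonneg[of m]) auto
    qed
    have "0 < 2 * pi * real m" using m by auto
    then show "(\<lambda>u. (u powr e - (u + pi) powr e) * sin u) integrable_on {2 * pi * real m..2 * pi * real m + pi}"
      using pi_gt_zero by (intro integrable_continuous_real continuous_intros) auto
  qed
  have step1: "0 \<le> integral {2 * pi * real m..2 * pi * real m + pi} f" for m
    using sin_nonneg[of m] f_int'[of "2 * pi * real m"] by (intro Henstock_Kurzweil_Integration.integral_nonneg) (auto simp: f_def)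
  have base: "1 / 16 \<le> integral {0..2 * pi} f"
  proof -
    let ?g = "\<lambda>u. (u powr e - (u + pi) powr e) * sin u"
    have cont: "continuous_on {0..pi} (\<lambda>u. (u + pi) powr e * sin u)"
    proof (intro continuous_intros ballI)
      show "u + pi \<noteq> 0" if "u \<in> {0..pi}" for u using that pi_gt_zero by (smt (verit) atLeastAtMost_iff)
    qed
    have g_int: "?g integrable_on {0..pi}"
      using integrable_diff[OF f_int'[of 0 pi] integrable_continuous_real[OF cont]] by (simp add: f_def left_diff_distrib)
    have g_int12: "?g integrable_on {1..2}"
      by (rule integrable_on_subinterval[OF g_int]) (use pi_ge_two in auto)
    have g_pos: "0 \<le> ?g u" if "u \<in> {0..pi}" for u
      using that pos[of u] sin_ge_zero[of u] by (cases "u = 0") auto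
    \<comment> \<open>On [1, 2] the sine is at least 1/2, u^e is at least 1/4, and the power shifted
      by pi is at most half of u^e. The integrand is therefore at least 1/8 times 1/2.\<close>
    have "1 / 16 = integral {1..2} (\<lambda>u :: real. 1 / 16 :: real)" by simp
    also have "\<dots> \<le> integral {1..2} ?g"
    proof (rule integral_le[OF _ g_int12])
      fix u :: real assume u: "u \<in> {1..2}"
      have s: "1 / 2 \<le> sin u"
      proof -
        have "sin (pi / 6) \<le> sin u" if "u \<le> pi / 2"
          using u that pi_less_4 by (intro sin_mono_le_eq[THEN iffD2]) auto
        moreover have "sin (pi / 6) \<le> sin u" if "pi / 2 \<le> u"
        proof -
          have "sin (pi / 6) \<le> sin (pi - u)"
            using u that pi_gt3 pi_less_4 by (intro sin_mono_le_eq[THEN iffD2]) auto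
          then show ?thesis by simp
        qed
        ultimately show ?thesis by (simp add: sin_30) linarith
      qed
      have "(u + pi) powr e \<le> (2 * u) powr e"
        using u e pi_ge_two by (intro powr_mono2') auto
      also have "\<dots> = 2 powr e * u powr e" using u by (simp add: powr_mult)
      also have "(2::real) powr e \<le> 2 powr (- 1)" using e by (intro powr_mono) auto
      also have "(2::real) powr (- 1) = 1 / 2" by (simp add: powr_minus_divide)
      finally have "(u + pi) powr e \<le> 1 / 2 * u powr e" by (simp add: mult_right_mono)
      moreover have "1 / 4 \<le> u powr e"
      proof -
        have "1 / 4 = (2::real) powr (- 2)" by (simp add: powr_minus_divide)
        also have "\<dots> \<le> 2 powr e" using e by (intro powr_mono) auto
        also have "\<dots> \<le> u powr e" using u e by (intro powr_mono2') auto
        finally show ?thesis .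
      qed
      ultimately have "1 / 8 \<le> u powr e - (u + pi) powr e" by simp
      with s have "1 / 8 * (1 / 2) \<le> ?g u" by (intro mult_mono) auto
      then show "1 / 16 \<le> ?g u" by simp
    qed (rule integrable_const_ivl)
    also have "\<dots> \<le> integral {0..pi} ?g"
      by (rule integral_subset_le[OF _ g_int12 g_int]) (use g_pos pi_ge_two in auto)
    also have "\<dots> = integral {0..2 * pi} f" using pair[of 0] by simp
    finally show ?thesis .
  qed
  have even: "1 / 16 \<le> integral {0..2 * pi * real (Suc m)} f" for m
  proof (induction m)
    case (Suc m)
    have "integral {0..2 * pi * real (Suc (Suc m))} f = integral {0..2 * pi * real (Suc m)} f
        + integral {2 * pi * real (Suc m)..2 * pi * real (Suc m) + 2 * pi} f"
      by (subst Henstock_Kurzweil_Integration.integral_combine) (auto intro!: f_int' simp: algebra_simps)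
    with Suc step2[of "Suc m"] show ?case by simp
  qed (use base in simp)
  \<comment> \<open>For odd k the surplus half-wave is positive and can be added to the full
    periods. The case k = 1 contains no full period; there the first period minus its negative
    half-wave is used.\<close>
  have "1 / 16 \<le> integral {0..pi * real k} f"
  proof (cases "even k")
    case True
    then obtain m where "k = 2 * Suc m" using k by (metis dvdE mult_0_right not0_implies_Suc not_one_le_zero)
    with even[of m] show ?thesis by (simp add: algebra_simps)
  next
    case False
    then obtain m where m: "k = Suc (2 * m)" by (metis oddE Suc_eq_plus1)
    have "1 / 16 \<le> integral {0..2 * pi * real m + pi} f"
    proof (cases m)
      case 0
      have "integral {0..2 * pi} f = integral {0..pi} f + integral {pi..2 * pi} f"
        by (intro Henstock_Kurzweil_Integration.integral_combine[symmetric] f_int') auto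
      moreover have "integral {pi..2 * pi} f \<le> 0"
      proof -
        have "integral {pi..2 * pi} f \<le> integral {pi..2 * pi} (\<lambda>_. 0)"
        proof (intro integral_le f_int')
          fix u assume "u \<in> {pi..2 * pi}"
          then have "sin u \<le> 0" using sin_le_zero[of u] by (cases "u = 2 * pi") auto
          then show "f u \<le> 0" by (simp add: f_def mult_nonneg_nonpos)
        qed auto
        then show ?thesis by simp
      qed
      ultimately show ?thesis using base 0 by simp
    next
      case (Suc j)
      have "integral {0..2 * pi * real m + pi} f = integral {0..2 * pi * real m} f
          + integral {2 * pi * real m..2 * pi * real m + pi} f"
        by (intro Henstock_Kurzweil_Integration.integral_combine[symmetric] f_int') auto
      with even[of j] step1[of m] Suc show ?thesis by simp
    qed
    then show ?thesis using m by (simp add: algebra_simps)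
  qed
  then show ?thesis by (simp add: f_def)
qed

section \<open>Size and regularity in H of the Fourier coefficients\<close>

definition fbm_kernel :: "real \<Rightarrow> real \<Rightarrow> real" where
  "fbm_kernel H y = y powr (2 * H - 1) + (1 - 2 * H) * integral {0..y} (\<lambda>u. u powr (2 * H - 2) * (1 - cos u))"

text \<open>The negated cosine coefficient of t^(2H) - H t^2 on [0, 1] at frequency k, the usual
  factor 2 included. The power of pi k is its decay; \<open>fbm_kernel\<close> is the remaining
  factor, bounded above and away from 0 on compact ranges of H that avoid 1/2.\<close>

definition fbm_fourier :: "nat \<Rightarrow> real \<Rightarrow> real" where
  "fbm_fourier k H = 4 * H * (pi * real k) powr (- 2 * H - 1) * fbm_kernel H (pi * real k)"

lemma one_minus_cos_le: "1 - cos u \<le> u\<^sup>2 / 2" for u :: real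
proof -
  have "cos u = 1 - 2 * (sin (u / 2))\<^sup>2" using cos_double_sin[of "u / 2"] by simp
  moreover have "(sin (u / 2))\<^sup>2 \<le> (u / 2)\<^sup>2"
    using abs_sin_x_le_abs_x[of "u / 2"] by (metis abs_le_square_iff)
  ultimately show ?thesis by (simp add: power2_eq_square)
qed

lemma tendsto_0_powr_bound:
  fixes G :: "real \<Rightarrow> real"
  assumes G: "\<And>u. 0 \<le> u \<Longrightarrow> \<bar>G u\<bar> \<le> C * u powr a" and a: "0 < a"
  shows "(G \<longlongrightarrow> 0) (at 0 within {0..y})"
proof (rule Lim_null_comparison)
  show "eventually (\<lambda>u. norm (G u) \<le> C * u powr a) (at 0 within {0..y})"
    using G by (auto simp: eventually_at_filter)
  have "((\<lambda>u. C * u powr a) \<longlongrightarrow> C * 0) (at 0 within {0..y})"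
    using a by (intro tendsto_mult tendsto_const tendsto_zero_powrI[of _ _ _ a])
      (auto simp: eventually_at_filter)
  then show "((\<lambda>u. C * u powr a) \<longlongrightarrow> 0) (at 0 within {0..y})" by simp
qed

text \<open>\<open>0 powr a\<close> is 0 for every exponent \<open>a\<close>, so the bound fixes G 0
  = 0 as well as the limit at 0. This yields continuity up to 0 for expressions that contain
  negative powers.\<close>

lemma continuous_on_from_0:
  fixes G :: "real \<Rightarrow> real"
  assumes "\<And>u. 0 \<le> u \<Longrightarrow> \<bar>G u\<bar> \<le> C * u powr a" "0 < a"
    and "continuous_on {0<..} G"
  shows "continuous_on {0..y} G"
  unfolding continuous_on_def
proof
  fix x assume x: "x \<in> {0..y}"
  show "(G \<longlongrightarrow> G x) (at x within {0..y})"
  proof (cases "x = 0")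
    case True
    have "G 0 = 0" using assms(1)[of 0] by simp
    with True tendsto_0_powr_bound[OF assms(1,2)] show ?thesis by simp
  next
    case False
    with x assms(3) have "(G \<longlongrightarrow> G x) (at x)"
      by (simp add: continuous_on_eq_continuous_at isCont_def)
    then show ?thesis by (rule Lim_at_imp_Lim_at_within)
  qed
qed

lemma one_minus_cos_kernel_integrable:
  fixes H y :: real
  assumes H: "0 < H" "H < 1"
  shows "(\<lambda>u. u powr (2 * H - 2) * (1 - cos u)) integrable_on {0..y}"
proof (rule integrable_continuous_real, rule continuous_on_from_0[where C="1" and a="2*H"])
  show "\<bar>u powr (2 * H - 2) * (1 - cos u)\<bar> \<le> 1 * u powr (2 * H)" if "0 \<le> u" for u
  proof (cases "u = 0")
    case False
    have "\<bar>u powr (2 * H - 2) * (1 - cos u)\<bar> \<le> u powr (2 * H - 2) * u\<^sup>2"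
      using one_minus_cos_le[of u] by (auto simp: abs_mult intro!: mult_left_mono) (smt (verit) zero_le_power2)
    also have "u\<^sup>2 = u powr 2" using that False by simp
    finally show ?thesis by (simp add: powr_add[symmetric])
  qed simp
qed (use H in \<open>auto intro!: continuous_intros\<close>)

text \<open>Above one half, a further integration by parts makes the kernel absolutely integrable at infinity.\<close>

lemma fbm_kernel_gt_half:
  assumes H: "1 / 2 < H" "H < 1" and k: "1 \<le> k"
  shows "fbm_kernel H (pi * real k)
    = (2 * H - 1) * (2 - 2 * H) * integral {0..pi * real k} (\<lambda>u. u powr (2 * H - 3) * sin u)"
proof -
  define y where "y = pi * real k"
  have y: "1 \<le> y" unfolding y_def using k pi_ge_two mult_mono[of 1 pi 1 "real k"] by auto
  define J where "J = integral {0..y} (\<lambda>u. u powr (2 * H - 3) * sin u)"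
  define L where "L = integral {0..y} (\<lambda>u. u powr (2 * H - 2) * (1 - cos u))"
  \<comment> \<open>Obtained by integrating u^(2H-2) cos u by parts. At y = pi k the sine vanishes,
    so only the power survives at the upper limit, and it cancels the power in
    \<open>fbm_kernel\<close>.\<close>
  define G where "G = (\<lambda>u :: real. u powr (2 * H - 1) / (2 * H - 1) - u powr (2 * H - 2) * sin u)"
  have main: "((\<lambda>u. u powr (2 * H - 2) * (1 - cos u) + (2 - 2 * H) * (u powr (2 * H - 3) * sin u))
      has_integral (G y - G 0)) {0..y}"
  proof (rule fundamental_theorem_of_calculus_interior)
    show "continuous_on {0..y} G"
      unfolding G_def
    proof (rule continuous_on_from_0[where C="1 / (2 * H - 1) + 1" and a="2 * H - 1"])
      fix u :: real assume u: "0 \<le> u"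
      have "\<bar>u powr (2 * H - 2) * sin u\<bar> \<le> u powr (2 * H - 1)"
      proof (cases "u = 0")
        case False
        have "\<bar>u powr (2 * H - 2) * sin u\<bar> \<le> u powr (2 * H - 2) * u powr 1"
          using abs_sin_x_le_abs_x[of u] u False by (auto simp: abs_mult intro!: mult_left_mono)
        also have "\<dots> = u powr (2 * H - 1)" by (simp add: powr_add[symmetric] del: powr_one_gt_zero_iff powr_one powr_one')
        finally show ?thesis .
      qed simp
      moreover have "\<bar>u powr (2 * H - 1) / (2 * H - 1)\<bar> = 1 / (2 * H - 1) * u powr (2 * H - 1)"
        using H by simp
      ultimately show "\<bar>u powr (2 * H - 1) / (2 * H - 1) - u powr (2 * H - 2) * sin u\<bar>
          \<le> (1 / (2 * H - 1) + 1) * u powr (2 * H - 1)"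
        unfolding distrib_right by linarith
    qed (use H in \<open>auto intro!: continuous_intros\<close>)
    fix u assume u: "u \<in> {0<..<y}"
    have "(G has_real_derivative
       (2 * H - 1) * u powr (2 * H - 1 - 1) / (2 * H - 1) - ((2 * H - 2) * u powr (2 * H - 2 - 1) * sin u + cos u * u powr (2 * H - 2))) (at u)"
      unfolding G_def using u H by (auto intro!: derivative_eq_intros)
    also have "(2 * H - 1) * u powr (2 * H - 1 - 1) / (2 * H - 1) = u powr (2 * H - 2)"
      using H by simp
    also have "2 * H - 2 - 1 = 2 * H - 3" by simp
    finally show "(G has_vector_derivative u powr (2 * H - 2) * (1 - cos u) + (2 - 2 * H) * (u powr (2 * H - 3) * sin u)) (at u)"
      unfolding has_real_derivative_iff_has_vector_derivative[symmetric]
      by (simp add: algebra_simps)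
  qed (use y in auto)
  have "G 0 = 0" by (simp add: G_def)
  moreover have "G y = y powr (2 * H - 1) / (2 * H - 1)" by (simp add: G_def y_def)
  moreover have L: "((\<lambda>u. u powr (2 * H - 2) * (1 - cos u)) has_integral L) {0..y}"
    unfolding L_def using one_minus_cos_kernel_integrable[of H] H by (intro integrable_integral) auto
  moreover have J: "((\<lambda>u. u powr (2 * H - 3) * sin u) has_integral J) {0..y}"
    unfolding J_def
  proof (intro integrable_integral integral_powr_bounds(1)[where A=1 and a="2 * H - 2" and A'=1 and b="2 * H - 3"])
    show "\<bar>u powr (2 * H - 3) * sin u\<bar> \<le> 1 * u powr (2 * H - 2)" if "0 \<le> u" "u \<le> 1" for u
    proof (cases "u = 0")
      case False
      have "\<bar>u powr (2 * H - 3) * sin u\<bar> \<le> u powr (2 * H - 3) * u powr 1"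
        using abs_sin_x_le_abs_x[of u] that False by (auto simp: abs_mult intro!: mult_left_mono)
      also have "\<dots> = u powr (2 * H - 2)" by (simp add: powr_add[symmetric] del: powr_one_gt_zero_iff powr_one powr_one')
      finally show ?thesis by simp
    qed simp
    show "\<bar>u powr (2 * H - 3) * sin u\<bar> \<le> 1 * u powr (2 * H - 3)" for u
      by (auto simp: abs_mult intro!: mult_left_le)
  qed (use y H in auto)
  ultimately have "L + (2 - 2 * H) * J = y powr (2 * H - 1) / (2 * H - 1)"
    using has_integral_unique[OF has_integral_add[OF L has_integral_mult_right[OF J, of "2 - 2 * H"]] main] by simp
  then have "(2 * H - 1) * (L + (2 - 2 * H) * J) = y powr (2 * H - 1)" using H by simp
  then show ?thesis
    unfolding fbm_kernel_def y_def[symmetric] L_def[symmetric] J_def[symmetric] by (simp add: algebra_simps)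
qed

text \<open>Below 1/2 the integral of u^(2H-2) (1 - cos u) converges absolutely at infinity; above
  1/2 the sine representation does, and converges at 0 as well. In both cases the prefactor is
  positive. At 1/2 the prefactors vanish and the exponents reach the limit of integrability, whence
  the separation of [a, b] from 1/2.\<close>

lemma fbm_kernel_bounds:
  fixes a b :: real
  assumes ab: "0 < a" "a \<le> b" "b < 1" and half: "b < 1 / 2 \<or> 1 / 2 < a"
  obtains c C L where "0 < c" "0 \<le> L"
    "\<And>k H. 1 \<le> k \<Longrightarrow> a \<le> H \<Longrightarrow> H \<le> b \<Longrightarrow> c \<le> fbm_kernel H (pi * real k) \<and> fbm_kernel H (pi * real k) \<le> C"
    "\<And>k H H'. 1 \<le> k \<Longrightarrow> a \<le> H \<Longrightarrow> H \<le> b \<Longrightarrow> a \<le> H' \<Longrightarrow> H' \<le> b \<Longrightarrow>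
        \<bar>fbm_kernel H (pi * real k) - fbm_kernel H' (pi * real k)\<bar> \<le> L * \<bar>H - H'\<bar>"
  using half
proof
  assume b: "b < 1 / 2"
  obtain K where K: "0 \<le> K"
    "\<And>e y. 2 * a - 2 \<le> e \<Longrightarrow> e \<le> 2 * b - 2 \<Longrightarrow> 1 \<le> y \<Longrightarrow> (\<lambda>u. u powr e * (1 - cos u)) integrable_on {0..y}"
    "\<And>e y. 2 * a - 2 \<le> e \<Longrightarrow> e \<le> 2 * b - 2 \<Longrightarrow> 1 \<le> y \<Longrightarrow> \<bar>integral {0..y} (\<lambda>u. u powr e * (1 - cos u))\<bar> \<le> K"
    "\<And>e e' y. 2 * a - 2 \<le> e \<Longrightarrow> e \<le> 2 * b - 2 \<Longrightarrow> 2 * a - 2 \<le> e' \<Longrightarrow> e' \<le> 2 * b - 2 \<Longrightarrow> 1 \<le> y \<Longrightarrow>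
       \<bar>integral {0..y} (\<lambda>u. u powr e * (1 - cos u)) - integral {0..y} (\<lambda>u. u powr e' * (1 - cos u))\<bar> \<le> K * \<bar>e - e'\<bar>"
  proof (rule powr_kernel_bounds[where g="\<lambda>u. 1 - cos u" and C=2 and d=2 and ?e0.0="2*a-2" and ?e1.0="2*b-2"])
    show "\<bar>1 - cos u\<bar> \<le> 2 * u powr 2" if "0 \<le> u" for u :: real
      using one_minus_cos_le[of u] that cos_le_one[of u] by (cases "u = 0") (auto, smt (verit) zero_le_power2)
    show "\<bar>1 - cos u\<bar> \<le> 2" for u :: real
      using cos_le_one[of u] cos_ge_minus_one[of u] by linarith
  qed (use ab b in auto)
  have y: "1 \<le> pi * real k" "pi \<le> pi * real k" if "1 \<le> k" for k
    using that pi_ge_two mult_mono[of 1 pi 1 "real k"] by auto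
  show ?thesis
  proof (rule that[of "(1 - 2 * b) * (1 / 8)" "2 / (1 - 2 * b) + 2 * K + 2 * K" "1 + K"])
    show "0 < (1 - 2 * b) * (1 / 8)" using b by simp
    show "0 \<le> 2 / (1 - 2 * b) + 2 * K + 2 * K" using b K by auto
  next
    fix k :: nat and H assume k: "1 \<le> k" and H: "a \<le> H" "H \<le> b"
    let ?y = "pi * real k"
    let ?J = "integral {0..?y} (\<lambda>u. u powr (2 * H - 2) * (1 - cos u))"
    have int: "(\<lambda>u. u powr (2 * H - 2) * (1 - cos u)) integrable_on {0..?y}"
      using K(2) H y[OF k] by auto
    \<comment> \<open>On [pi/2, pi] the factor 1 - cos u is at least 1 and the power at least
      pi^(-2). The interval has length pi/2, and 1/(2 pi) exceeds 1/8 because pi < 4.\<close>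
    have "integral {pi/2..pi} (\<lambda>u :: real. 1 / pi\<^sup>2 :: real) \<le> ?J"
    proof (rule order_trans[OF integral_le integral_subset_le])
      show "(\<lambda>u. u powr (2 * H - 2) * (1 - cos u)) integrable_on {pi / 2..pi}"
        by (rule integrable_on_subinterval[OF int]) (use y[OF k] in auto)
      then show "(\<lambda>u. u powr (2 * H - 2) * (1 - cos u)) integrable_on {pi / 2..pi}" .
      fix u :: real assume u: "u \<in> {pi / 2..pi}"
      then have u0: "0 < u" by (auto intro: less_le_trans[OF pi_half_gt_zero])
      have "1 / pi\<^sup>2 = pi powr (- 2)" by (simp add: powr_minus_divide)
      also have "\<dots> \<le> pi powr (2 * H - 2)" using H ab pi_ge_two by (intro powr_mono) auto
      also have "\<dots> \<le> u powr (2 * H - 2)" using u u0 H b by (intro powr_mono2') auto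
      also have "\<dots> \<le> u powr (2 * H - 2) * (1 - cos u)"
        using u cos_monotone_0_pi_le[of "pi/2" u] by (simp add: mult_le_cancel_left1)
      finally show "1 / pi\<^sup>2 \<le> u powr (2 * H - 2) * (1 - cos u)" .
    qed (use y[OF k] int in auto)
    moreover have "1 / 8 \<le> integral {pi/2..pi} (\<lambda>u :: real. 1 / pi\<^sup>2 :: real)"
      using pi_gt_zero pi_less_4 by (simp add: power2_eq_square field_simps)
    ultimately have "1 / 8 \<le> ?J" by linarith
    then have "(1 - 2 * b) * (1 / 8) \<le> (1 - 2 * H) * ?J" using H b by (intro mult_mono) auto
    moreover have "0 \<le> ?y powr (2 * H - 1)" by simp
    moreover have "?y powr (2 * H - 1) \<le> 1 powr (2 * H - 1)" using H b y[OF k] by (intro powr_mono2') auto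
    moreover have "(1 - 2 * H) * ?J \<le> 1 * K"
      using K(3)[of "2 * H - 2" ?y] K(1) H ab b y[OF k] \<open>1 / 8 \<le> ?J\<close> by (intro mult_mono) auto
    ultimately show "(1 - 2 * b) * (1 / 8) \<le> fbm_kernel H ?y \<and> fbm_kernel H ?y \<le> 1 + K"
      unfolding fbm_kernel_def powr_one_eq_one by (intro conjI) linarith+
  next
    fix k :: nat and H H' assume k: "1 \<le> k" and H: "a \<le> H" "H \<le> b" "a \<le> H'" "H' \<le> b"
    let ?y = "pi * real k"
    let ?J = "\<lambda>H. integral {0..?y} (\<lambda>u. u powr (2 * H - 2) * (1 - cos u))"
    have 1: "\<bar>?y powr (2 * H - 1) - ?y powr (2 * H' - 1)\<bar> \<le> 2 / (1 - 2 * b) * \<bar>H - H'\<bar>"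
    proof -
      have "\<bar>?y powr (2 * H - 1) - ?y powr (2 * H' - 1)\<bar>
          \<le> \<bar>(2 * H - 1) - (2 * H' - 1)\<bar> / (1 - 2 * b) * ?y powr (2 * b - 1 + (1 - 2 * b))"
        using H b y[OF k] by (intro abs_powr_diff_ge_1) auto
      moreover have "\<bar>(2 * H - 1) - (2 * H' - 1)\<bar> = 2 * \<bar>H - H'\<bar>" using abs_mult[of 2 "H - H'"] by (simp add: right_diff_distrib)
      ultimately show ?thesis using y[OF k] by simp
    qed
    have 2: "\<bar>?J H - ?J H'\<bar> \<le> K * \<bar>(2 * H - 2) - (2 * H' - 2)\<bar>" and 3: "\<bar>?J H'\<bar> \<le> K"
      using K(4)[of "2 * H - 2" "2 * H' - 2" ?y] K(3)[of "2 * H' - 2" ?y] H y[OF k] by auto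
    have "\<bar>(2 * H - 2) - (2 * H' - 2)\<bar> = 2 * \<bar>H - H'\<bar>" using abs_mult[of 2 "H - H'"] by (simp add: right_diff_distrib)
    with 2 have 2: "\<bar>?J H - ?J H'\<bar> \<le> 2 * K * \<bar>H - H'\<bar>" by simp
    have "fbm_kernel H ?y - fbm_kernel H' ?y = (?y powr (2 * H - 1) - ?y powr (2 * H' - 1))
        + (1 - 2 * H) * (?J H - ?J H') - 2 * (H - H') * ?J H'"
      unfolding fbm_kernel_def by (simp add: algebra_simps)
    then have "\<bar>fbm_kernel H ?y - fbm_kernel H' ?y\<bar> \<le> \<bar>?y powr (2 * H - 1) - ?y powr (2 * H' - 1)\<bar>
        + \<bar>(1 - 2 * H) * (?J H - ?J H')\<bar> + \<bar>2 * (H - H') * ?J H'\<bar>"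
      by linarith
    moreover have "\<bar>(1 - 2 * H) * (?J H - ?J H')\<bar> \<le> 1 * (2 * K * \<bar>H - H'\<bar>)"
      unfolding abs_mult using 2 H b ab by (intro mult_mono) auto
    moreover have "\<bar>2 * (H - H') * ?J H'\<bar> \<le> 2 * \<bar>H - H'\<bar> * K"
      unfolding abs_mult using 3 by (intro mult_mono) auto
    ultimately have "\<bar>fbm_kernel H ?y - fbm_kernel H' ?y\<bar> \<le> 2 / (1 - 2 * b) * \<bar>H - H'\<bar> + 1 * (2 * K * \<bar>H - H'\<bar>) + 2 * \<bar>H - H'\<bar> * K"
      using 1 by linarith
    then show "\<bar>fbm_kernel H ?y - fbm_kernel H' ?y\<bar> \<le> (2 / (1 - 2 * b) + 2 * K + 2 * K) * \<bar>H - H'\<bar>"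
      unfolding distrib_right by (simp add: mult.commute mult.left_commute)
  qed
next
  assume a: "1 / 2 < a"
  obtain K where K: "0 \<le> K"
    "\<And>e y. 2 * a - 3 \<le> e \<Longrightarrow> e \<le> 2 * b - 3 \<Longrightarrow> 1 \<le> y \<Longrightarrow> (\<lambda>u. u powr e * sin u) integrable_on {0..y}"
    "\<And>e y. 2 * a - 3 \<le> e \<Longrightarrow> e \<le> 2 * b - 3 \<Longrightarrow> 1 \<le> y \<Longrightarrow> \<bar>integral {0..y} (\<lambda>u. u powr e * sin u)\<bar> \<le> K"
    "\<And>e e' y. 2 * a - 3 \<le> e \<Longrightarrow> e \<le> 2 * b - 3 \<Longrightarrow> 2 * a - 3 \<le> e' \<Longrightarrow> e' \<le> 2 * b - 3 \<Longrightarrow> 1 \<le> y \<Longrightarrow>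
       \<bar>integral {0..y} (\<lambda>u. u powr e * sin u) - integral {0..y} (\<lambda>u. u powr e' * sin u)\<bar> \<le> K * \<bar>e - e'\<bar>"
  proof (rule powr_kernel_bounds[where g=sin and C=1 and d=1 and ?e0.0="2*a-3" and ?e1.0="2*b-3"])
    show "\<bar>sin u\<bar> \<le> 1 * u powr 1" if "0 \<le> u" for u :: real
      using abs_sin_x_le_abs_x[of u] that by (cases "u = 0") auto
  qed (use ab a in auto)
  have y: "1 \<le> pi * real k" if "1 \<le> k" for k
    using that pi_ge_two mult_mono[of 1 pi 1 "real k"] by auto
  define q where "q = (\<lambda>H :: real. (2 * H - 1) * (2 - 2 * H))"
  have q: "(2 * a - 1) * (2 - 2 * b) \<le> q H" "0 < q H" "q H \<le> 2" if "a \<le> H" "H \<le> b" for H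
  proof -
    show "(2 * a - 1) * (2 - 2 * b) \<le> q H" unfolding q_def using that a ab by (intro mult_mono) auto
    show "0 < q H" unfolding q_def using that a ab by (intro mult_pos_pos) auto
    have "q H \<le> 1 * 2" unfolding q_def using that a ab by (intro mult_mono) auto
    then show "q H \<le> 2" by simp
  qed
  show ?thesis
  proof (rule that[of "(2 * a - 1) * (2 - 2 * b) * (1 / 16)" "4 * K + 4 * K" "2 * K"])
    show "0 < (2 * a - 1) * (2 - 2 * b) * (1 / 16)" using ab a by simp
    show "0 \<le> 4 * K + 4 * K" using K by auto
  next
    fix k :: nat and H assume k: "1 \<le> k" and H: "a \<le> H" "H \<le> b"
    let ?y = "pi * real k"
    let ?J = "integral {0..?y} (\<lambda>u. u powr (2 * H - 3) * sin u)"
    have eq: "fbm_kernel H ?y = q H * ?J"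
      unfolding q_def using H ab a by (intro fbm_kernel_gt_half k) auto
    have J: "1 / 16 \<le> ?J" using H ab a by (intro integral_powr_sin_ge k) auto
    have "(2 * a - 1) * (2 - 2 * b) * (1 / 16) \<le> q H * ?J"
      using J q[OF H] by (intro mult_mono) auto
    moreover have "q H * ?J \<le> 2 * K"
      using J K(3)[of "2 * H - 3" ?y] q[OF H] H y[OF k] K(1) by (intro mult_mono) auto
    ultimately show "(2 * a - 1) * (2 - 2 * b) * (1 / 16) \<le> fbm_kernel H ?y \<and> fbm_kernel H ?y \<le> 2 * K"
      unfolding eq by simp
  next
    fix k :: nat and H H' assume k: "1 \<le> k" and H: "a \<le> H" "H \<le> b" "a \<le> H'" "H' \<le> b"
    let ?y = "pi * real k"
    let ?J = "\<lambda>H. integral {0..?y} (\<lambda>u. u powr (2 * H - 3) * sin u)"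
    have eq: "fbm_kernel H ?y = q H * ?J H" "fbm_kernel H' ?y = q H' * ?J H'"
      unfolding q_def using H ab a by (auto intro!: fbm_kernel_gt_half k)
    have 2: "\<bar>?J H - ?J H'\<bar> \<le> K * \<bar>(2 * H - 3) - (2 * H' - 3)\<bar>" and 3: "\<bar>?J H'\<bar> \<le> K"
      using K(4)[of "2 * H - 3" "2 * H' - 3" ?y] K(3)[of "2 * H' - 3" ?y] H y[OF k] by auto
    have "\<bar>(2 * H - 3) - (2 * H' - 3)\<bar> = 2 * \<bar>H - H'\<bar>" using abs_mult[of 2 "H - H'"] by (simp add: right_diff_distrib)
    with 2 have 2: "\<bar>?J H - ?J H'\<bar> \<le> 2 * K * \<bar>H - H'\<bar>" by simp
    have qd: "\<bar>q H - q H'\<bar> \<le> 4 * \<bar>H - H'\<bar>"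
    proof -
      have "q H - q H' = (H - H') * (6 - 4 * (H + H'))" by (simp add: q_def algebra_simps)
      also have "\<bar>\<dots>\<bar> \<le> \<bar>H - H'\<bar> * 4" unfolding abs_mult using H a ab by (intro mult_left_mono) auto
      finally show ?thesis by simp
    qed
    have "fbm_kernel H ?y - fbm_kernel H' ?y = q H * (?J H - ?J H') + (q H - q H') * ?J H'"
      unfolding eq by (simp add: algebra_simps)
    then have "\<bar>fbm_kernel H ?y - fbm_kernel H' ?y\<bar> \<le> \<bar>q H * (?J H - ?J H')\<bar> + \<bar>(q H - q H') * ?J H'\<bar>" by linarith
    moreover have "\<bar>q H * (?J H - ?J H')\<bar> \<le> 2 * (2 * K * \<bar>H - H'\<bar>)"
      unfolding abs_mult using 2 q[of H] H by (intro mult_mono) auto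
    moreover have "\<bar>(q H - q H') * ?J H'\<bar> \<le> 4 * \<bar>H - H'\<bar> * K"
      unfolding abs_mult using 3 qd by (intro mult_mono) auto
    ultimately have "\<bar>fbm_kernel H ?y - fbm_kernel H' ?y\<bar> \<le> 2 * (2 * K * \<bar>H - H'\<bar>) + 4 * \<bar>H - H'\<bar> * K"
      by linarith
    then show "\<bar>fbm_kernel H ?y - fbm_kernel H' ?y\<bar> \<le> (4 * K + 4 * K) * \<bar>H - H'\<bar>"
      unfolding distrib_right by (simp add: mult.commute mult.left_commute)
  qed
qed

section \<open>Completeness of the cosines and the expansion of the variance function\<close>

lemma cosine_coefficients_zero_imp_zero:
  fixes h :: "real \<Rightarrow> real"
  assumes h: "continuous_on {0..1} h"
    and coeff: "\<And>k :: nat. integral {0..1} (\<lambda>t. h t * cos (pi * real k * t)) = 0"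
    and t: "t \<in> {0..1}"
  shows "h t = 0"
proof -
  have int: "(\<lambda>t. h t * g t) integrable_on {0..1}" if "continuous_on {0..1} g" for g
    using h that by (intro integrable_continuous_real continuous_intros)
  \<comment> \<open>The product formula writes cos(pi k t) cos(pi t) through the frequencies k + 1
    and k - 1, so the frequency is generalised in the induction; frequency 0 has no lower neighbour
    and is treated apart. As a result \<open>h\<close> is orthogonal to every polynomial in cos(pi
    t).\<close>
  have pow: "integral {0..1} (\<lambda>t. h t * (cos (pi * real k * t) * cos (pi * t) ^ j)) = 0" for j k
  proof (induction j arbitrary: k)
    case 0
    then show ?case using coeff by simp
  next
    case (Suc j)
    show ?case
    proof (cases k)
      case 0
      then show ?thesis using Suc[of 1] by (simp add: mult_ac)
    next
      case k: (Suc k')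
      have "cos (pi * real k * t) * cos (pi * t) ^ Suc j
          = (cos (pi * real (Suc k) * t) * cos (pi * t) ^ j + cos (pi * real k' * t) * cos (pi * t) ^ j) / 2" for t
      proof -
        have "cos (pi * real (Suc k) * t) + cos (pi * real k' * t) = 2 * (cos (pi * real k * t) * cos (pi * t))"
        proof -
          have "pi * real (Suc k) * t = pi * real k * t + pi * t" "pi * real k' * t = pi * real k * t - pi * t"
            by (simp_all add: k algebra_simps)
          then show ?thesis by (simp add: cos_add cos_diff)
        qed
        then show ?thesis by (simp add: distrib_right[symmetric])
      qed
      then have "(\<lambda>t. h t * (cos (pi * real k * t) * cos (pi * t) ^ Suc j))
          = (\<lambda>t. (h t * (cos (pi * real (Suc k) * t) * cos (pi * t) ^ j)
            + h t * (cos (pi * real k' * t) * cos (pi * t) ^ j)) * (1 / 2))"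
        by (simp add: fun_eq_iff algebra_simps add_divide_distrib)
      then have "integral {0..1} (\<lambda>t. h t * (cos (pi * real k * t) * cos (pi * t) ^ Suc j))
         = (integral {0..1} (\<lambda>t. h t * (cos (pi * real (Suc k) * t) * cos (pi * t) ^ j))
          + integral {0..1} (\<lambda>t. h t * (cos (pi * real k' * t) * cos (pi * t) ^ j))) * (1 / 2)"
        by (simp only: integral_mult_left, subst integral_add) (auto intro!: int continuous_intros)
      then show ?thesis unfolding Suc.IH by simp
    qed
  qed
  \<comment> \<open>Stone-Weierstrass in the variable x = cos(pi t) provides a polynomial uniformly
    close to \<open>h\<close>. By orthogonality only the approximation error remains in the integral
    of h^2.\<close>
  have hh: "integral {0..1} (\<lambda>t. h t * h t) \<le> \<epsilon> * integral {0..1} (\<lambda>t. \<bar>h t\<bar>)" if \<epsilon>: "0 < \<epsilon>" for \<epsilon>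
  proof -
    have cont: "continuous_on {-1..1} (\<lambda>x. h (arccos x / pi))"
      using arccos_lbound arccos_ubound
      by (intro continuous_on_compose2[OF h] continuous_intros) (auto simp: arccos)
    obtain p where p: "real_polynomial_function p" "\<And>x. x \<in> {-1..1} \<Longrightarrow> \<bar>h (arccos x / pi) - p x\<bar> < \<epsilon>"
      using Stone_Weierstrass_real_polynomial_function[OF compact_Icc cont \<epsilon>] by blast
    obtain a n where an: "p = (\<lambda>x. \<Sum>i\<le>n. a i * x ^ i)"
      using p(1) real_polynomial_function_iff_sum by blast
    have close: "\<bar>h t - p (cos (pi * t))\<bar> \<le> \<epsilon>" if t: "t \<in> {0..1}" for t
    proof -
      have "arccos (cos (pi * t)) = pi * t" using t by (intro arccos_cos) auto
      then show ?thesis using p(2)[of "cos (pi * t)"] by auto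
    qed
    have pc: "continuous_on {0..1} (\<lambda>t. p (cos (pi * t)))"
      unfolding an by (intro continuous_intros)
    have "integral {0..1} (\<lambda>t. h t * p (cos (pi * t))) = (\<Sum>i\<le>n. a i * integral {0..1} (\<lambda>t. h t * (cos (pi * real 0 * t) * cos (pi * t) ^ i)))"
    proof -
      have "(\<lambda>t. h t * p (cos (pi * t))) = (\<lambda>t. \<Sum>i\<le>n. a i * (h t * (cos (pi * real 0 * t) * cos (pi * t) ^ i)))"
        by (simp add: an sum_distrib_left mult_ac)
      then show ?thesis
        by (simp only: integral_mult_right[symmetric], subst integral_sum[symmetric])
           (auto intro!: integrable_on_mult_right int continuous_intros)
    qed
    then have "integral {0..1} (\<lambda>t. h t * p (cos (pi * t))) = 0" unfolding pow by simp
    then have "integral {0..1} (\<lambda>t. h t * h t) = integral {0..1} (\<lambda>t. h t * h t - h t * p (cos (pi * t)))"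
      by (subst integral_diff) (auto intro!: int h pc)
    also have "\<dots> \<le> integral {0..1} (\<lambda>t. \<epsilon> * \<bar>h t\<bar>)"
    proof (rule integral_le)
      show "(\<lambda>t. h t * h t - h t * p (cos (pi * t))) integrable_on {0..1}"
        by (intro integrable_diff int h pc)
      show "(\<lambda>t. \<epsilon> * \<bar>h t\<bar>) integrable_on {0..1}"
        using h by (intro integrable_continuous_real continuous_intros)
      show "h t * h t - h t * p (cos (pi * t)) \<le> \<epsilon> * \<bar>h t\<bar>" if "t \<in> {0..1}" for t
      proof -
        have "h t * h t - h t * p (cos (pi * t)) \<le> \<bar>h t * (h t - p (cos (pi * t)))\<bar>"
          by (simp add: right_diff_distrib)
        also have "\<dots> \<le> \<bar>h t\<bar> * \<epsilon>" unfolding abs_mult by (intro mult_left_mono close that) auto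
        finally show ?thesis by (simp add: mult.commute)
      qed
    qed
    finally show ?thesis by simp
  qed
  have "integral {0..1} (\<lambda>t. h t * h t) \<le> 0"
  proof (rule field_le_epsilon)
    fix e :: real assume e: "0 < e"
    define m where "m = integral {0..1} (\<lambda>t. \<bar>h t\<bar>)"
    have m: "0 \<le> m" unfolding m_def
      using h by (intro Henstock_Kurzweil_Integration.integral_nonneg integrable_continuous_real continuous_intros) auto
    have "integral {0..1} (\<lambda>t. h t * h t) \<le> e / (m + 1) * m" using hh[of "e / (m + 1)"] e m by (simp add: m_def)
    also have "\<dots> \<le> e" using e m by (simp add: field_simps)
    finally show "integral {0..1} (\<lambda>t. h t * h t) \<le> 0 + e" by simp
  qed
  moreover have "0 \<le> integral {0..1} (\<lambda>t. h t * h t)"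
    by (intro Henstock_Kurzweil_Integration.integral_nonneg int h) auto
  ultimately have "integral {0..1} (\<lambda>t. h t * h t) = 0" by simp
  moreover have "continuous_on {0..1} (\<lambda>t. h t * h t)" by (intro continuous_intros h)
  ultimately have "\<forall>t\<in>{0..1}. h t * h t = 0" by (subst (asm) integral_eq_0_iff) simp_all
  with t show ?thesis by simp
qed

lemma integral_cos_pi: "integral {0..1} (\<lambda>t. cos (pi * real k * t)) = (if k = 0 then 1 else 0)"
proof (cases "k = 0")
  case False
  have "((\<lambda>t. cos (pi * real k * t)) has_integral
      (sin (pi * real k * 1) / (pi * real k) - sin (pi * real k * 0) / (pi * real k))) {0..1}"
    by (rule fundamental_theorem_of_calculus)
       (use False in \<open>auto intro!: derivative_eq_intros simp: has_real_derivative_iff_has_vector_derivative[symmetric]\<close>)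
  then show ?thesis using False by (simp add: integral_unique mult.commute[of pi])
qed simp

lemma integral_cos_cos_pi:
  assumes "1 \<le> k"
  shows "integral {0..1} (\<lambda>t. cos (pi * real k * t) * cos (pi * real j * t)) = (if j = k then 1 / 2 else 0)"
proof -
  define d where "d = (if k \<le> j then j - k else k - j)"
  have "cos (pi * real k * t) * cos (pi * real j * t)
      = (1 / 2) * (cos (pi * real (j + k) * t) + cos (pi * real d * t))" for t
  proof -
    have "cos (pi * real d * t) = cos (pi * real j * t - pi * real k * t)"
    proof (cases "k \<le> j")
      case True
      then show ?thesis by (simp add: d_def of_nat_diff algebra_simps)
    next
      case False
      then have "pi * real d * t = - (pi * real j * t - pi * real k * t)" by (simp add: d_def of_nat_diff algebra_simps)
      then show ?thesis by (simp only: cos_minus)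
    qed
    moreover have "cos (pi * real (j + k) * t) = cos (pi * real j * t + pi * real k * t)" by (simp add: algebra_simps)
    ultimately show ?thesis by (simp add: cos_add cos_diff)
  qed
  then have "integral {0..1} (\<lambda>t. cos (pi * real k * t) * cos (pi * real j * t))
      = (1 / 2) * (integral {0..1} (\<lambda>t. cos (pi * real (j + k) * t)) + integral {0..1} (\<lambda>t. cos (pi * real d * t)))"
    by (simp only: integral_mult_right, subst integral_add)
       (auto intro!: integrable_continuous_real continuous_intros)
  also have "\<dots> = (if j = k then 1 / 2 else 0)"
    using assms unfolding integral_cos_pi by (auto simp: d_def)
  finally show ?thesis .
qed

text \<open>Two integrations by parts and the scaling u = c t with c = pi k. The second primitive of
  the sine is taken as 1 - cos, whose double zero at 0 compensates the negative powers of t.\<close>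

lemma fbm_cosine_coefficient:
  assumes H: "0 < H" "H < 1" and k: "1 \<le> k"
  shows "integral {0..1} (\<lambda>t. (t powr (2 * H) - H * t\<^sup>2) * cos (pi * real k * t)) = - fbm_fourier k H / 2"
proof -
  define c where "c = pi * real k"
  define p where "p = 2 * H"
  have c: "0 < c" and p: "0 < p" "p < 2" using k H by (auto simp: c_def p_def)
  have sin_c: "sin c = 0" by (simp add: c_def mult.commute[of pi])
  define L where "L = integral {0..c} (\<lambda>u. u powr (p - 2) * (1 - cos u))"
  have L1: "((\<lambda>t. t powr (p - 2) * (1 - cos (c * t))) has_integral (c powr (1 - p) * L)) {0..1}"
  proof -
    have "((\<lambda>u. u powr (p - 2) * (1 - cos u)) has_integral L) {0..c}"
      unfolding L_def p_def using one_minus_cos_kernel_integrable[OF H] by (auto intro: integrable_integral)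
    from has_integral_stretch_real[OF this, of c] c
    have "((\<lambda>t. (c * t) powr (p - 2) * (1 - cos (c * t))) has_integral (1 / c) * L) ((\<lambda>x. x / c) ` {0..c})"
      by simp
    moreover have "(\<lambda>x. x / c) ` {0..c} = {0..1}"
      using c by (auto simp: image_iff field_simps intro!: bexI[of _ "c * _"])
    ultimately have "((\<lambda>t. c powr (2 - p) * ((c * t) powr (p - 2) * (1 - cos (c * t)))) has_integral c powr (2 - p) * ((1 / c) * L)) {0..1}"
      by (intro has_integral_mult_right) simp
    moreover have "c powr (2 - p) * ((c * t) powr (p - 2) * (1 - cos (c * t))) = t powr (p - 2) * (1 - cos (c * t))" if "t \<in> {0..1}" for t
    proof -
      have "c powr (2 - p) * (c * t) powr (p - 2) = t powr (p - 2)"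
        using c that powr_add[of c "2 - p" "p - 2"] by (simp add: powr_mult mult.assoc[symmetric])
      then show ?thesis by (simp add: mult.assoc[symmetric])
    qed
    moreover have "c powr (2 - p) * ((1 / c) * L) = c powr (1 - p) * L"
      using c powr_diff[of c "2 - p" 1] by simp
    ultimately show ?thesis by (metis (no_types, lifting) has_integral_cong)
  qed
  define d where "d = 1 / c\<^sup>2"
  \<comment> \<open>Since p = 2 H, the derivative of the function is p (t^(p-1) - t). The last
    bracket is the primitive of t sin(c t), the one before it the boundary term for t^(p-1) sin(c
    t).\<close>
  define G where "G = (\<lambda>t. (t powr p - H * t\<^sup>2) * sin (c * t) / c
      - (p / c) * (t powr (p - 1) * (1 - cos (c * t)) / c - (d * sin (c * t) - t * cos (c * t) / c)))"
  have main: "((\<lambda>t. (t powr p - H * t\<^sup>2) * cos (c * t) - (p * (p - 1) / c\<^sup>2) * (t powr (p - 2) * (1 - cos (c * t))))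
      has_integral (G 1 - G 0)) {0..1}"
  proof (rule fundamental_theorem_of_calculus_interior)
    have c1: "continuous_on {0..1} (\<lambda>t. t powr (p - 1) * (1 - cos (c * t)))"
    proof (rule continuous_on_from_0[where C="c\<^sup>2 / 2" and a="p + 1"])
      show "\<bar>t powr (p - 1) * (1 - cos (c * t))\<bar> \<le> c\<^sup>2 / 2 * t powr (p + 1)" if "0 \<le> t" for t
      proof (cases "t = 0")
        case False
        have "\<bar>t powr (p - 1) * (1 - cos (c * t))\<bar> \<le> t powr (p - 1) * ((c * t)\<^sup>2 / 2)"
          using one_minus_cos_le[of "c * t"] cos_le_one[of "c * t"] unfolding abs_mult by (intro mult_mono) auto
        also have "\<dots> = c\<^sup>2 / 2 * (t powr (p - 1) * t powr 2)"
          using that False by (simp add: power_mult_distrib)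
        also have "t powr (p - 1) * t powr 2 = t powr (p + 1)" by (simp add: powr_add[symmetric] add.commute)
        finally show ?thesis .
      qed simp
    qed (use p in \<open>auto intro!: continuous_intros\<close>)
    have c2: "continuous_on {0..1} (\<lambda>t. t powr p)"
      using p by (intro continuous_on_powr') (auto intro!: continuous_intros)
    show "continuous_on {0..1} G"
      unfolding G_def using c by (intro continuous_intros c1 c2) auto
    fix t :: real assume t: "t \<in> {0<..<1}"
    have "(G has_real_derivative
       (((p * t powr (p - 1) - H * (2 * t)) * sin (c * t) + (t powr p - H * t\<^sup>2) * (c * cos (c * t))) / c
      - (p / c) * (((p - 1) * t powr (p - 1 - 1) * (1 - cos (c * t)) + t powr (p - 1) * (c * sin (c * t))) / c
        - (d * (c * cos (c * t)) - (cos (c * t) - t * (c * sin (c * t))) / c)))) (at t)"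
      unfolding G_def using t c by (auto intro!: derivative_eq_intros simp: mult_ac)
    moreover have "p - 1 - 1 = p - 2" by simp
    moreover have "((p * X - H * (2 * t)) * s + Y * (c * cs)) / c
        - (p / c) * (((p - 1) * Z * w + X * (c * s)) / c - (d * (c * cs) - (cs - t * (c * s)) / c))
      = Y * cs - (p * (p - 1) / c\<^sup>2) * (Z * w)" for X Y Z s cs w
      using c unfolding p_def d_def by (simp add: field_simps power2_eq_square)
    ultimately show "(G has_vector_derivative (t powr p - H * t\<^sup>2) * cos (c * t) - (p * (p - 1) / c\<^sup>2) * (t powr (p - 2) * (1 - cos (c * t)))) (at t)"
      unfolding has_real_derivative_iff_has_vector_derivative[symmetric] by simp
  qed simp
  have "G 0 = 0" by (simp add: G_def)
  \<comment> \<open>The two occurrences of cos c, that is of (-1)^k, cancel: this is the effect of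
    subtracting exactly H t^2.\<close>
  moreover have "G 1 = - (p / c\<^sup>2)"
    using sin_c by (simp add: G_def power2_eq_square diff_divide_distrib[symmetric] add_divide_distrib[symmetric])
  ultimately have G01: "G 1 - G 0 = - (p / c\<^sup>2)" by simp
  have "((\<lambda>t. ((t powr p - H * t\<^sup>2) * cos (c * t) - (p * (p - 1) / c\<^sup>2) * (t powr (p - 2) * (1 - cos (c * t))))
      + (p * (p - 1) / c\<^sup>2) * (t powr (p - 2) * (1 - cos (c * t)))) has_integral
      (- (p / c\<^sup>2) + (p * (p - 1) / c\<^sup>2) * (c powr (1 - p) * L))) {0..1}"
    by (rule has_integral_add[OF main[unfolded G01] has_integral_mult_right[OF L1]])
  then have "integral {0..1} (\<lambda>t. (t powr p - H * t\<^sup>2) * cos (c * t)) = - (p / c\<^sup>2) + (p * (p - 1) / c\<^sup>2) * (c powr (1 - p) * L)"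
    by (intro integral_unique) simp
  also have "\<dots> = - fbm_fourier k H / 2"
  proof -
    have e1: "c powr (- p - 1) * c powr (p - 1) = 1 / c\<^sup>2"
      using c powr_add[of c "- p - 1" "p - 1"] by (simp add: powr_minus_divide)
    have e2: "c powr (- p - 1) = c powr (1 - p) / c\<^sup>2"
    proof -
      have "- p - 1 = (1 - p) - 2" by simp
      then show ?thesis using c by (simp only: powr_diff) simp
    qed
    have "fbm_fourier k H = 2 * p * (c powr (- p - 1) * c powr (p - 1)) + 2 * p * (1 - p) * (c powr (- p - 1) * L)"
      unfolding fbm_fourier_def fbm_kernel_def c_def[symmetric] L_def p_def by (simp add: algebra_simps)
    then have "fbm_fourier k H = 2 * (p * (1 / c\<^sup>2)) + 2 * (p * (1 - p) * (c powr (1 - p) / c\<^sup>2 * L))"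
      unfolding e1 unfolding e2 by (simp only: mult.assoc)
    then have F: "- fbm_fourier k H / 2 = - (p * (1 / c\<^sup>2)) - p * (1 - p) * (c powr (1 - p) / c\<^sup>2 * L)"
      by linarith
    show ?thesis unfolding F by (simp add: right_diff_distrib left_diff_distrib diff_divide_distrib mult_ac)
  qed
  finally show ?thesis by (simp add: p_def c_def)
qed

text \<open>Summability gives a continuous cosine series by the Weierstrass test. The function minus
  its mean plus this series has only vanishing cosine coefficients, hence is zero; evenness covers
  negative \<open>t\<close>.\<close>

lemma fbm_fourier_expansion:
  assumes H: "0 < H" "H < 1" and pos: "\<And>k. 0 \<le> fbm_fourier (Suc k) H"
    and summ: "summable (\<lambda>k. fbm_fourier (Suc k) H)" and t: "\<bar>t\<bar> \<le> 1"
  shows "(\<lambda>k. fbm_fourier (Suc k) H * (1 - cos (pi * real (Suc k) * t))) sums (\<bar>t\<bar> powr (2 * H) - H * t\<^sup>2)"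
proof -
  define f where "f = (\<lambda>t :: real. t powr (2 * H) - H * t\<^sup>2)"
  define A where "A = integral {0..1} f"
  define S where "S = (\<lambda>n t. \<Sum>k<n. fbm_fourier (Suc k) H * cos (pi * real (Suc k) * t))"
  define T where "T = (\<lambda>t. \<Sum>k. fbm_fourier (Suc k) H * cos (pi * real (Suc k) * t))"
  have f_cont: "continuous_on {0..1} f"
    unfolding f_def using H by (intro continuous_intros continuous_on_powr') auto
  have bound: "norm (fbm_fourier (Suc k) H * cos (pi * real (Suc k) * t)) \<le> fbm_fourier (Suc k) H" for k t
    using pos[of k] by (auto simp: abs_mult intro!: mult_left_le)
  have unif: "uniform_limit {0..1} S T sequentially"
    unfolding S_def T_def by (rule Weierstrass_m_test[OF bound summ])
  have S_cont: "continuous_on {0..1} (S n)" for n unfolding S_def by (intro continuous_intros)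
  have T_cont: "continuous_on {0..1} T"
    by (rule uniform_limit_theorem[OF _ unif]) (auto simp: S_cont)
  define h where "h = (\<lambda>t. f t - A + T t)"
  have h_cont: "continuous_on {0..1} h" unfolding h_def by (intro continuous_intros f_cont T_cont)
  have h0: "h t = 0" if "t \<in> {0..1}" for t
  proof (rule cosine_coefficients_zero_imp_zero[OF h_cont _ that])
    fix j :: nat
    let ?c = "\<lambda>t. cos (pi * real j * t)"
    have unif': "uniform_limit {0..1} (\<lambda>n t. (f t - A + S n t) * ?c t) (\<lambda>t. h t * ?c t) sequentially"
    proof (rule uniform_lim_mult)
      show "uniform_limit {0..1} (\<lambda>n t. f t - A + S n t) h sequentially"
        unfolding h_def by (intro uniform_limit_intros unif)
      show "bounded (h ` {0..1})"
        by (intro compact_imp_bounded compact_continuous_image h_cont) simp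
      show "bounded (?c ` {0..1})"
        by (intro compact_imp_bounded compact_continuous_image continuous_intros) simp
    qed (intro uniform_limit_intros)
    have cont': "continuous_on {0..1} (\<lambda>t. (f t - A + S n t) * ?c t)" for n
      by (intro continuous_intros f_cont S_cont)
    obtain I J where IJ: "\<And>n. ((\<lambda>t. (f t - A + S n t) * ?c t) has_integral I n) {0..1}"
      "((\<lambda>t. h t * ?c t) has_integral J) {0..1}" "I \<longlonglongrightarrow> J"
      by (rule uniform_limit_integral[OF unif' cont' trivial_limit_sequentially]) (rule that)
    \<comment> \<open>As soon as the partial sum contains frequency j, its contribution cancels that
      of the function exactly, so the limit is that of an eventually zero sequence.\<close>
    have "I n = 0" if n: "j \<le> n" for n
    proof -
      have fc: "(\<lambda>t. f t * ?c t) integrable_on {0..1}"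
        by (intro integrable_continuous_real continuous_intros f_cont)
      have cc: "?c integrable_on {0..1}"
        by (intro integrable_continuous_real continuous_intros)
      have "(\<lambda>t. (f t - A + S n t) * ?c t) = (\<lambda>t. f t * ?c t - A * ?c t
          + (\<Sum>k<n. fbm_fourier (Suc k) H * (cos (pi * real (Suc k) * t) * ?c t)))"
        by (simp add: S_def fun_eq_iff algebra_simps sum_distrib_left)
      then have "I n = integral {0..1} (\<lambda>t. f t * ?c t - A * ?c t
          + (\<Sum>k<n. fbm_fourier (Suc k) H * (cos (pi * real (Suc k) * t) * ?c t)))"
        using integral_unique[OF IJ(1)[of n]] by simp
      also have "\<dots> = integral {0..1} (\<lambda>t. f t * ?c t) - A * integral {0..1} ?c
          + (\<Sum>k<n. fbm_fourier (Suc k) H * integral {0..1} (\<lambda>t. cos (pi * real (Suc k) * t) * ?c t))"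
        using fc cc
        by (subst integral_add, (auto intro!: integrable_diff integrable_sum integrable_on_mult_right integrable_continuous_real continuous_intros f_cont)[2],
            subst integral_diff, (auto intro!: integrable_on_mult_right)[2],
            subst integral_sum, (auto intro!: integrable_on_mult_right integrable_continuous_real continuous_intros)[2], simp)
      also have "(\<Sum>k<n. fbm_fourier (Suc k) H * integral {0..1} (\<lambda>t. cos (pi * real (Suc k) * t) * ?c t))
          = (\<Sum>k<n. if k = j - 1 \<and> 1 \<le> j then fbm_fourier j H / 2 else 0)"
        by (intro sum.cong refl, subst integral_cos_cos_pi) auto
      also have "\<dots> = (if 1 \<le> j then fbm_fourier j H / 2 else 0)"
        using n by (cases "1 \<le> j") (auto simp: sum.delta)
      also have "integral {0..1} (\<lambda>t. f t * ?c t) = (if 1 \<le> j then - fbm_fourier j H / 2 else A)"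
        using fbm_cosine_coefficient[OF H, of j] by (auto simp: f_def A_def not_less_eq_eq)
      finally show "I n = 0" unfolding integral_cos_pi by auto
    qed
    then have "eventually (\<lambda>n. I n = 0) sequentially" by (auto simp: eventually_sequentially)
    then have "I \<longlonglongrightarrow> 0" by (rule tendsto_eventually)
    with IJ(3) have "J = 0" by (rule LIMSEQ_unique)
    with IJ(2) show "integral {0..1} (\<lambda>t. h t * ?c t) = 0" by (simp add: integral_unique)
  qed
  have T_sums: "(\<lambda>k. fbm_fourier (Suc k) H * cos (pi * real (Suc k) * t)) sums T t" for t
    unfolding T_def by (intro summable_sums summable_comparison_test[OF _ summ]) (use bound in auto)
  \<comment> \<open>The function vanishes at 0, which identifies its mean with the sum of the
    series; this turns the cosines into 1 - cos.\<close>
  have T0: "T 0 = A" using h0[of 0] by (simp add: h_def f_def)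
  have sums: "(\<lambda>k. fbm_fourier (Suc k) H * (1 - cos (pi * real (Suc k) * t))) sums (T 0 - T t)" for t
    using sums_diff[OF T_sums[of 0] T_sums[of t]] by (simp add: right_diff_distrib)
  have "T \<bar>t\<bar> = A - f \<bar>t\<bar>" using h0[of "\<bar>t\<bar>"] t by (simp add: h_def)
  then have "T 0 - T \<bar>t\<bar> = f \<bar>t\<bar>" using T0 by simp
  moreover have "cos (pi * real (Suc k) * \<bar>t\<bar>) = cos (pi * real (Suc k) * t)" for k
    by (cases "0 \<le> t") auto
  ultimately show ?thesis using sums[of "\<bar>t\<bar>"] by (simp add: f_def)
qed

text \<open>Logarithms appear because the Hellinger bound sees relative errors of amplitudes. The
  power of k alone contributes -2 (H - H') ln k; once this is compensated, the rest is Lipschitz in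
  H uniformly in k.\<close>

lemma fbm_fourier_bounds:
  fixes a b :: real
  assumes ab: "0 < a" "a \<le> b" "b < 1" and half: "b < 1 / 2 \<or> 1 / 2 < a"
  obtains C L where "0 < C" "0 \<le> L"
    "\<And>k H. 1 \<le> k \<Longrightarrow> a \<le> H \<Longrightarrow> H \<le> b \<Longrightarrow> 0 < fbm_fourier k H"
    "\<And>k H. 1 \<le> k \<Longrightarrow> a \<le> H \<Longrightarrow> H \<le> b \<Longrightarrow> fbm_fourier k H \<le> C * real k powr (- 2 * H - 1)"
    "\<And>k H H'. 1 \<le> k \<Longrightarrow> a \<le> H \<Longrightarrow> H \<le> b \<Longrightarrow> a \<le> H' \<Longrightarrow> H' \<le> b \<Longrightarrow>
        \<bar>ln (fbm_fourier k H) - ln (fbm_fourier k H') + 2 * (H - H') * ln (real k)\<bar> \<le> L * \<bar>H - H'\<bar>"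
proof -
  obtain c C L where c: "0 < c" "0 \<le> L"
    "\<And>k H. 1 \<le> k \<Longrightarrow> a \<le> H \<Longrightarrow> H \<le> b \<Longrightarrow> c \<le> fbm_kernel H (pi * real k) \<and> fbm_kernel H (pi * real k) \<le> C"
    "\<And>k H H'. 1 \<le> k \<Longrightarrow> a \<le> H \<Longrightarrow> H \<le> b \<Longrightarrow> a \<le> H' \<Longrightarrow> H' \<le> b \<Longrightarrow>
        \<bar>fbm_kernel H (pi * real k) - fbm_kernel H' (pi * real k)\<bar> \<le> L * \<bar>H - H'\<bar>"
    by (rule fbm_kernel_bounds[OF ab half]) (rule that)
  have C: "0 < C" using c(1) c(3)[of 1 a] ab by auto
  have ln_Lip: "\<bar>ln x - ln y\<bar> \<le> \<bar>x - y\<bar> / d" if "d \<le> x" "d \<le> y" "0 < d" for x y d :: real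
  proof -
    have *: "ln x - ln y \<le> \<bar>x - y\<bar> / d" if "d \<le> x" "d \<le> y" for x y
    proof -
      have xy: "0 < x" "0 < y" using that \<open>0 < d\<close> by auto
      have "ln x - ln y = ln (x / y)" using xy by (simp add: ln_div)
      also have "\<dots> \<le> x / y - 1" using xy by (intro ln_le_minus_one) simp
      also have "\<dots> = (x - y) / y" using xy by (simp add: diff_divide_distrib)
      also have "\<dots> \<le> \<bar>x - y\<bar> / y" using xy by (intro divide_right_mono) auto
      also have "\<dots> \<le> \<bar>x - y\<bar> / d" using that \<open>0 < d\<close> by (intro divide_left_mono) auto
      finally show ?thesis .
    qed
    show ?thesis using *[OF that(1,2)] *[OF that(2,1)] by (simp add: abs_minus_commute abs_le_iff)
  qed
  show ?thesis
  \<comment> \<open>The term 1/a stems from ln H, 2 ln pi from the power of pi, and L/c from the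
    kernel with its lower bound c. The 4 bounds the prefactor 4 H.\<close>
  proof (rule that[of "4 * C" "1 / a + 2 * ln pi + L / c"])
    show "0 < 4 * C" using C by simp
    show "0 \<le> 1 / a + 2 * ln pi + L / c" using ab c pi_ge_two by (auto intro!: add_nonneg_nonneg)
    fix k :: nat and H assume k: "1 \<le> k" and H: "a \<le> H" "H \<le> b"
    have h: "0 < fbm_kernel H (pi * real k)" using c(1) c(3)[OF k H] by linarith
    then show "0 < fbm_fourier k H" unfolding fbm_fourier_def using H ab k by simp
    have "fbm_fourier k H \<le> (4 * 1) * (1 * real k powr (- 2 * H - 1)) * C"
      unfolding fbm_fourier_def
    proof (intro mult_mono)
      have "pi powr (- 2 * H - 1) \<le> 1 powr (- 2 * H - 1)" using H ab pi_ge_two by (intro powr_mono2') auto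
      then show "(pi * real k) powr (- 2 * H - 1) \<le> 1 * real k powr (- 2 * H - 1)"
        by (simp add: powr_mult mult_left_le_one_le)
    qed (use H ab c(3)[OF k H] h in auto)
    then show "fbm_fourier k H \<le> 4 * C * real k powr (- 2 * H - 1)" by (simp add: mult_ac)
  next
    fix k :: nat and H H' assume k: "1 \<le> k" and H: "a \<le> H" "H \<le> b" and H': "a \<le> H'" "H' \<le> b"
    have ln_eq: "ln (fbm_fourier k H) = ln 4 + ln H - (2 * H + 1) * (ln pi + ln (real k)) + ln (fbm_kernel H (pi * real k))"
      if H: "a \<le> H" "H \<le> b" for H
    proof -
      have h: "0 < fbm_kernel H (pi * real k)" using c(1) c(3)[OF k H] by linarith
      then show ?thesis
        unfolding fbm_fourier_def using H ab k by (simp add: ln_mult ln_powr algebra_simps)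
    qed
    have 1: "\<bar>ln H - ln H'\<bar> \<le> \<bar>H - H'\<bar> / a" using H H' ab by (intro ln_Lip) auto
    have 2: "\<bar>ln (fbm_kernel H (pi * real k)) - ln (fbm_kernel H' (pi * real k))\<bar> \<le> L * \<bar>H - H'\<bar> / c"
    proof -
      have "\<bar>ln (fbm_kernel H (pi * real k)) - ln (fbm_kernel H' (pi * real k))\<bar>
          \<le> \<bar>fbm_kernel H (pi * real k) - fbm_kernel H' (pi * real k)\<bar> / c"
        using c(1) c(3)[OF k H] c(3)[OF k H'] by (intro ln_Lip) auto
      also have "\<dots> \<le> L * \<bar>H - H'\<bar> / c" using c(1) c(4)[OF k H H'] by (intro divide_right_mono) auto
      finally show ?thesis .
    qed
    have "ln (fbm_fourier k H) - ln (fbm_fourier k H') + 2 * (H - H') * ln (real k)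
        = (ln H - ln H') - 2 * ((H - H') * ln pi) + (ln (fbm_kernel H (pi * real k)) - ln (fbm_kernel H' (pi * real k)))"
      unfolding ln_eq[OF H] ln_eq[OF H'] by (simp add: algebra_simps)
    moreover have "\<bar>(H - H') * ln pi\<bar> = \<bar>H - H'\<bar> * ln pi" using pi_ge_two by (simp add: abs_mult)
    ultimately have "\<bar>ln (fbm_fourier k H) - ln (fbm_fourier k H') + 2 * (H - H') * ln (real k)\<bar>
        \<le> \<bar>H - H'\<bar> / a + 2 * (\<bar>H - H'\<bar> * ln pi) + L * \<bar>H - H'\<bar> / c"
      using 1 2 by linarith
    then show "\<bar>ln (fbm_fourier k H) - ln (fbm_fourier k H') + 2 * (H - H') * ln (real k)\<bar>
        \<le> (1 / a + 2 * ln pi + L / c) * \<bar>H - H'\<bar>"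
      by (simp add: algebra_simps)
  qed
qed

section \<open>Conditionally Gaussian data\<close>

definition block :: "nat \<Rightarrow> nat \<Rightarrow> nat set" where
  "block g j = {j * g..<j * g + g}"

text \<open>Riemann sum on a grid of \<open>n * g\<close> points for the integrated variance over
  the observation interval number j, where \<open>x\<close> is the log variance on the grid. Given
  the path, it is the variance of the discretized increment.\<close>

definition block_var :: "nat \<Rightarrow> nat \<Rightarrow> (nat \<Rightarrow> real) \<Rightarrow> nat \<Rightarrow> real" where
  "block_var n g x j = (\<Sum>k\<in>block g j. exp (x k)) / real (n * g)"

text \<open>Conditional mean of the test \<open>F\<close> given the log variance path
  \<open>x\<close>.\<close>

definition mix_mean :: "nat \<Rightarrow> nat \<Rightarrow> ((nat \<Rightarrow> real) \<Rightarrow> real) \<Rightarrow> (nat \<Rightarrow> real) \<Rightarrow> real" where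
  "mix_mean n g F x = (\<integral>z. F (\<lambda>j\<in>{..<n}. sqrt (block_var n g x j) * z j) \<partial>gauss {..<n})"

definition lin_path :: "nat set \<Rightarrow> (nat \<Rightarrow> nat \<Rightarrow> real) \<Rightarrow> nat \<Rightarrow> (nat \<Rightarrow> real) \<Rightarrow> nat \<Rightarrow> real" where
  "lin_path I e G \<zeta> = (\<lambda>k\<in>{..<G}. \<Sum>i\<in>I. \<zeta> i * e i k)"

lemma finite_block [simp]: "finite (block g j)" and card_block [simp]: "card (block g j) = g"
  by (auto simp: block_def)

lemma block_subset: "j < n \<Longrightarrow> k \<in> block g j \<Longrightarrow> k < n * g"
proof -
  assume "j < n" "k \<in> block g j"
  then have "k < (j + 1) * g" "j + 1 \<le> n" by (auto simp: block_def algebra_simps)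
  then show "k < n * g" by (meson less_le_trans mult_le_mono1)
qed

lemma sum_blocks: "(\<Sum>j<n. \<Sum>k\<in>block g j. f k) = (\<Sum>k<n * g. f k)"
  unfolding block_def by (rule sum.nat_group)

lemma block_var_pos: "0 < n \<Longrightarrow> 0 < g \<Longrightarrow> 0 < block_var n g x j"
  unfolding block_var_def by (intro divide_pos_pos sum_pos) (auto simp: block_def)

text \<open>Rewrites the Hellinger cost of two standard deviations in terms of variances, which
  unlike their roots are linear in the exponentials of the path.\<close>

lemma sqrt_diff_square_le:
  assumes "0 < v" "0 < w"
  shows "(sqrt v - sqrt w)\<^sup>2 / ((sqrt v)\<^sup>2 + (sqrt w)\<^sup>2) \<le> ((v - w) / (v + w))\<^sup>2"
proof -
  have s: "0 < sqrt v" "0 < sqrt w" using assms by auto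
  have "(v - w)\<^sup>2 = (sqrt v - sqrt w)\<^sup>2 * (sqrt v + sqrt w)\<^sup>2"
  proof -
    have "v - w = (sqrt v - sqrt w) * (sqrt v + sqrt w)"
      using assms by (simp add: algebra_simps)
    then show ?thesis by (metis power_mult_distrib)
  qed
  moreover have "v + w \<le> (sqrt v + sqrt w)\<^sup>2"
    using assms s by (simp add: power2_sum)
  ultimately have "(sqrt v - sqrt w)\<^sup>2 * (v + w) \<le> (v - w)\<^sup>2"
    by (simp add: mult_left_mono)
  then have "(sqrt v - sqrt w)\<^sup>2 \<le> (v - w)\<^sup>2 / (v + w)"
    using assms by (simp add: pos_le_divide_eq)
  then have "(sqrt v - sqrt w)\<^sup>2 / (v + w) \<le> (v - w)\<^sup>2 / (v + w) / (v + w)"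
    using assms by (intro divide_right_mono) auto
  then show ?thesis using assms by (simp add: power_divide power2_eq_square)
qed

text \<open>Jensen for the square: the weighted variance of \<open>d\<close> is nonnegative.\<close>

lemma weighted_square_le:
  fixes w d :: "'i \<Rightarrow> real"
  assumes "\<And>k. k \<in> A \<Longrightarrow> 0 \<le> w k" "(\<Sum>k\<in>A. w k) = 1"
  shows "(\<Sum>k\<in>A. w k * d k)\<^sup>2 \<le> (\<Sum>k\<in>A. w k * (d k)\<^sup>2)"
proof -
  define m where "m = (\<Sum>k\<in>A. w k * d k)"
  have "0 \<le> (\<Sum>k\<in>A. w k * (d k - m)\<^sup>2)" using assms(1) by (intro sum_nonneg) auto
  also have "\<dots> = (\<Sum>k\<in>A. w k * (d k)\<^sup>2 - 2 * m * (w k * d k) + m\<^sup>2 * w k)"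
    by (intro sum.cong refl) (simp add: power2_diff algebra_simps)
  also have "\<dots> = (\<Sum>k\<in>A. w k * (d k)\<^sup>2) - 2 * m * m + m\<^sup>2"
    by (simp add: sum.distrib sum_subtractf sum_distrib_left[symmetric] m_def[symmetric] assms(2))
  finally show ?thesis unfolding m_def[symmetric] by (simp add: power2_eq_square)
qed

text \<open>Harmonic against arithmetic mean, from the nonnegative sum of (1 - t a k)^2 / a k with t
  = card B / (sum of a).\<close>

lemma inverse_sum_le:
  fixes a :: "'i \<Rightarrow> real"
  assumes B: "finite B" "B \<noteq> {}" and a: "\<And>k. k \<in> B \<Longrightarrow> 0 < a k"
  shows "1 / (\<Sum>k\<in>B. a k) \<le> (\<Sum>k\<in>B. 1 / a k) / (real (card B))\<^sup>2"
proof -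
  define A g where "A = (\<Sum>k\<in>B. a k)" and "g = real (card B)"
  have A: "0 < A" and g: "0 < g" unfolding A_def g_def using B a by (auto intro!: sum_pos simp: card_gt_0_iff)
  have "0 \<le> (\<Sum>k\<in>B. (1 - g / A * a k)\<^sup>2 / a k)" using a by (intro sum_nonneg) (simp add: less_imp_le)
  also have "\<dots> = (\<Sum>k\<in>B. 1 / a k - 2 * (g / A) + (g / A)\<^sup>2 * a k)"
    using a by (intro sum.cong refl) (simp add: power2_eq_square diff_divide_distrib add_divide_distrib algebra_simps less_imp_neq[THEN not_sym])
  also have "\<dots> = (\<Sum>k\<in>B. 1 / a k) - g * (2 * (g / A)) + (g / A)\<^sup>2 * A"
    by (simp add: sum.distrib sum_subtractf sum_distrib_left[symmetric] A_def[symmetric] g_def)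
  also have "\<dots> = (\<Sum>k\<in>B. 1 / a k) - g\<^sup>2 / A"
    using A by (simp add: power2_eq_square)
  finally have "g\<^sup>2 / A \<le> (\<Sum>k\<in>B. 1 / a k)" by simp
  then have "g\<^sup>2 / A / g\<^sup>2 \<le> (\<Sum>k\<in>B. 1 / a k) / g\<^sup>2" by (intro divide_right_mono) auto
  then show ?thesis using g unfolding A_def[symmetric] g_def[symmetric] by simp
qed

text \<open>The relative change of variance is at most a weighted mean of |x k - y k| with weights a
  k / A, and Jensen squares it. The reciprocal of A is then replaced by a mean of reciprocals, so
  that only exponentials of path differences occur. For Gaussian paths these have explicit moments,
  and no lower bound on the volatility enters.\<close>

lemma block_var_ratio_le:
  assumes n: "0 < n" and g: "0 < g"
  shows "((block_var n g x j - block_var n g y j) / (block_var n g x j + block_var n g y j))\<^sup>2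
    \<le> (\<Sum>k\<in>block g j. \<Sum>l\<in>block g j. (exp (x k - x l) + exp (y k - y l)) * (x k - y k)\<^sup>2) / (real g)\<^sup>2"
proof -
  let ?B = "block g j"
  have ne: "?B \<noteq> {}" using g by (auto simp: block_def)
  define a where "a = (\<lambda>k. exp (x k) + exp (y k))"
  have a: "0 < a k" for k unfolding a_def by (simp add: add_pos_pos)
  define A where "A = (\<Sum>k\<in>?B. a k)"
  have A: "0 < A" unfolding A_def using a ne by (intro sum_pos) auto
  have G: "0 < real (n * g)" using n g by simp
  have "block_var n g x j + block_var n g y j = A / real (n * g)"
    by (simp add: block_var_def A_def a_def sum.distrib add_divide_distrib)
  moreover have "\<bar>block_var n g x j - block_var n g y j\<bar> \<le> (\<Sum>k\<in>?B. a k * \<bar>x k - y k\<bar>) / real (n * g)"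
  proof -
    have "\<bar>block_var n g x j - block_var n g y j\<bar> = \<bar>\<Sum>k\<in>?B. exp (x k) - exp (y k)\<bar> / real (n * g)"
      by (simp add: block_var_def diff_divide_distrib[symmetric] sum_subtractf del: of_nat_mult)
    also have "\<dots> \<le> (\<Sum>k\<in>?B. \<bar>exp (x k) - exp (y k)\<bar>) / real (n * g)"
      by (intro divide_right_mono sum_abs) auto
    also have "\<dots> \<le> (\<Sum>k\<in>?B. a k * \<bar>x k - y k\<bar>) / real (n * g)"
    proof (intro divide_right_mono sum_mono)
      fix k
      have "exp (max (x k) (y k)) \<le> a k" by (auto simp: max_def a_def)
      then have "\<bar>x k - y k\<bar> * exp (max (x k) (y k)) \<le> \<bar>x k - y k\<bar> * a k" by (intro mult_left_mono) auto
      with abs_exp_diff_le[of "x k" "y k"] show "\<bar>exp (x k) - exp (y k)\<bar> \<le> a k * \<bar>x k - y k\<bar>"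
        by (simp add: mult.commute)
    qed auto
    finally show ?thesis .
  qed
  ultimately have "\<bar>(block_var n g x j - block_var n g y j) / (block_var n g x j + block_var n g y j)\<bar>
      \<le> ((\<Sum>k\<in>?B. a k * \<bar>x k - y k\<bar>) / real (n * g)) / (A / real (n * g))"
    using A G by (simp only: abs_divide) (intro divide_mono divide_pos_pos, auto intro!: divide_nonneg_nonneg sum_nonneg mult_nonneg_nonneg less_imp_le[OF a])
  also have "\<dots> = (\<Sum>k\<in>?B. a k * \<bar>x k - y k\<bar>) / A"
  proof -
    have "(S / m) / (A / m) = S / A" if "m \<noteq> 0" for S m :: real using that by simp
    from this[OF less_imp_neq[OF G, THEN not_sym]] show ?thesis .
  qed
  also have "\<dots> = (\<Sum>k\<in>?B. a k / A * \<bar>x k - y k\<bar>)"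
    by (simp add: sum_divide_distrib)
  finally have "((block_var n g x j - block_var n g y j) / (block_var n g x j + block_var n g y j))\<^sup>2
      \<le> (\<Sum>k\<in>?B. a k / A * \<bar>x k - y k\<bar>)\<^sup>2"
    by (metis abs_ge_zero power2_abs power_mono)
  also have "\<dots> \<le> (\<Sum>k\<in>?B. a k / A * \<bar>x k - y k\<bar>\<^sup>2)"
    using a A by (intro weighted_square_le) (auto simp: less_imp_le sum_divide_distrib[symmetric] A_def[symmetric])
  also have "\<dots> \<le> (\<Sum>k\<in>?B. \<Sum>l\<in>?B. (exp (x k - x l) + exp (y k - y l)) * (x k - y k)\<^sup>2 / (real g)\<^sup>2)"
  proof (rule sum_mono)
    fix k
    have "a k / A = a k * (1 / A)" by simp
    also have "\<dots> \<le> a k * ((\<Sum>l\<in>?B. 1 / a l) / (real g)\<^sup>2)"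
      using inverse_sum_le[of ?B a] ne a by (intro mult_left_mono) (auto simp: A_def less_imp_le)
    also have "\<dots> = (\<Sum>l\<in>?B. a k / a l / (real g)\<^sup>2)"
      by (simp add: sum_distrib_left sum_divide_distrib)
    also have "\<dots> \<le> (\<Sum>l\<in>?B. (exp (x k - x l) + exp (y k - y l)) / (real g)\<^sup>2)"
    proof (intro sum_mono divide_right_mono)
      fix l
      have "exp (x k) / a l \<le> exp (x k) / exp (x l)" "exp (y k) / a l \<le> exp (y k) / exp (y l)"
        using a[of l] by (auto intro!: divide_left_mono mult_pos_pos simp: a_def)
      then show "a k / a l \<le> exp (x k - x l) + exp (y k - y l)"
      proof -
        assume "exp (x k) / a l \<le> exp (x k) / exp (x l)" "exp (y k) / a l \<le> exp (y k) / exp (y l)"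
        moreover have "a k / a l = exp (x k) / a l + exp (y k) / a l" by (simp add: a_def add_divide_distrib)
        ultimately show ?thesis by (simp add: exp_diff)
      qed
    qed simp
    finally have "a k / A \<le> (\<Sum>l\<in>?B. (exp (x k - x l) + exp (y k - y l)) / (real g)\<^sup>2)" .
    from mult_right_mono[OF this, of "(x k - y k)\<^sup>2"]
    have "a k / A * \<bar>x k - y k\<bar>\<^sup>2 \<le> (\<Sum>l\<in>?B. (exp (x k - x l) + exp (y k - y l)) / (real g)\<^sup>2) * (x k - y k)\<^sup>2"
      by simp
    then show "a k / A * \<bar>x k - y k\<bar>\<^sup>2 \<le> (\<Sum>l\<in>?B. (exp (x k - x l) + exp (y k - y l)) * (x k - y k)\<^sup>2 / (real g)\<^sup>2)"
      by (simp add: sum_distrib_right)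
  qed
  finally show ?thesis by (simp add: sum_divide_distrib)
qed

text \<open>Trades a square for exponentials, so that all expectations reduce to Gaussian
  exponential moments. With \<open>V\<close> an upper bound for the variance of \<open>d\<close> the
  exponents are of order one.\<close>

lemma square_le_exp:
  fixes d V :: real
  assumes V: "0 < V"
  shows "d\<^sup>2 \<le> V * (exp (d / sqrt V) + exp (- d / sqrt V))"
proof -
  define t where "t = d / sqrt V"
  have "\<bar>t\<bar> \<le> 1 + \<bar>t\<bar> / 2 + (\<bar>t\<bar> / 2)\<^sup>2 / 2"
    using zero_le_power2[of "\<bar>t\<bar> / 2 - 1"] by (simp add: power2_diff)
  also have "\<dots> \<le> exp (\<bar>t\<bar> / 2)" by (rule exp_lower_Taylor_quadratic) simp
  finally have "\<bar>t\<bar>\<^sup>2 \<le> (exp (\<bar>t\<bar> / 2))\<^sup>2" by (intro power_mono) auto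
  also have "\<dots> = exp \<bar>t\<bar>" by (simp add: power2_eq_square exp_add[symmetric])
  also have "\<dots> \<le> exp t + exp (- t)" by (simp add: abs_if)
  finally have "t\<^sup>2 \<le> exp t + exp (- t)" by simp
  moreover have "d\<^sup>2 = V * t\<^sup>2" using V by (simp add: t_def power_divide)
  ultimately show ?thesis using V by (simp add: t_def)
qed

lemma measurable_block_var [measurable]:
  assumes "j < n"
  shows "(\<lambda>x. block_var n g x j) \<in> borel_measurable (PiM {..<n * g} (\<lambda>_. borel))"
proof -
  have "(\<lambda>x. exp (x k)) \<in> borel_measurable (PiM {..<n * g} (\<lambda>_. borel :: real measure))" if "k \<in> block g j" for k
  proof -
    have [measurable]: "(\<lambda>x. x k) \<in> borel_measurable (PiM {..<n * g} (\<lambda>_. borel :: real measure))"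
      using block_subset[OF assms that] by (intro measurable_component_singleton) simp
    show ?thesis by measurable
  qed
  then show ?thesis
    unfolding block_var_def by (intro borel_measurable_divide borel_measurable_const borel_measurable_sum)
qed

lemma measurable_block_scale [measurable]:
  "(\<lambda>(x, z). \<lambda>j\<in>{..<n}. sqrt (block_var n g x j) * z j)
    \<in> measurable (PiM {..<n * g} (\<lambda>_. borel) \<Otimes>\<^sub>M PiM {..<n} (\<lambda>_. borel)) (PiM {..<n} (\<lambda>_. borel))"
  unfolding split_beta' by (rule measurable_restrict) measurable

lemma measurable_mix_mean [measurable]:
  assumes [measurable]: "F \<in> borel_measurable (PiM {..<n} (\<lambda>_. borel))"
  shows "mix_mean n g F \<in> borel_measurable (PiM {..<n * g} (\<lambda>_. borel))"
proof -
  interpret prob_space "gauss {..<n}" by (rule prob_space_gauss)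
  have "(\<lambda>(x, z). F (\<lambda>j\<in>{..<n}. sqrt (block_var n g x j) * z j))
      \<in> borel_measurable (PiM {..<n * g} (\<lambda>_. borel) \<Otimes>\<^sub>M gauss {..<n})"
    using measurable_compose[OF measurable_block_scale assms, of g] by (simp add: split_beta' cong: measurable_cong_sets)
  then show ?thesis
    unfolding mix_mean_def[abs_def] by (rule borel_measurable_lebesgue_integral)
qed

lemma measurable_lin_path [measurable]:
  "lin_path I e G \<in> measurable (PiM I (\<lambda>_. borel)) (PiM {..<G} (\<lambda>_. borel))"
  unfolding lin_path_def by measurable

lemma mix_mean_bounds:
  assumes F: "F \<in> borel_measurable (PiM {..<n} (\<lambda>_. borel))" and F01: "\<And>x. 0 \<le> F x \<and> F x \<le> 1"
  shows "0 \<le> mix_mean n g F x \<and> mix_mean n g F x \<le> 1"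
proof -
  interpret prob_space "gauss {..<n}" by (rule prob_space_gauss)
  have "(\<lambda>z. \<lambda>j\<in>{..<n}. sqrt (block_var n g x j) * z j) \<in> measurable (gauss {..<n}) (PiM {..<n} (\<lambda>_. borel))"
    by measurable
  from measurable_compose[OF this F]
  have m: "(\<lambda>z. F (\<lambda>j\<in>{..<n}. sqrt (block_var n g x j) * z j)) \<in> borel_measurable (gauss {..<n})" .
  have "integrable (gauss {..<n}) (\<lambda>z. F (\<lambda>j\<in>{..<n}. sqrt (block_var n g x j) * z j))"
    using F01 m by (intro integrable_const_bound[where B=1]) auto
  then show ?thesis
    unfolding mix_mean_def using F01 by (intro conjI integral_ge_const integral_le_const) auto
qed

lemma mix_mean_diff_le:
  assumes n: "0 < n" and g: "0 < g" and c: "0 < c"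
    and F: "F \<in> borel_measurable (PiM {..<n} (\<lambda>_. borel))" and F01: "\<And>x. 0 \<le> F x \<and> F x \<le> 1"
  shows "\<bar>mix_mean n g F x - mix_mean n g F y\<bar> \<le> 2 * c + (\<Sum>j<n. (\<Sum>k\<in>block g j. \<Sum>l\<in>block g j.
      (exp (x k - x l) + exp (y k - y l)) * (x k - y k)\<^sup>2) / (real g)\<^sup>2) / c"
proof -
  have "\<bar>mix_mean n g F x - mix_mean n g F y\<bar> \<le> 2 * c + (\<Sum>j<n. (sqrt (block_var n g x j) - sqrt (block_var n g y j))\<^sup>2
      / ((sqrt (block_var n g x j))\<^sup>2 + (sqrt (block_var n g y j))\<^sup>2)) / c"
    unfolding mix_mean_def using F F01 c block_var_pos[OF n g] by (intro gauss_scale_test_bound) auto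
  also have "\<dots> \<le> 2 * c + (\<Sum>j<n. (\<Sum>k\<in>block g j. \<Sum>l\<in>block g j.
      (exp (x k - x l) + exp (y k - y l)) * (x k - y k)\<^sup>2) / (real g)\<^sup>2) / c"
    using c by (intro add_left_mono divide_right_mono sum_mono
        order_trans[OF sqrt_diff_square_le[OF block_var_pos[OF n g] block_var_pos[OF n g]] block_var_ratio_le[OF n g]]) auto
  finally show ?thesis .
qed

text \<open>The exponents that arise are \<alpha> + s \<delta> with s = 1/sqrt V or its negative;
  their squared norm is at most 2 R + 2, which explains exp(R + 1). An integrable majorant is
  produced so that later estimates are pointwise comparisons.\<close>

lemma gauss_exp_square_bound:
  assumes I: "finite I" and V: "0 < V" "(\<Sum>i\<in>I. (\<delta> i)\<^sup>2) \<le> V" and R: "(\<Sum>i\<in>I. (\<alpha> i)\<^sup>2) \<le> R"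
  obtains h where "integrable (gauss I) h" "(\<integral>\<xi>. h \<xi> \<partial>gauss I) \<le> 2 * V * exp (R + 1)"
    "\<And>\<xi>. exp (\<Sum>i\<in>I. \<alpha> i * \<xi> i) * (\<Sum>i\<in>I. \<delta> i * \<xi> i)\<^sup>2 \<le> h \<xi>"
proof -
  define E where "E = (\<lambda>s \<xi>. exp (\<Sum>i\<in>I. (\<alpha> i + s * \<delta> i) * \<xi> i))"
  have E_le: "(\<integral>\<xi>. E s \<xi> \<partial>gauss I) \<le> exp (R + 1)" if s: "s\<^sup>2 * V = 1" for s
  proof -
    have "(\<Sum>i\<in>I. (\<alpha> i + s * \<delta> i)\<^sup>2) \<le> (\<Sum>i\<in>I. 2 * (\<alpha> i)\<^sup>2 + 2 * s\<^sup>2 * (\<delta> i)\<^sup>2)"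
    proof (rule sum_mono)
      fix i
      have "0 \<le> (\<alpha> i - s * \<delta> i)\<^sup>2" by simp
      then show "(\<alpha> i + s * \<delta> i)\<^sup>2 \<le> 2 * (\<alpha> i)\<^sup>2 + 2 * s\<^sup>2 * (\<delta> i)\<^sup>2"
        by (simp add: power2_sum power2_diff power_mult_distrib)
    qed
    also have "\<dots> = 2 * (\<Sum>i\<in>I. (\<alpha> i)\<^sup>2) + 2 * (s\<^sup>2 * (\<Sum>i\<in>I. (\<delta> i)\<^sup>2))"
      by (simp add: sum.distrib sum_distrib_left mult_ac)
    also have "\<dots> \<le> 2 * R + 2 * (s\<^sup>2 * V)"
      using V R by (intro add_mono mult_left_mono) auto
    finally have "(\<Sum>i\<in>I. (\<alpha> i + s * \<delta> i)\<^sup>2) / 2 \<le> R + 1" using s by simp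
    then show ?thesis unfolding E_def gauss_exp_moment(2)[OF I] by simp
  qed
  define s where "s = 1 / sqrt V"
  have s: "s\<^sup>2 * V = 1" "(- s)\<^sup>2 * V = 1" using V by (auto simp: s_def power_divide)
  have int: "integrable (gauss I) (E s)" for s
    unfolding E_def by (rule gauss_exp_moment(1)[OF I])
  show ?thesis
  proof (rule that[of "\<lambda>\<xi>. V * (E s \<xi> + E (- s) \<xi>)"])
    show "integrable (gauss I) (\<lambda>\<xi>. V * (E s \<xi> + E (- s) \<xi>))" using int by simp
    have "(\<integral>\<xi>. V * (E s \<xi> + E (- s) \<xi>) \<partial>gauss I) = V * ((\<integral>\<xi>. E s \<xi> \<partial>gauss I) + (\<integral>\<xi>. E (- s) \<xi> \<partial>gauss I))"
      using int by simp
    also have "\<dots> \<le> V * (exp (R + 1) + exp (R + 1))" using V E_le s by (intro mult_left_mono add_mono) auto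
    finally show "(\<integral>\<xi>. V * (E s \<xi> + E (- s) \<xi>) \<partial>gauss I) \<le> 2 * V * exp (R + 1)" by simp
    fix \<xi>
    have E_eq: "E s \<xi> = exp (\<Sum>i\<in>I. \<alpha> i * \<xi> i) * exp (s * (\<Sum>i\<in>I. \<delta> i * \<xi> i))" for s
      unfolding E_def exp_add[symmetric] by (simp add: distrib_right sum.distrib sum_distrib_left mult.assoc)
    have "(\<Sum>i\<in>I. \<delta> i * \<xi> i)\<^sup>2 \<le> V * (exp (s * (\<Sum>i\<in>I. \<delta> i * \<xi> i)) + exp (- s * (\<Sum>i\<in>I. \<delta> i * \<xi> i)))"
      using square_le_exp[OF V(1), of "\<Sum>i\<in>I. \<delta> i * \<xi> i"] by (simp add: s_def)
    then have "exp (\<Sum>i\<in>I. \<alpha> i * \<xi> i) * (\<Sum>i\<in>I. \<delta> i * \<xi> i)\<^sup>2 \<le> exp (\<Sum>i\<in>I. \<alpha> i * \<xi> i)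
        * (V * (exp (s * (\<Sum>i\<in>I. \<delta> i * \<xi> i)) + exp (- s * (\<Sum>i\<in>I. \<delta> i * \<xi> i))))"
      by (intro mult_left_mono) auto
    also have "\<dots> = V * (E s \<xi> + E (- s) \<xi>)" unfolding E_eq by (simp add: algebra_simps)
    finally show "exp (\<Sum>i\<in>I. \<alpha> i * \<xi> i) * (\<Sum>i\<in>I. \<delta> i * \<xi> i)\<^sup>2 \<le> V * (E s \<xi> + E (- s) \<xi>)" .
  qed
qed

section \<open>Comparison of two truncated series\<close>

definition series_mean :: "nat \<Rightarrow> nat \<Rightarrow> nat set \<Rightarrow> (nat \<Rightarrow> nat \<Rightarrow> real) \<Rightarrow> (nat \<Rightarrow> real) \<Rightarrow> ((nat \<Rightarrow> real) \<Rightarrow> real) \<Rightarrow> real" where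
  "series_mean n g I e b F = (\<integral>\<xi>. mix_mean n g F (lin_path I e (n * g) (\<lambda>i\<in>I. b i * \<xi> i)) \<partial>gauss I)"

text \<open>Both paths are driven by the same \<open>\<xi>\<close>, so the conditional bound can be
  integrated. Basis values are at most 2, hence the constant 4 in the variance of the path
  difference; differences of basis values are at most 4, hence the 16 in the exponents.\<close>

lemma series_mean_coupling:
  assumes n: "0 < n" and g: "0 < g" and c: "0 < c" and I: "finite I" and e2: "\<And>i k. \<bar>e i k\<bar> \<le> 2"
    and F: "F \<in> borel_measurable (PiM {..<n} (\<lambda>_. borel))" and F01: "\<And>x. 0 \<le> F x \<and> F x \<le> 1"
    and V: "0 < V" "4 * (\<Sum>i\<in>I. (b i - b' i)\<^sup>2) \<le> V"
    and R: "16 * (\<Sum>i\<in>I. (b i)\<^sup>2) \<le> R" "16 * (\<Sum>i\<in>I. (b' i)\<^sup>2) \<le> R"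
  shows "\<bar>series_mean n g I e b F - series_mean n g I e b' F\<bar> \<le> 2 * c + 4 * real n * V * exp (R + 1) / c"
proof -
  interpret G: prob_space "gauss I" by (rule prob_space_gauss)
  define X where "X = (\<lambda>b \<xi>. lin_path I e (n * g) (\<lambda>i\<in>I. b i * \<xi> i))"
  have X_eq: "X b \<xi> k = (\<Sum>i\<in>I. b i * e i k * \<xi> i)" if "k < n * g" for b \<xi> k
    using that by (simp add: X_def lin_path_def mult_ac cong: sum.cong)
  have [measurable]: "X b \<in> measurable (gauss I) (PiM {..<n * g} (\<lambda>_. borel))" for b
    unfolding X_def by measurable
  note [measurable] = F
  have int: "integrable (gauss I) (\<lambda>\<xi>. mix_mean n g F (X b \<xi>))" for b
  proof (rule G.integrable_const_bound[where B=1])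
    show "AE \<xi> in gauss I. norm (mix_mean n g F (X b \<xi>)) \<le> 1"
      using mix_mean_bounds[OF F F01] by (auto intro!: AE_I2 simp: abs_le_iff)
  qed measurable
  have R0: "\<exists>h. integrable (gauss I) h \<and> (\<integral>\<xi>. h \<xi> \<partial>gauss I) \<le> 2 * V * exp (R + 1) \<and>
      (\<forall>\<xi>. exp (X a \<xi> k - X a \<xi> l) * (X b \<xi> k - X b' \<xi> k)\<^sup>2 \<le> h \<xi>)"
    if k: "k < n * g" "l < n * g" and a: "16 * (\<Sum>i\<in>I. (a i)\<^sup>2) \<le> R" for k l a
  proof -
    have 1: "(\<Sum>i\<in>I. ((b i - b' i) * e i k)\<^sup>2) \<le> V"
    proof -
      have "(\<Sum>i\<in>I. ((b i - b' i) * e i k)\<^sup>2) \<le> (\<Sum>i\<in>I. (b i - b' i)\<^sup>2 * 2\<^sup>2)"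
        unfolding power_mult_distrib
        using power_mono[OF e2 abs_ge_zero, of _ _ 2] by (intro sum_mono mult_left_mono) auto
      then show ?thesis using V(2) by (simp add: sum_distrib_left mult.commute)
    qed
    have 2: "(\<Sum>i\<in>I. (a i * (e i k - e i l))\<^sup>2) \<le> R"
    proof -
      have "\<bar>e i k - e i l\<bar> \<le> 4" for i using e2[of i k] e2[of i l] by linarith
      then have "(\<Sum>i\<in>I. (a i * (e i k - e i l))\<^sup>2) \<le> (\<Sum>i\<in>I. (a i)\<^sup>2 * 4\<^sup>2)"
        unfolding power_mult_distrib using power_mono[OF _ abs_ge_zero, of _ 4 2] by (intro sum_mono mult_left_mono) force+
      then show ?thesis using a by (simp add: sum_distrib_left mult.commute)
    qed
    have d: "X a \<xi> k - X a \<xi> l = (\<Sum>i\<in>I. a i * (e i k - e i l) * \<xi> i)"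
      "X b \<xi> k - X b' \<xi> k = (\<Sum>i\<in>I. (b i - b' i) * e i k * \<xi> i)" for \<xi>
      using k by (simp_all add: X_eq sum_subtractf[symmetric] algebra_simps)
    show ?thesis
      unfolding d by (rule gauss_exp_square_bound[OF I V(1) 1 2]) blast
  qed
  have "\<forall>k\<in>{..<n * g}. \<forall>l\<in>{..<n * g}. \<exists>h. integrable (gauss I) h \<and> (\<integral>\<xi>. h \<xi> \<partial>gauss I) \<le> 2 * V * exp (R + 1) \<and>
      (\<forall>\<xi>. exp (X b \<xi> k - X b \<xi> l) * (X b \<xi> k - X b' \<xi> k)\<^sup>2 \<le> h \<xi>)"
    using R0 R(1) by auto
  then obtain h where h: "\<And>k l. k < n * g \<Longrightarrow> l < n * g \<Longrightarrow> integrable (gauss I) (h k l) \<and> (\<integral>\<xi>. h k l \<xi> \<partial>gauss I) \<le> 2 * V * exp (R + 1) \<and>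
      (\<forall>\<xi>. exp (X b \<xi> k - X b \<xi> l) * (X b \<xi> k - X b' \<xi> k)\<^sup>2 \<le> h k l \<xi>)"
    unfolding bchoice_iff by auto
  have "\<forall>k\<in>{..<n * g}. \<forall>l\<in>{..<n * g}. \<exists>h. integrable (gauss I) h \<and> (\<integral>\<xi>. h \<xi> \<partial>gauss I) \<le> 2 * V * exp (R + 1) \<and>
      (\<forall>\<xi>. exp (X b' \<xi> k - X b' \<xi> l) * (X b \<xi> k - X b' \<xi> k)\<^sup>2 \<le> h \<xi>)"
    using R0 R(2) by auto
  then obtain h' where h': "\<And>k l. k < n * g \<Longrightarrow> l < n * g \<Longrightarrow> integrable (gauss I) (h' k l) \<and> (\<integral>\<xi>. h' k l \<xi> \<partial>gauss I) \<le> 2 * V * exp (R + 1) \<and>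
      (\<forall>\<xi>. exp (X b' \<xi> k - X b' \<xi> l) * (X b \<xi> k - X b' \<xi> k)\<^sup>2 \<le> h' k l \<xi>)"
    unfolding bchoice_iff by auto
  define T where "T = (\<lambda>\<xi>. 2 * c + (\<Sum>j<n. (\<Sum>k\<in>block g j. \<Sum>l\<in>block g j. h k l \<xi> + h' k l \<xi>) / (real g)\<^sup>2) / c)"
  have T_int: "integrable (gauss I) T"
    unfolding T_def using h h' block_subset
    by (intro Bochner_Integration.integrable_add integrable_const integrable_divide Bochner_Integration.integrable_sum) auto
  have T_bound: "\<bar>mix_mean n g F (X b \<xi>) - mix_mean n g F (X b' \<xi>)\<bar> \<le> T \<xi>" for \<xi>
  proof -
    have "(exp (X b \<xi> k - X b \<xi> l) + exp (X b' \<xi> k - X b' \<xi> l)) * (X b \<xi> k - X b' \<xi> k)\<^sup>2 \<le> h k l \<xi> + h' k l \<xi>"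
      if "j < n" "k \<in> block g j" "l \<in> block g j" for j k l
      using h[of k l] h'[of k l] block_subset that by (auto simp: distrib_right intro!: add_mono)
    then show ?thesis
      unfolding T_def using c
      by (intro order_trans[OF mix_mean_diff_le[OF n g c F F01]] add_left_mono divide_right_mono sum_mono) auto
  qed
  have series_eq: "series_mean n g I e b F = (\<integral>\<xi>. mix_mean n g F (X b \<xi>) \<partial>gauss I)" for b
    by (simp add: series_mean_def X_def)
  have "\<bar>series_mean n g I e b F - series_mean n g I e b' F\<bar> = \<bar>\<integral>\<xi>. mix_mean n g F (X b \<xi>) - mix_mean n g F (X b' \<xi>) \<partial>gauss I\<bar>"
    unfolding series_eq using int by simp
  also have "\<dots> \<le> (\<integral>\<xi>. \<bar>mix_mean n g F (X b \<xi>) - mix_mean n g F (X b' \<xi>)\<bar> \<partial>gauss I)" by (rule integral_abs_bound)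
  also have "\<dots> \<le> (\<integral>\<xi>. T \<xi> \<partial>gauss I)" using int T_int T_bound by (intro integral_mono) auto
  also have "\<dots> = 2 * c + (\<Sum>j<n. (\<Sum>k\<in>block g j. \<Sum>l\<in>block g j. (\<integral>\<xi>. h k l \<xi> \<partial>gauss I) + (\<integral>\<xi>. h' k l \<xi> \<partial>gauss I)) / (real g)\<^sup>2) / c"
  proof (rule has_bochner_integral_integral_eq)
    have "has_bochner_integral (gauss I) (\<lambda>_. 2 * c) (2 * c)"
      using G.prob_space by (simp add: has_bochner_integral_iff)
    moreover have "has_bochner_integral (gauss I) (h k l) (\<integral>\<xi>. h k l \<xi> \<partial>gauss I)"
      "has_bochner_integral (gauss I) (h' k l) (\<integral>\<xi>. h' k l \<xi> \<partial>gauss I)"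
      if "j < n" "k \<in> block g j" "l \<in> block g j" for j k l
      using h[of k l] h'[of k l] block_subset that by (auto intro!: has_bochner_integral_integrable)
    ultimately show "has_bochner_integral (gauss I) T (2 * c + (\<Sum>j<n. (\<Sum>k\<in>block g j. \<Sum>l\<in>block g j.
        (\<integral>\<xi>. h k l \<xi> \<partial>gauss I) + (\<integral>\<xi>. h' k l \<xi> \<partial>gauss I)) / (real g)\<^sup>2) / c)"
      unfolding T_def using c g by (intro has_bochner_integral_add has_bochner_integral_divide has_bochner_integral_sum) auto
  qed
  also have "\<dots> \<le> 2 * c + (\<Sum>j<n. (\<Sum>k\<in>block g j. \<Sum>l\<in>block g j. 2 * V * exp (R + 1) + 2 * V * exp (R + 1)) / (real g)\<^sup>2) / c"
    using c h h' block_subset by (intro add_left_mono divide_right_mono sum_mono add_mono) auto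
  \<comment> \<open>Each of the n blocks has g^2 pairs, which the division by g^2 turns into a mean;
    each pair contributes one majorant for either path.\<close>
  also have "\<dots> = 2 * c + 4 * real n * V * exp (R + 1) / c"
    using g by (simp add: power2_eq_square)
  finally show ?thesis .
qed

text \<open>The conditional mean is a function of the vector of scaled coefficients, so the
  Hellinger bound applies to these coefficients directly.\<close>

lemma series_mean_scaling:
  assumes c: "0 < c" and I: "finite I" and b: "\<And>i. i \<in> I \<Longrightarrow> 0 < b i \<and> 0 < b' i"
    and F: "F \<in> borel_measurable (PiM {..<n} (\<lambda>_. borel))" and F01: "\<And>x. 0 \<le> F x \<and> F x \<le> 1"
  shows "\<bar>series_mean n g I e b F - series_mean n g I e b' F\<bar> \<le> 2 * c + (\<Sum>i\<in>I. (b i - b' i)\<^sup>2 / ((b i)\<^sup>2 + (b' i)\<^sup>2)) / c"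
proof -
  have "(\<lambda>\<zeta>. mix_mean n g F (lin_path I e (n * g) \<zeta>)) \<in> borel_measurable (PiM I (\<lambda>_. borel))"
    using F by measurable
  then show ?thesis
    unfolding series_mean_def
    using gauss_scale_test_bound[OF I b _ _ c, where F="\<lambda>\<zeta>. mix_mean n g F (lin_path I e (n * g) \<zeta>)"]
      mix_mean_bounds[OF F F01] by simp
qed

lemma series_mean_test_bound:
  assumes n: "0 < n" and g: "0 < g" and c: "0 < c" and I: "finite I" and e2: "\<And>i k. \<bar>e i k\<bar> \<le> 2"
    and b: "\<And>i. i \<in> I \<Longrightarrow> 0 < b i \<and> 0 < b' i" and L: "L \<subseteq> I"
    and F: "F \<in> borel_measurable (PiM {..<n} (\<lambda>_. borel))" and F01: "\<And>x. 0 \<le> F x \<and> F x \<le> 1"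
    and V: "0 < V" "4 * (\<Sum>i\<in>I - L. (b i - b' i)\<^sup>2) \<le> V"
    and R: "16 * (\<Sum>i\<in>I. (b i)\<^sup>2 + (b' i)\<^sup>2) \<le> R"
    and Q: "(\<Sum>i\<in>L. (b i - b' i)\<^sup>2 / ((b i)\<^sup>2 + (b' i)\<^sup>2)) \<le> Q"
  shows "\<bar>series_mean n g I e b F - series_mean n g I e b' F\<bar> \<le> 4 * c + Q / c + 4 * real n * V * exp (R + 1) / c"
proof -
  \<comment> \<open>Hybrid amplitudes: passing from \<open>b\<close> to \<open>m\<close> changes
    only indices outside \<open>L\<close> and is done by coupling, passing from \<open>m\<close> to
    \<open>b'\<close> changes only indices in \<open>L\<close> and is done by scaling. Each passage
    costs 2 c.\<close>
  define m where "m = (\<lambda>i. if i \<in> L then b i else b' i)"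
  have fL: "finite L" using I L by (rule finite_subset[rotated])
  have sub: "(\<Sum>i\<in>I. if i \<in> A then f i else 0) = (\<Sum>i\<in>A. f i)" if "A \<subseteq> I" for A and f :: "nat \<Rightarrow> real"
    using I that by (simp add: sum.inter_restrict[symmetric] Int_absorb1)
  have R': "16 * (\<Sum>i\<in>I. (b i)\<^sup>2) \<le> R" "16 * (\<Sum>i\<in>I. (m i)\<^sup>2) \<le> R"
    by (rule order_trans[OF _ R], intro mult_left_mono sum_mono, auto simp: m_def)+
  have "(\<Sum>i\<in>I. (b i - m i)\<^sup>2) = (\<Sum>i\<in>I. if i \<in> I - L then (b i - b' i)\<^sup>2 else 0)"
    by (intro sum.cong) (auto simp: m_def)
  then have "4 * (\<Sum>i\<in>I. (b i - m i)\<^sup>2) \<le> V" using V(2) sub[of "I - L"] by simp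
  from series_mean_coupling[OF n g c I e2 F F01 V(1) this R']
  have 1: "\<bar>series_mean n g I e b F - series_mean n g I e m F\<bar> \<le> 2 * c + 4 * real n * V * exp (R + 1) / c" .
  have "(\<Sum>i\<in>I. (m i - b' i)\<^sup>2 / ((m i)\<^sup>2 + (b' i)\<^sup>2)) = (\<Sum>i\<in>I. if i \<in> L then (b i - b' i)\<^sup>2 / ((b i)\<^sup>2 + (b' i)\<^sup>2) else 0)"
    by (intro sum.cong) (auto simp: m_def)
  also have "\<dots> \<le> Q" using Q sub[OF L] by simp
  finally have "(\<Sum>i\<in>I. (m i - b' i)\<^sup>2 / ((m i)\<^sup>2 + (b' i)\<^sup>2)) / c \<le> Q / c" using c by (intro divide_right_mono) auto
  moreover have "\<bar>series_mean n g I e m F - series_mean n g I e b' F\<bar>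
      \<le> 2 * c + (\<Sum>i\<in>I. (m i - b' i)\<^sup>2 / ((m i)\<^sup>2 + (b' i)\<^sup>2)) / c"
    using b by (intro series_mean_scaling c I F F01) (auto simp: m_def)
  ultimately show ?thesis using 1 by linarith
qed

section \<open>Laws of the discretized data and their limits\<close>

definition data_law :: "nat \<Rightarrow> nat \<Rightarrow> (nat \<Rightarrow> real) measure \<Rightarrow> (nat \<Rightarrow> real) measure" where
  "data_law n g P = distr (P \<Otimes>\<^sub>M gauss {..<n}) (PiM {..<n} (\<lambda>_. borel))
     (\<lambda>(x, z). \<lambda>j\<in>{..<n}. sqrt (block_var n g x j) * z j)"

definition series_law :: "nat set \<Rightarrow> (nat \<Rightarrow> nat \<Rightarrow> real) \<Rightarrow> (nat \<Rightarrow> real) \<Rightarrow> nat \<Rightarrow> (nat \<Rightarrow> real) measure" where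
  "series_law I e b G = distr (gauss I) (PiM {..<G} (\<lambda>_. borel)) (\<lambda>\<xi>. lin_path I e G (\<lambda>i\<in>I. b i * \<xi> i))"

lemma measurable_block_scale':
  assumes P: "prob_vec {..<n * g} P"
  shows "(\<lambda>(x, z). \<lambda>j\<in>{..<n}. sqrt (block_var n g x j) * z j)
    \<in> measurable (P \<Otimes>\<^sub>M gauss {..<n}) (PiM {..<n} (\<lambda>_. borel))"
proof -
  have "sets (P \<Otimes>\<^sub>M gauss {..<n}) = sets (PiM {..<n * g} (\<lambda>_. borel) \<Otimes>\<^sub>M PiM {..<n} (\<lambda>_. borel))"
    by (intro sets_pair_measure_cong prob_vecD(3)[OF P] sets_gauss)
  then show ?thesis using measurable_block_scale measurable_cong_sets by blast
qed

lemma data_law: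
  assumes P: "prob_vec {..<n * g} P"
  shows "prob_vec {..<n} (data_law n g P)"
    and "\<And>F :: _ \<Rightarrow> real. F \<in> borel_measurable (PiM {..<n} (\<lambda>_. borel)) \<Longrightarrow> (\<And>x. \<bar>F x\<bar> \<le> K) \<Longrightarrow>
      (\<integral>y. F y \<partial>data_law n g P) = (\<integral>x. mix_mean n g F x \<partial>P)"
    and "vchar {..<n} (data_law n g P) u
      = complex_of_real (\<integral>x. exp (- (\<Sum>j<n. (u j)\<^sup>2 * block_var n g x j) / 2) \<partial>P)"
proof -
  note m = measurable_block_scale'[OF P]
  have pP: "prob_space P" using prob_vecD[OF P] by simp
  interpret PG: prob_space "P \<Otimes>\<^sub>M gauss {..<n}" by (intro prob_space_pair pP prob_space_gauss)
  interpret pair_sigma_finite P "gauss {..<n}" by (intro pair_sigma_finite_prob pP prob_space_gauss)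
  show "prob_vec {..<n} (data_law n g P)"
    unfolding prob_vec_def data_law_def using PG.prob_space_distr[OF m] by simp
  show "(\<integral>y. F y \<partial>data_law n g P) = (\<integral>x. mix_mean n g F x \<partial>P)"
    if F: "F \<in> borel_measurable (PiM {..<n} (\<lambda>_. borel))" and K: "\<And>x. \<bar>F x\<bar> \<le> K" for F :: "_ \<Rightarrow> real"
  proof -
    have "integrable (P \<Otimes>\<^sub>M gauss {..<n}) (\<lambda>(x, z). F (\<lambda>j\<in>{..<n}. sqrt (block_var n g x j) * z j))"
      using measurable_compose[OF m F] K
      by (intro integrable_pair_bounded[OF pP prob_space_gauss, where K=K]) (auto simp: split_beta')
    from integral_fst'[OF this] show ?thesis
      unfolding data_law_def mix_mean_def by (subst integral_distr[OF m F]) (simp add: split_beta')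
  qed
  show "vchar {..<n} (data_law n g P) u = complex_of_real (\<integral>x. exp (- (\<Sum>j<n. (u j)\<^sup>2 * block_var n g x j) / 2) \<partial>P)"
  proof -
    let ?F = "\<lambda>y :: nat \<Rightarrow> real. iexp (\<Sum>j<n. u j * y j)"
    have F: "?F \<in> borel_measurable (PiM {..<n} (\<lambda>_. borel))" by measurable
    have "integrable (P \<Otimes>\<^sub>M gauss {..<n}) (\<lambda>(x, z). ?F (\<lambda>j\<in>{..<n}. sqrt (block_var n g x j) * z j))"
      using measurable_compose[OF m F]
      by (intro integrable_pair_bounded[OF pP prob_space_gauss, where K=1]) (auto simp: split_beta')
    from integral_fst'[OF this]
    have "vchar {..<n} (data_law n g P) u = (\<integral>x. \<integral>z. ?F (\<lambda>j\<in>{..<n}. sqrt (block_var n g x j) * z j) \<partial>gauss {..<n} \<partial>P)"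
      unfolding data_law_def vchar_def by (subst integral_distr[OF m F]) (simp add: split_beta')
    also have "\<dots> = (\<integral>x. complex_of_real (exp (- (\<Sum>j<n. (u j)\<^sup>2 * block_var n g x j) / 2)) \<partial>P)"
    proof (rule Bochner_Integration.integral_cong[OF refl])
      fix x
      have nn: "0 \<le> block_var n g x j" for j
        by (auto simp: block_var_def intro!: divide_nonneg_nonneg sum_nonneg)
      have "(\<integral>z. ?F (\<lambda>j\<in>{..<n}. sqrt (block_var n g x j) * z j) \<partial>gauss {..<n})
          = (\<integral>z. iexp (\<Sum>j<n. (u j * sqrt (block_var n g x j)) * z j) \<partial>gauss {..<n})"
        by (simp add: mult.assoc)
      also have "\<dots> = complex_of_real (exp (- (\<Sum>j<n. (u j * sqrt (block_var n g x j))\<^sup>2) / 2))"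
        by (rule gauss_char) simp
      finally show "(\<integral>z. ?F (\<lambda>j\<in>{..<n}. sqrt (block_var n g x j) * z j) \<partial>gauss {..<n})
          = complex_of_real (exp (- (\<Sum>j<n. (u j)\<^sup>2 * block_var n g x j) / 2))"
        using nn by (simp add: power_mult_distrib)
    qed
    finally show ?thesis by simp
  qed
qed

lemma series_law:
  assumes I: "finite I"
  shows "prob_vec {..<n * g} (series_law I e b (n * g))"
    and "F \<in> borel_measurable (PiM {..<n} (\<lambda>_. borel)) \<Longrightarrow>
      (\<integral>x. mix_mean n g F x \<partial>series_law I e b (n * g)) = series_mean n g I e b F"
    and "vchar {..<G} (series_law I e b G) u
      = complex_of_real (exp (- (\<Sum>i\<in>I. (b i)\<^sup>2 * (\<Sum>k<G. u k * e i k)\<^sup>2) / 2))"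
proof -
  interpret prob_space "gauss I" by (rule prob_space_gauss)
  have m[measurable]: "(\<lambda>\<xi>. lin_path I e G (\<lambda>i\<in>I. b i * \<xi> i)) \<in> measurable (gauss I) (PiM {..<G} (\<lambda>_. borel))" for G
    by measurable
  show "prob_vec {..<n * g} (series_law I e b (n * g))"
    unfolding prob_vec_def series_law_def using prob_space_distr[OF m] by simp
  show "(\<integral>x. mix_mean n g F x \<partial>series_law I e b (n * g)) = series_mean n g I e b F"
    if F: "F \<in> borel_measurable (PiM {..<n} (\<lambda>_. borel))"
    unfolding series_law_def series_mean_def by (rule integral_distr[OF m measurable_mix_mean[OF F]])
  show "vchar {..<G} (series_law I e b G) u = complex_of_real (exp (- (\<Sum>i\<in>I. (b i)\<^sup>2 * (\<Sum>k<G. u k * e i k)\<^sup>2) / 2))"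
  proof -
    have "vchar {..<G} (series_law I e b G) u = (\<integral>\<xi>. iexp (\<Sum>k<G. u k * lin_path I e G (\<lambda>i\<in>I. b i * \<xi> i) k) \<partial>gauss I)"
      unfolding vchar_def series_law_def by (rule integral_distr[OF m]) measurable
    also have "\<dots> = (\<integral>\<xi>. iexp (\<Sum>i\<in>I. (b i * (\<Sum>k<G. u k * e i k)) * \<xi> i) \<partial>gauss I)"
    proof (intro Bochner_Integration.integral_cong refl arg_cong[where f=iexp])
      fix \<xi>
      have "(\<Sum>k<G. u k * lin_path I e G (\<lambda>i\<in>I. b i * \<xi> i) k) = (\<Sum>k<G. \<Sum>i\<in>I. u k * (b i * \<xi> i * e i k))"
        by (simp add: lin_path_def sum_distrib_left)
      also have "\<dots> = (\<Sum>i\<in>I. \<Sum>k<G. u k * (b i * \<xi> i * e i k))" by (rule sum.swap)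
      finally show "(\<Sum>k<G. u k * lin_path I e G (\<lambda>i\<in>I. b i * \<xi> i) k) = (\<Sum>i\<in>I. (b i * (\<Sum>k<G. u k * e i k)) * \<xi> i)"
        by (simp add: sum_distrib_left sum_distrib_right mult_ac)
    qed
    also have "\<dots> = complex_of_real (exp (- (\<Sum>i\<in>I. (b i * (\<Sum>k<G. u k * e i k))\<^sup>2) / 2))"
      by (rule gauss_char[OF I])
    finally show ?thesis by (simp add: power_mult_distrib)
  qed
qed

text \<open>With s = c exp t the derivative is -s exp(-s), bounded by 1 whatever the size of
  \<open>c\<close>.\<close>

lemma exp_exp_Lipschitz:
  assumes c: "0 \<le> c"
  shows "\<bar>exp (- (c * exp x)) - exp (- (c * exp y))\<bar> \<le> \<bar>x - y :: real\<bar>"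
proof -
  have "norm (exp (- (c * exp x)) - exp (- (c * exp y))) \<le> 1 * norm (x - y)"
  proof (rule field_differentiable_bound[of UNIV "\<lambda>t. exp (- (c * exp t))" "\<lambda>t. exp (- (c * exp t)) * (- (c * exp t))"])
    show "((\<lambda>t. exp (- (c * exp t))) has_field_derivative exp (- (c * exp t)) * (- (c * exp t))) (at t within UNIV)" for t :: real
      by (auto intro!: derivative_eq_intros)
    show "norm (exp (- (c * exp t)) * (- (c * exp t))) \<le> 1" for t :: real
    proof -
      define s where "s = c * exp t"
      have s: "0 \<le> s" using c by (simp add: s_def)
      have "s \<le> exp s" using exp_ge_add_one_self[of s] by linarith
      then have "exp (- s) * s \<le> 1" by (simp add: exp_minus field_simps)
      then show ?thesis using s unfolding s_def[symmetric] by (simp add: abs_mult)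
    qed
  qed auto
  then show ?thesis by simp
qed

text \<open>The characteristic function of the data is the mean, under the path law, of a product of
  factors exp(-c k exp(x k)). Each factor lies in [0, 1] and is 1-Lipschitz, so the product is
  Lipschitz although the variances themselves grow exponentially in the path; the continuity theorem
  for bounded Lipschitz functions applies.\<close>

lemma data_law_limit:
  assumes Pk: "\<And>k. prob_vec {..<n * g} (Pk k)" and P: "prob_vec {..<n * g} P"
    and conv: "\<And>u. (\<lambda>k. vchar {..<n * g} (Pk k) u) \<longlonglongrightarrow> vchar {..<n * g} P u"
  shows "(\<lambda>k. vchar {..<n} (data_law n g (Pk k)) u) \<longlonglongrightarrow> vchar {..<n} (data_law n g P) u"
proof -
  define \<phi> where "\<phi> = (\<lambda>x. exp (- (\<Sum>j<n. (u j)\<^sup>2 * block_var n g x j) / 2))"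
  \<comment> \<open>\<open>k div g\<close> is the block that contains \<open>k\<close>; the 2 in the
    denominator is the one in the Gaussian characteristic function.\<close>
  define c where "c = (\<lambda>k. (u (k div g))\<^sup>2 / (2 * real (n * g)))"
  have c: "0 \<le> c k" for k by (simp add: c_def)
  have \<phi>_eq: "\<phi> x = (\<Prod>k<n * g. exp (- (c k * exp (x k))))" for x
  proof -
    have "(\<Sum>j<n. (u j)\<^sup>2 * block_var n g x j) / 2 = (\<Sum>j<n. \<Sum>k\<in>block g j. c k * exp (x k))"
      unfolding sum_divide_distrib
    proof (rule sum.cong[OF refl])
      fix j
      have "k div g = j" if "k \<in> block g j" for k
      proof -
        from that have "k = j * g + (k - j * g)" "k - j * g < g" by (auto simp: block_def)
        then show ?thesis by (metis add.commute div_mult_self1 div_less add_0_right add_0 less_nat_zero_code mult.commute)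
      qed
      then show "(u j)\<^sup>2 * block_var n g x j / 2 = (\<Sum>k\<in>block g j. c k * exp (x k))"
        by (simp add: block_var_def c_def sum_distrib_left sum_divide_distrib mult_ac)
    qed
    then show ?thesis
      unfolding \<phi>_def sum_blocks by (simp add: exp_sum[symmetric] sum_negf)
  qed
  have "(\<lambda>k. \<integral>x. \<phi> x \<partial>Pk k) \<longlonglongrightarrow> (\<integral>x. \<phi> x \<partial>P)"
  proof (rule Levy_Lipschitz[OF Pk P conv, where K=1 and L=1])
    show "\<phi> \<in> borel_measurable (PiM {..<n * g} (\<lambda>_. borel))"
      unfolding \<phi>_eq[abs_def] by measurable
    show "\<bar>\<phi> x\<bar> \<le> 1" for x
      unfolding \<phi>_eq using c by (auto simp: abs_prod intro!: prod_le_1)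
    show "\<bar>\<phi> x - \<phi> y\<bar> \<le> 1 * (\<Sum>k<n * g. \<bar>x k - y k\<bar>)" for x y
    proof -
      have "norm (\<phi> x - \<phi> y) \<le> (\<Sum>k<n * g. norm (exp (- (c k * exp (x k))) - exp (- (c k * exp (y k)))))"
        unfolding \<phi>_eq using c by (intro norm_prod_diff) auto
      also have "\<dots> \<le> (\<Sum>k<n * g. \<bar>x k - y k\<bar>)"
        using exp_exp_Lipschitz[OF c] by (intro sum_mono) auto
      finally show ?thesis by simp
    qed
  qed
  then show ?thesis
    unfolding data_law(3)[OF Pk] data_law(3)[OF P] \<phi>_def by (rule tendsto_of_real)
qed

section \<open>Two nearby parameters\<close>

text \<open>Index 0 is the linear drift; the indices 2m+1 and 2m+2 carry cos - 1 and sin at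
  frequency m+1. The value 0 beyond the grid makes the bound 2 valid for every
  \<open>k\<close>.\<close>

definition fbm_basis :: "nat \<Rightarrow> nat \<Rightarrow> nat \<Rightarrow> real" where
  "fbm_basis G i k = (if G \<le> k then 0 else if i = 0 then real k / real G
     else if odd i then cos (pi * real ((i + 1) div 2) * (real k / real G)) - 1
     else sin (pi * real ((i + 1) div 2) * (real k / real G)))"

text \<open>Standard deviations of the coefficients. The halved Fourier coefficient reflects that
  the covariance is half of a combination of three values of the variance function.\<close>

definition fbm_amp :: "real \<Rightarrow> real \<Rightarrow> nat \<Rightarrow> real" where
  "fbm_amp H \<eta> i = (if i = 0 then \<eta> * sqrt H else \<eta> * sqrt (fbm_fourier ((i + 1) div 2) H / 2))"

definition fbm_regular :: "real \<Rightarrow> bool" where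
  "fbm_regular H \<longleftrightarrow> 0 < H \<and> H < 1 \<and> (\<forall>k. 0 < fbm_fourier (Suc k) H) \<and> summable (\<lambda>k. fbm_fourier (Suc k) H)"

definition fbm_grid_law :: "real \<Rightarrow> real \<Rightarrow> nat \<Rightarrow> (nat \<Rightarrow> real) measure \<Rightarrow> bool" where
  "fbm_grid_law H \<eta> G P \<longleftrightarrow> prob_vec {..<G} P \<and> (\<forall>u. vchar {..<G} P u = complex_of_real
     (exp (- (\<eta>\<^sup>2 * (\<Sum>k<G. \<Sum>l<G. u k * u l * fbm_cov H (real k / real G) (real l / real G))) / 2)))"

lemma sum_up_to_even: "(\<Sum>i\<le>2 * K. f i) = f 0 + (\<Sum>m<K. f (2 * m + 1) + f (2 * m + 2))" for f :: "nat \<Rightarrow> real"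
  by (induction K) (auto simp: add.assoc)

lemma fbm_basis_le: "\<bar>fbm_basis G i k\<bar> \<le> 2"
proof -
  have "\<bar>cos x - 1\<bar> \<le> 2" "\<bar>sin x\<bar> \<le> 2" for x :: real
    using cos_le_one[of x] cos_ge_minus_one[of x] abs_sin_le_one[of x] by linarith+
  then show ?thesis by (auto simp: fbm_basis_def divide_le_eq)
qed

text \<open>At each frequency, (1 - cos a)(1 - cos b) + sin a sin b equals (1 - cos a) + (1 - cos b)
  - (1 - cos(a - b)). Summing gives the covariance with the quadratic parts -H s^2 - H t^2 + H (s -
  t)^2 halved, that is -H s t, which the drift of variance H restores.\<close>

lemma fbm_cov_series:
  assumes H: "fbm_regular H" and k: "k < G" and l: "l < G"
  shows "(\<lambda>K. \<Sum>i\<le>2 * K. (fbm_amp H \<eta> i)\<^sup>2 * (fbm_basis G i k * fbm_basis G i l))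
    \<longlonglongrightarrow> \<eta>\<^sup>2 * fbm_cov H (real k / real G) (real l / real G)"
proof -
  define s t where "s = real k / real G" and "t = real l / real G"
  have st: "0 \<le> s" "s \<le> 1" "0 \<le> t" "t \<le> 1" using k l by (auto simp: s_def t_def)
  define \<mu> where "\<mu> = (\<lambda>m. fbm_fourier (Suc m) H)"
  have H': "0 < H" "H < 1" "\<And>m. 0 \<le> \<mu> m" "summable \<mu>"
    using H unfolding fbm_regular_def \<mu>_def by (auto simp: less_imp_le)
  have expand: "(\<lambda>m. \<mu> m * (1 - cos (pi * real (Suc m) * x))) sums (\<bar>x\<bar> powr (2 * H) - H * x\<^sup>2)" if "\<bar>x\<bar> \<le> 1" for x
    using fbm_fourier_expansion[OF H'(1,2) _ _ that] H'(3,4) by (simp add: \<mu>_def)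
  have pair: "(fbm_amp H \<eta> (2 * m + 1))\<^sup>2 * (fbm_basis G (2 * m + 1) k * fbm_basis G (2 * m + 1) l)
      + (fbm_amp H \<eta> (2 * m + 2))\<^sup>2 * (fbm_basis G (2 * m + 2) k * fbm_basis G (2 * m + 2) l)
      = \<eta>\<^sup>2 / 2 * (\<mu> m * (1 - cos (pi * real (Suc m) * s)) + \<mu> m * (1 - cos (pi * real (Suc m) * t))
        - \<mu> m * (1 - cos (pi * real (Suc m) * (s - t))))" for m
  proof -
    define a b where "a = pi * real (Suc m) * s" and "b = pi * real (Suc m) * t"
    have d: "pi * real (Suc m) * (s - t) = a - b" by (simp add: a_def b_def algebra_simps)
    have "(2 * m + 1 + 1) div 2 = Suc m" "(2 * m + 2 + 1) div 2 = Suc m" by auto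
    then have basis: "fbm_amp H \<eta> (2 * m + 1) = \<eta> * sqrt (\<mu> m / 2)" "fbm_amp H \<eta> (2 * m + 2) = \<eta> * sqrt (\<mu> m / 2)"
      "fbm_basis G (2 * m + 1) k = cos a - 1" "fbm_basis G (2 * m + 1) l = cos b - 1"
      "fbm_basis G (2 * m + 2) k = sin a" "fbm_basis G (2 * m + 2) l = sin b"
      using k l by (auto simp: fbm_amp_def fbm_basis_def \<mu>_def a_def b_def s_def t_def)
    have sq: "(\<eta> * sqrt (\<mu> m / 2))\<^sup>2 = \<eta>\<^sup>2 / 2 * \<mu> m"
      using H'(3)[of m] by (simp add: power_mult_distrib)
    show ?thesis
      unfolding basis sq d a_def[symmetric] b_def[symmetric] by (simp add: cos_diff algebra_simps add_divide_distrib)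
  qed
  have "(\<lambda>K. \<Sum>m<K. \<eta>\<^sup>2 / 2 * (\<mu> m * (1 - cos (pi * real (Suc m) * s)) + \<mu> m * (1 - cos (pi * real (Suc m) * t))
        - \<mu> m * (1 - cos (pi * real (Suc m) * (s - t)))))
      \<longlonglongrightarrow> \<eta>\<^sup>2 / 2 * ((\<bar>s\<bar> powr (2 * H) - H * s\<^sup>2) + (\<bar>t\<bar> powr (2 * H) - H * t\<^sup>2) - (\<bar>s - t\<bar> powr (2 * H) - H * (s - t)\<^sup>2))"
    using st by (intro sums_mult[unfolded sums_def] sums_diff[unfolded sums_def] sums_add[unfolded sums_def] expand[unfolded sums_def]) auto
  then have "(\<lambda>K. \<eta>\<^sup>2 * H * (s * t) + (\<Sum>m<K. \<eta>\<^sup>2 / 2 * (\<mu> m * (1 - cos (pi * real (Suc m) * s)) + \<mu> m * (1 - cos (pi * real (Suc m) * t))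
        - \<mu> m * (1 - cos (pi * real (Suc m) * (s - t))))))
      \<longlonglongrightarrow> \<eta>\<^sup>2 * H * (s * t) + \<eta>\<^sup>2 / 2 * ((\<bar>s\<bar> powr (2 * H) - H * s\<^sup>2) + (\<bar>t\<bar> powr (2 * H) - H * t\<^sup>2) - (\<bar>s - t\<bar> powr (2 * H) - H * (s - t)\<^sup>2))"
    by (intro tendsto_add tendsto_const)
  also have "\<eta>\<^sup>2 * H * (s * t) + \<eta>\<^sup>2 / 2 * ((\<bar>s\<bar> powr (2 * H) - H * s\<^sup>2) + (\<bar>t\<bar> powr (2 * H) - H * t\<^sup>2) - (\<bar>s - t\<bar> powr (2 * H) - H * (s - t)\<^sup>2))
      = \<eta>\<^sup>2 * fbm_cov H s t"
    unfolding fbm_cov_def by (simp add: abs_minus_commute[of s t] power2_eq_square field_simps)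
  also have "(\<lambda>K. \<eta>\<^sup>2 * H * (s * t) + (\<Sum>m<K. \<eta>\<^sup>2 / 2 * (\<mu> m * (1 - cos (pi * real (Suc m) * s)) + \<mu> m * (1 - cos (pi * real (Suc m) * t))
        - \<mu> m * (1 - cos (pi * real (Suc m) * (s - t))))))
      = (\<lambda>K. \<Sum>i\<le>2 * K. (fbm_amp H \<eta> i)\<^sup>2 * (fbm_basis G i k * fbm_basis G i l))"
    unfolding sum_up_to_even pair using H'(1) k l
    by (simp add: fbm_amp_def fbm_basis_def s_def t_def power_mult_distrib)
  finally show ?thesis by (simp add: s_def t_def)
qed

text \<open>Counting truncations from \<open>J\<close> upwards keeps the low frequencies, treated by
  scaling, inside every truncation.\<close>

lemma series_law_converges:
  assumes H: "fbm_regular H" and P: "fbm_grid_law H \<eta> G P"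
  shows "(\<lambda>K. vchar {..<G} (series_law {..2 * (J + K)} (fbm_basis G) (fbm_amp H \<eta>) G) u) \<longlonglongrightarrow> vchar {..<G} P u"
proof -
  define q where "q = (\<lambda>K. \<Sum>i\<le>2 * K. (fbm_amp H \<eta> i)\<^sup>2 * (\<Sum>k<G. u k * fbm_basis G i k)\<^sup>2)"
  have q_eq: "q K = (\<Sum>k<G. \<Sum>l<G. u k * u l * (\<Sum>i\<le>2 * K. (fbm_amp H \<eta> i)\<^sup>2 * (fbm_basis G i k * fbm_basis G i l)))" for K
  proof -
    have "q K = (\<Sum>i\<le>2 * K. \<Sum>k<G. \<Sum>l<G. u k * u l * ((fbm_amp H \<eta> i)\<^sup>2 * (fbm_basis G i k * fbm_basis G i l)))"
      unfolding q_def power2_eq_square[of "sum _ _"] sum_product by (simp add: sum_distrib_left mult_ac)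
    also have "\<dots> = (\<Sum>k<G. \<Sum>i\<le>2 * K. \<Sum>l<G. u k * u l * ((fbm_amp H \<eta> i)\<^sup>2 * (fbm_basis G i k * fbm_basis G i l)))"
      by (rule sum.swap)
    also have "\<dots> = (\<Sum>k<G. \<Sum>l<G. \<Sum>i\<le>2 * K. u k * u l * ((fbm_amp H \<eta> i)\<^sup>2 * (fbm_basis G i k * fbm_basis G i l)))"
      by (intro sum.cong refl sum.swap)
    finally show ?thesis by (simp add: sum_distrib_left)
  qed
  have "q \<longlonglongrightarrow> (\<Sum>k<G. \<Sum>l<G. u k * u l * (\<eta>\<^sup>2 * fbm_cov H (real k / real G) (real l / real G)))"
    unfolding q_eq by (intro tendsto_sum tendsto_mult tendsto_const fbm_cov_series[OF H]) auto
  also have "(\<Sum>k<G. \<Sum>l<G. u k * u l * (\<eta>\<^sup>2 * fbm_cov H (real k / real G) (real l / real G)))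
      = \<eta>\<^sup>2 * (\<Sum>k<G. \<Sum>l<G. u k * u l * fbm_cov H (real k / real G) (real l / real G))"
    by (simp add: sum_distrib_left mult_ac)
  finally have "(\<lambda>K. q (K + J)) \<longlonglongrightarrow> \<eta>\<^sup>2 * (\<Sum>k<G. \<Sum>l<G. u k * u l * fbm_cov H (real k / real G) (real l / real G))"
    by (rule LIMSEQ_ignore_initial_segment)
  then have "(\<lambda>K. complex_of_real (exp (- q (J + K) / 2))) \<longlonglongrightarrow> complex_of_real (exp (- (\<eta>\<^sup>2 * (\<Sum>k<G. \<Sum>l<G. u k * u l * fbm_cov H (real k / real G) (real l / real G))) / 2))"
    by (intro tendsto_of_real tendsto_exp tendsto_divide tendsto_minus tendsto_const) (auto simp: add.commute)
  then show ?thesis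
    using P by (simp add: series_law(3) q_def fbm_grid_law_def)
qed

text \<open>The hypotheses on \<open>V\<close> and \<open>R\<close> are uniform in the truncation
  level, so the bound for the truncated series survives the limit. It is also the same for every
  mesh \<open>g\<close>.\<close>

lemma fbm_data_test_bound:
  assumes n: "0 < n" and g: "0 < g" and c: "0 < c"
    and H: "fbm_regular H" "fbm_regular H'" and \<eta>: "0 < \<eta>" "0 < \<eta>'"
    and P: "fbm_grid_law H \<eta> (n * g) P" and P': "fbm_grid_law H' \<eta>' (n * g) P'"
    and V: "0 < V" "\<And>K. 4 * (\<Sum>i\<in>{2 * J<..2 * (J + K)}. (fbm_amp H \<eta> i - fbm_amp H' \<eta>' i)\<^sup>2) \<le> V"
    and R: "\<And>K. 16 * (\<Sum>i\<le>2 * K. (fbm_amp H \<eta> i)\<^sup>2 + (fbm_amp H' \<eta>' i)\<^sup>2) \<le> R"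
    and Q: "(\<Sum>i\<le>2 * J. (fbm_amp H \<eta> i - fbm_amp H' \<eta>' i)\<^sup>2 / ((fbm_amp H \<eta> i)\<^sup>2 + (fbm_amp H' \<eta>' i)\<^sup>2)) \<le> Q"
    and f: "continuous_on UNIV f" and f01: "\<And>x. 0 \<le> f x \<and> f x \<le> 1"
  shows "\<bar>(\<integral>x. f x \<partial>data_law n g P) - (\<integral>x. f x \<partial>data_law n g P')\<bar>
    \<le> 4 * c + Q / c + 4 * real n * V * exp (R + 1) / c"
proof -
  define S where "S = (\<lambda>H \<eta> K. series_law {..2 * (J + K)} (fbm_basis (n * g)) (fbm_amp H \<eta>) (n * g))"
  have S: "prob_vec {..<n * g} (S H \<eta> K)" for H \<eta> K unfolding S_def by (rule series_law(1)) simp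
  have amp_pos: "0 < fbm_amp H \<eta> i" if "fbm_regular H" "0 < \<eta>" for H \<eta> i
  proof (cases "i = 0")
    case False
    then have "(i + 1) div 2 \<noteq> 0" by auto
    then obtain m where "(i + 1) div 2 = Suc m" using not0_implies_Suc by blast
    then show ?thesis using that False by (auto simp: fbm_amp_def fbm_regular_def)
  qed (use that in \<open>auto simp: fbm_amp_def fbm_regular_def\<close>)
  have Pv: "prob_vec {..<n * g} P" "prob_vec {..<n * g} P'" using P P' by (auto simp: fbm_grid_law_def)
  show ?thesis
  proof (rule test_bound_limit[where Pk="\<lambda>K. data_law n g (S H \<eta> K)" and Qk="\<lambda>K. data_law n g (S H' \<eta>' K)" and I="{..<n}"])
    show "prob_vec {..<n} (data_law n g (S H \<eta> K))" "prob_vec {..<n} (data_law n g (S H' \<eta>' K))" for K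
      by (rule data_law(1)[OF S])+
    show "prob_vec {..<n} (data_law n g P)" "prob_vec {..<n} (data_law n g P')" using Pv by (auto intro: data_law(1))
    show "(\<lambda>K. vchar {..<n} (data_law n g (S H \<eta> K)) u) \<longlonglongrightarrow> vchar {..<n} (data_law n g P) u" for u
      by (rule data_law_limit[OF S Pv(1)]) (unfold S_def, rule series_law_converges[OF H(1) P])
    show "(\<lambda>K. vchar {..<n} (data_law n g (S H' \<eta>' K)) u) \<longlonglongrightarrow> vchar {..<n} (data_law n g P') u" for u
      by (rule data_law_limit[OF S Pv(2)]) (unfold S_def, rule series_law_converges[OF H(2) P'])
    fix K and F :: "(nat \<Rightarrow> real) \<Rightarrow> real"
    assume F: "continuous_on UNIV F" "\<And>x. 0 \<le> F x \<and> F x \<le> 1"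
    have Fm: "F \<in> borel_measurable (PiM {..<n} (\<lambda>_. borel))" by (rule borel_measurable_continuous_PiM[OF F(1)])
    have "\<bar>F x\<bar> \<le> 1" for x using F(2)[of x] by simp
    then have eq: "(\<integral>x. F x \<partial>data_law n g (S H \<eta> K)) = series_mean n g {..2 * (J + K)} (fbm_basis (n * g)) (fbm_amp H \<eta>) F" for H \<eta>
      using data_law(2)[OF S Fm, where K=1] series_law(2)[OF _ Fm] by (simp add: S_def)
    show "\<bar>(\<integral>x. F x \<partial>data_law n g (S H \<eta> K)) - (\<integral>x. F x \<partial>data_law n g (S H' \<eta>' K))\<bar> \<le> 4 * c + Q / c + 4 * real n * V * exp (R + 1) / c"
      unfolding eq
    proof (rule series_mean_test_bound[OF n g c _ fbm_basis_le, where L="{..2 * J}"])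
      show "0 < fbm_amp H \<eta> i \<and> 0 < fbm_amp H' \<eta>' i" for i using amp_pos H \<eta> by auto
      have "{..2 * (J + K)} - {..2 * J} = {2 * J<..2 * (J + K)}" by auto
      then show "4 * (\<Sum>i\<in>{..2 * (J + K)} - {..2 * J}. (fbm_amp H \<eta> i - fbm_amp H' \<eta>' i)\<^sup>2) \<le> V" using V(2) by simp
    qed (use Fm F V R[of "J + K"] Q in auto)
  qed (use f f01 in auto)
qed

section \<open>Relative perturbation of the amplitudes\<close>

lemma relative_square_le:
  fixes x y :: real
  assumes "0 < x" "0 < y"
  shows "(x - y)\<^sup>2 \<le> (ln x - ln y)\<^sup>2 * (max x y)\<^sup>2"
proof -
  have "\<bar>x - y\<bar> \<le> \<bar>ln x - ln y\<bar> * exp (max (ln x) (ln y))"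
    using abs_exp_diff_le[of "ln x" "ln y"] assms by simp
  also have "exp (max (ln x) (ln y)) = max x y"
    using assms by (auto simp: max_def)
  finally have "\<bar>x - y\<bar>\<^sup>2 \<le> (\<bar>ln x - ln y\<bar> * max x y)\<^sup>2" by (intro power_mono) auto
  then show ?thesis by (simp add: power_mult_distrib)
qed

text \<open>Relative errors for the low frequencies and absolute errors for the high ones are both
  governed by the difference of logarithms, in which the perturbations of H and of the volatility of
  volatility add up.\<close>

lemma relative_square_le':
  fixes x y :: real
  assumes "0 < x" "0 < y"
  shows "(x - y)\<^sup>2 / (x\<^sup>2 + y\<^sup>2) \<le> (ln x - ln y)\<^sup>2"
    and "(x - y)\<^sup>2 \<le> (ln x - ln y)\<^sup>2 * (x\<^sup>2 + y\<^sup>2)"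
proof -
  have "(max x y)\<^sup>2 \<le> x\<^sup>2 + y\<^sup>2" by (auto simp: max_def)
  then have "(ln x - ln y)\<^sup>2 * (max x y)\<^sup>2 \<le> (ln x - ln y)\<^sup>2 * (x\<^sup>2 + y\<^sup>2)" by (intro mult_left_mono) auto
  with relative_square_le[OF assms] show "(x - y)\<^sup>2 \<le> (ln x - ln y)\<^sup>2 * (x\<^sup>2 + y\<^sup>2)" by linarith
  then show "(x - y)\<^sup>2 / (x\<^sup>2 + y\<^sup>2) \<le> (ln x - ln y)\<^sup>2"
    using assms by (simp add: pos_divide_le_eq add_pos_pos)
qed

text \<open>Absorbs a logarithm into a small power, which the sums over frequencies can
  afford.\<close>

lemma log_square_le:
  fixes x \<delta> L :: real
  assumes x: "1 \<le> x" and \<delta>: "0 < \<delta>" and L: "0 \<le> L"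
  shows "(ln x + L)\<^sup>2 \<le> (1 / \<delta> + L)\<^sup>2 * x powr (2 * \<delta>)"
proof -
  have "ln x \<le> x powr \<delta> / \<delta>" by (rule ln_powr_bound[OF x \<delta>])
  moreover have "L \<le> L * x powr \<delta>" using L x \<delta> ge_one_powr_ge_zero[of x \<delta>] by (simp add: mult_le_cancel_left1)
  ultimately have "ln x + L \<le> (1 / \<delta> + L) * x powr \<delta>" by (simp add: distrib_right)
  then have "(ln x + L)\<^sup>2 \<le> ((1 / \<delta> + L) * x powr \<delta>)\<^sup>2" using x L by (intro power_mono) auto
  also have "\<dots> = (1 / \<delta> + L)\<^sup>2 * x powr (2 * \<delta>)"
    using x by (simp add: power_mult_distrib power2_eq_square[of "_ powr _"] powr_add[symmetric])
  finally show ?thesis .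
qed

lemma sum_powr_half_le: "(\<Sum>m<J. real (Suc m) powr (- 1 / 2)) \<le> 2 * sqrt (real J)"
proof (induction J)
  case (Suc J)
  have "real (Suc J) powr (- 1 / 2) = 1 / sqrt (real (Suc J))"
    by (simp add: powr_minus_divide powr_half_sqrt)
  also have "\<dots> \<le> 2 * (sqrt (real (Suc J)) - sqrt (real J))"
  proof -
    have s: "0 < sqrt (real (Suc J))" "0 \<le> sqrt (real J)" "sqrt (real J) \<le> sqrt (real (Suc J))" by auto
    have "1 = (sqrt (real (Suc J)) - sqrt (real J)) * (sqrt (real (Suc J)) + sqrt (real J))"
      by (simp add: algebra_simps)
    also have "\<dots> \<le> (sqrt (real (Suc J)) - sqrt (real J)) * (2 * sqrt (real (Suc J)))"
      using s by (intro mult_left_mono) auto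
    finally show ?thesis unfolding pos_divide_le_eq[OF s(1)] by (simp only: mult_ac)
  qed
  finally show ?case using Suc by simp
qed simp

text \<open>Telescoping through the mean value theorem, in place of a comparison with an
  integral.\<close>

lemma sum_powr_tail_le:
  assumes a: "0 < a" and J: "1 \<le> J"
  shows "(\<Sum>m\<in>{J..<J + K}. real (Suc m) powr (- a - 1)) \<le> real J powr (- a) / a"
proof -
  have step: "real (Suc m) powr (- a - 1) \<le> (real m powr (- a) - real (Suc m) powr (- a)) / a" if "1 \<le> m" for m
  proof -
    have "\<exists>z. real m < z \<and> z < real (Suc m) \<and>
        real (Suc m) powr (- a) - real m powr (- a) = (real (Suc m) - real m) * (- a * z powr (- a - 1))"
      using that by (intro MVT2) (auto intro!: derivative_eq_intros)
    then obtain z where z: "real m < z" "z < real (Suc m)"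
      "real m powr (- a) - real (Suc m) powr (- a) = a * z powr (- a - 1)" by auto
    have "real (Suc m) powr (- a - 1) \<le> z powr (- a - 1)"
      using z a that by (intro powr_mono2') auto
    with z(3) a show ?thesis by (simp add: pos_le_divide_eq mult.commute)
  qed
  have "(\<Sum>m\<in>{J..<J + K}. real (Suc m) powr (- a - 1)) \<le> (real J powr (- a) - real (J + K) powr (- a)) / a"
  proof (induction K)
    case (Suc K)
    with step[of "J + K"] J show ?case by (simp add: diff_divide_distrib)
  qed simp
  also have "\<dots> \<le> real J powr (- a) / a" using a by (intro divide_right_mono) auto
  finally show ?thesis .
qed

lemma sum_even_tail: "(\<Sum>i\<in>{2 * J<..2 * (J + K)}. f i) = (\<Sum>m\<in>{J..<J + K}. f (2 * m + 1) + f (2 * m + 2))" for f :: "nat \<Rightarrow> real"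
proof (induction K)
  case (Suc K)
  have "{2 * J<..2 * (J + Suc K)} = insert (2 * (J + K) + 1) (insert (2 * (J + K) + 2) {2 * J<..2 * (J + K)})" by auto
  with Suc show ?case by (simp add: add.assoc)
qed simp

lemma fbm_amp_odd: "fbm_amp H \<eta> (2 * m + 1) = \<eta> * sqrt (fbm_fourier (Suc m) H / 2)"
  and fbm_amp_even: "fbm_amp H \<eta> (2 * m + 2) = \<eta> * sqrt (fbm_fourier (Suc m) H / 2)"
proof -
  have "(2 * m + 1 + 1) div 2 = Suc m" "(2 * m + 2 + 1) div 2 = Suc m" by auto
  then show "fbm_amp H \<eta> (2 * m + 1) = \<eta> * sqrt (fbm_fourier (Suc m) H / 2)"
    "fbm_amp H \<eta> (2 * m + 2) = \<eta> * sqrt (fbm_fourier (Suc m) H / 2)"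
    by (simp_all add: fbm_amp_def)
qed

text \<open>The second parameter moves along the curve on which the amplitude at frequency \<open>J\<close> is constant to first
  order; this is what removes the logarithm from the rate for \<open>H\<close> and puts it into the rate for the volatility of volatility.\<close>

lemma fbm_amp_perturbation:
  fixes a b :: real
  assumes ab: "0 < a" "a \<le> b" "b < 1" and half: "b < 1 / 2 \<or> 1 / 2 < a"
  obtains C where "0 < C"
    "\<And>H. a \<le> H \<Longrightarrow> H \<le> b \<Longrightarrow> fbm_regular H"
    "\<And>H \<eta> K. a \<le> H \<Longrightarrow> H \<le> b \<Longrightarrow> 0 < \<eta> \<Longrightarrow> (\<Sum>i\<le>2 * K. (fbm_amp H \<eta> i)\<^sup>2) \<le> C * \<eta>\<^sup>2"
    "\<And>H h \<eta> J. a \<le> H - h \<Longrightarrow> 0 \<le> h \<Longrightarrow> H \<le> b \<Longrightarrow> 0 < \<eta> \<Longrightarrow> 1 \<le> J \<Longrightarrow>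
      (\<Sum>i\<le>2 * J. (fbm_amp H \<eta> i - fbm_amp (H - h) (\<eta> * real J powr (- h)) i)\<^sup>2
         / ((fbm_amp H \<eta> i)\<^sup>2 + (fbm_amp (H - h) (\<eta> * real J powr (- h)) i)\<^sup>2)) \<le> C * h\<^sup>2 * real J"
    "\<And>H h \<eta> J K. a \<le> H - h \<Longrightarrow> 0 \<le> h \<Longrightarrow> 4 * h \<le> a \<Longrightarrow> H \<le> b \<Longrightarrow> 0 < \<eta> \<Longrightarrow> 1 \<le> J \<Longrightarrow>
      (\<Sum>i\<in>{2 * J<..2 * (J + K)}. (fbm_amp H \<eta> i - fbm_amp (H - h) (\<eta> * real J powr (- h)) i)\<^sup>2)
        \<le> C * \<eta>\<^sup>2 * h\<^sup>2 * real J powr (- 2 * H)"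
proof -
  obtain C L where CL: "0 < C" "0 \<le> L"
    "\<And>k H. 1 \<le> k \<Longrightarrow> a \<le> H \<Longrightarrow> H \<le> b \<Longrightarrow> 0 < fbm_fourier k H"
    "\<And>k H. 1 \<le> k \<Longrightarrow> a \<le> H \<Longrightarrow> H \<le> b \<Longrightarrow> fbm_fourier k H \<le> C * real k powr (- 2 * H - 1)"
    "\<And>k H H'. 1 \<le> k \<Longrightarrow> a \<le> H \<Longrightarrow> H \<le> b \<Longrightarrow> a \<le> H' \<Longrightarrow> H' \<le> b \<Longrightarrow>
        \<bar>ln (fbm_fourier k H) - ln (fbm_fourier k H') + 2 * (H - H') * ln (real k)\<bar> \<le> L * \<bar>H - H'\<bar>"
    by (rule fbm_fourier_bounds[OF ab half]) (rule that)
  \<comment> \<open>\<open>L\<close> controls the Fourier coefficients, 1/a the change of ln H in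
    the drift amplitude.\<close>
  define M where "M = L + 1 / a"
  have M: "0 < M" "L \<le> M" "1 / a \<le> M" using CL(2) ab by (auto simp: M_def intro!: add_nonneg_pos)
  have regular: "fbm_regular H" if H: "a \<le> H" "H \<le> b" for H
  proof -
    have "summable (\<lambda>k. fbm_fourier (Suc k) H)"
    proof (rule summable_comparison_test)
      show "\<exists>N. \<forall>k\<ge>N. norm (fbm_fourier (Suc k) H) \<le> C * real (Suc k) powr (- 2 * H - 1)"
        using CL(3,4)[of "Suc _" H] H by (auto simp: less_imp_le abs_of_pos)
      have "summable (\<lambda>k. real k powr (- 2 * H - 1))" using H ab by (simp add: summable_real_powr_iff)
      then have "summable (\<lambda>k. real (Suc k) powr (- 2 * H - 1))" by (subst summable_Suc_iff)
      then show "summable (\<lambda>k. C * real (Suc k) powr (- 2 * H - 1))" by (rule summable_mult)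
    qed
    then show ?thesis using H ab CL(3) by (auto simp: fbm_regular_def)
  qed
  have amp2: "(\<eta> * sqrt (fbm_fourier (Suc m) H / 2))\<^sup>2 \<le> \<eta>\<^sup>2 * C * real (Suc m) powr (- 2 * H - 1)"
    if H: "a \<le> H" "H \<le> b" for H \<eta> m
  proof -
    have "(\<eta> * sqrt (fbm_fourier (Suc m) H / 2))\<^sup>2 = \<eta>\<^sup>2 * (fbm_fourier (Suc m) H / 2)"
      using CL(3)[of "Suc m" H] H by (simp add: power_mult_distrib)
    also have "\<dots> \<le> \<eta>\<^sup>2 * (C * real (Suc m) powr (- 2 * H - 1))"
      using CL(3,4)[of "Suc m" H] H by (intro mult_left_mono) auto
    finally show ?thesis by (simp add: mult.assoc)
  qed
  have energy: "(\<Sum>i\<le>2 * K. (fbm_amp H \<eta> i)\<^sup>2) \<le> (1 + 2 * C * (1 + 1 / (2 * a))) * \<eta>\<^sup>2"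
    if H: "a \<le> H" "H \<le> b" and \<eta>: "0 < \<eta>" for H \<eta> K
  proof -
    have "(\<Sum>m<K. real (Suc m) powr (- 2 * H - 1)) \<le> 1 + 1 / (2 * a)"
    proof (cases K)
      case (Suc K')
      have "(\<Sum>m<K. real (Suc m) powr (- 2 * H - 1)) = 1 + (\<Sum>m\<in>{1..<1 + K'}. real (Suc m) powr (- 2 * H - 1))"
        unfolding Suc by (subst lessThan_atLeast0, subst sum.atLeast_Suc_lessThan) auto
      also have "(\<Sum>m\<in>{1..<1 + K'}. real (Suc m) powr (- 2 * H - 1)) \<le> 1 / (2 * H)"
        using sum_powr_tail_le[of "2 * H" 1 K'] H ab by simp
      also have "1 / (2 * H) \<le> 1 / (2 * a)" using H ab by (intro divide_left_mono) auto
      finally show ?thesis by simp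
    qed (use ab in auto)
    then have "2 * (\<eta>\<^sup>2 * C) * (\<Sum>m<K. real (Suc m) powr (- 2 * H - 1)) \<le> 2 * (\<eta>\<^sup>2 * C) * (1 + 1 / (2 * a))"
      using CL(1) by (intro mult_left_mono) auto
    moreover have "(\<Sum>i\<le>2 * K. (fbm_amp H \<eta> i)\<^sup>2) \<le> \<eta>\<^sup>2 * H + (\<Sum>m<K. 2 * (\<eta>\<^sup>2 * C) * real (Suc m) powr (- 2 * H - 1))"
      unfolding sum_up_to_even fbm_amp_odd fbm_amp_even using amp2[OF H, of \<eta>] H ab
      by (intro add_mono sum_mono) (auto simp: fbm_amp_def power_mult_distrib mult.assoc)
    moreover have "\<eta>\<^sup>2 * H \<le> \<eta>\<^sup>2" using H ab by (intro mult_left_le) auto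
    ultimately show ?thesis by (simp add: sum_distrib_left algebra_simps)
  qed
  \<comment> \<open>The factor J^(-h) contributes h ln J and the decay of the coefficients -h ln(m +
    1). Together they give -h ln((m + 1)/J), small near frequency \<open>J\<close>; the remainder is
    Lipschitz in H.\<close>
  have log_ratio: "\<bar>ln (\<eta> * sqrt (fbm_fourier (Suc m) H / 2)) - ln (\<eta> * real J powr (- h) * sqrt (fbm_fourier (Suc m) (H - h) / 2))\<bar>
      \<le> h * (\<bar>ln (real (Suc m) / real J)\<bar> + M)"
    if "a \<le> H - h" "0 \<le> h" "H \<le> b" "0 < \<eta>" "1 \<le> J" for H h \<eta> J m
  proof -
    have f: "0 < fbm_fourier (Suc m) H" "0 < fbm_fourier (Suc m) (H - h)" using CL(3)[of "Suc m"] that by auto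
    have sq: "ln (sqrt (x / 2)) = (ln x - ln 2) / 2" if "0 < x" for x :: real
      using that by (simp add: ln_sqrt ln_div)
    have "ln (\<eta> * sqrt (fbm_fourier (Suc m) H / 2)) - ln (\<eta> * real J powr (- h) * sqrt (fbm_fourier (Suc m) (H - h) / 2))
        = h * ln (real J) + (ln (fbm_fourier (Suc m) H) - ln (fbm_fourier (Suc m) (H - h))) / 2"
      using f that by (simp add: ln_mult sq ln_powr diff_divide_distrib)
    also have "\<dots> = (ln (fbm_fourier (Suc m) H) - ln (fbm_fourier (Suc m) (H - h)) + 2 * (H - (H - h)) * ln (real (Suc m))) / 2
        - h * ln (real (Suc m) / real J)"
    proof -
      have "ln (real (Suc m) / real J) = ln (real (Suc m)) - ln (real J)" using that by (simp add: ln_div del: of_nat_Suc)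
      then show ?thesis by (simp only:) (simp add: field_simps)
    qed
    finally have "\<bar>ln (\<eta> * sqrt (fbm_fourier (Suc m) H / 2)) - ln (\<eta> * real J powr (- h) * sqrt (fbm_fourier (Suc m) (H - h) / 2))\<bar>
        \<le> \<bar>(ln (fbm_fourier (Suc m) H) - ln (fbm_fourier (Suc m) (H - h)) + 2 * (H - (H - h)) * ln (real (Suc m))) / 2\<bar>
          + \<bar>h * ln (real (Suc m) / real J)\<bar>"
      by linarith
    moreover have "\<bar>(ln (fbm_fourier (Suc m) H) - ln (fbm_fourier (Suc m) (H - h)) + 2 * (H - (H - h)) * ln (real (Suc m))) / 2\<bar> \<le> L * h"
    proof (rule order_trans)
      show "\<bar>ln (fbm_fourier (Suc m) H) - ln (fbm_fourier (Suc m) (H - h)) + 2 * (H - (H - h)) * ln (real (Suc m))\<bar> \<le> L * h"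
        using CL(5)[of "Suc m" H "H - h"] that by auto
      have "\<bar>E / 2\<bar> \<le> \<bar>E\<bar>" for E :: real by simp
      then show "\<bar>(ln (fbm_fourier (Suc m) H) - ln (fbm_fourier (Suc m) (H - h)) + 2 * (H - (H - h)) * ln (real (Suc m))) / 2\<bar>
          \<le> \<bar>ln (fbm_fourier (Suc m) H) - ln (fbm_fourier (Suc m) (H - h)) + 2 * (H - (H - h)) * ln (real (Suc m))\<bar>" .
    qed
    moreover have "L * h \<le> M * h" using M that by (intro mult_right_mono) auto
    moreover have "0 \<le> L * h" using CL that by simp
    moreover have "\<bar>h * ln (real (Suc m) / real J)\<bar> = h * \<bar>ln (real (Suc m) / real J)\<bar>" using that by (simp add: abs_mult)
    ultimately show ?thesis unfolding distrib_left mult.commute[of h M] by linarith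
  qed
  \<comment> \<open>4 + M comes from \<delta> = 1/4 in \<open>log_square_le\<close>. The drift
    counts once; each frequency has two coefficients and the sum of inverse square roots brings
    another 2, so that 5 = 1 + 4.\<close>
  define C2 where "C2 = 5 * (4 + M)\<^sup>2"
  have low: "(\<Sum>i\<le>2 * J. (fbm_amp H \<eta> i - fbm_amp (H - h) (\<eta> * real J powr (- h)) i)\<^sup>2
         / ((fbm_amp H \<eta> i)\<^sup>2 + (fbm_amp (H - h) (\<eta> * real J powr (- h)) i)\<^sup>2)) \<le> C2 * h\<^sup>2 * real J"
    if A: "a \<le> H - h" "0 \<le> h" "H \<le> b" "0 < \<eta>" "1 \<le> J" for H h \<eta> J
  proof -
    define \<eta>' where "\<eta>' = \<eta> * real J powr (- h)"
    have \<eta>': "0 < \<eta>'" using A by (simp add: \<eta>'_def)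
    define t where "t = (\<lambda>i. (fbm_amp H \<eta> i - fbm_amp (H - h) \<eta>' i)\<^sup>2 / ((fbm_amp H \<eta> i)\<^sup>2 + (fbm_amp (H - h) \<eta>' i)\<^sup>2))"
    have J: "1 \<le> real J" using A by simp
    \<comment> \<open>With \<delta> = 1/4 the squared logarithm becomes (J/x)^(1/2), whose sum over
      x up to J is still of order J.\<close>
    have base: "(h * (\<bar>ln (x / real J)\<bar> + M))\<^sup>2 \<le> h\<^sup>2 * ((4 + M)\<^sup>2 * (real J / x) powr (1 / 2))" if "1 \<le> x" "x \<le> real J" for x
    proof -
      have "\<bar>ln (x / real J)\<bar> = ln (real J / x)" using that by (simp add: ln_div)
      then show ?thesis
        using log_square_le[of "real J / x" "1 / 4" M] that M
        by (simp add: power_mult_distrib mult_left_mono)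
    qed
    have t0: "t 0 \<le> h\<^sup>2 * ((4 + M)\<^sup>2 * real J)"
    proof -
      have p: "0 < \<eta> * sqrt H" "0 < \<eta>' * sqrt (H - h)" using A ab \<eta>' by auto
      have "\<bar>ln (\<eta> * sqrt H) - ln (\<eta>' * sqrt (H - h))\<bar> \<le> h * (\<bar>ln (1 / real J)\<bar> + M)"
      proof -
        have Hh: "0 < H - h" "0 < H" using A ab by auto
        have "ln (\<eta> * sqrt H) - ln (\<eta>' * sqrt (H - h)) = h * ln (real J) + (ln H - ln (H - h)) / 2"
          unfolding \<eta>'_def using A Hh by (simp add: ln_mult ln_sqrt ln_powr diff_divide_distrib)
        moreover have "0 \<le> ln H - ln (H - h)" using Hh A by simp
        moreover have "ln H - ln (H - h) \<le> h * M"
        proof -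
          have "ln H - ln (H - h) = ln (H / (H - h))" using Hh by (simp add: ln_div)
          also have "\<dots> \<le> H / (H - h) - 1" using Hh by (intro ln_le_minus_one) simp
          also have "\<dots> = h * (1 / (H - h))" using Hh by (simp add: field_simps)
          also have "\<dots> \<le> h * (1 / a)" using A ab by (intro mult_left_mono divide_left_mono) auto
          also have "\<dots> \<le> h * M" using A M by (intro mult_left_mono) auto
          finally show ?thesis .
        qed
        moreover have "0 \<le> h * ln (real J)" using A J by simp
        moreover have "\<bar>ln (1 / real J)\<bar> = ln (real J)" using J by (simp add: ln_div)
        ultimately show ?thesis by (simp add: distrib_left)
      qed
      then have "(ln (\<eta> * sqrt H) - ln (\<eta>' * sqrt (H - h)))\<^sup>2 \<le> (h * (\<bar>ln (1 / real J)\<bar> + M))\<^sup>2"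
        using abs_le_square_iff[of "ln (\<eta> * sqrt H) - ln (\<eta>' * sqrt (H - h))" "h * (\<bar>ln (1 / real J)\<bar> + M)"] A M by simp
      also have "\<dots> \<le> h\<^sup>2 * ((4 + M)\<^sup>2 * real J powr (1 / 2))" using base[of 1] J by simp
      also have "\<dots> \<le> h\<^sup>2 * ((4 + M)\<^sup>2 * real J powr 1)" using J by (intro mult_left_mono powr_mono) auto
      finally show ?thesis
        using relative_square_le'(1)[OF p] J unfolding t_def by (simp add: fbm_amp_def)
    qed
    have tm: "(\<eta> * sqrt (fbm_fourier (Suc m) H / 2) - \<eta>' * sqrt (fbm_fourier (Suc m) (H - h) / 2))\<^sup>2
          / ((\<eta> * sqrt (fbm_fourier (Suc m) H / 2))\<^sup>2 + (\<eta>' * sqrt (fbm_fourier (Suc m) (H - h) / 2))\<^sup>2)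
        \<le> h\<^sup>2 * (4 + M)\<^sup>2 * sqrt (real J) * real (Suc m) powr (- 1 / 2)" if m: "m < J" for m
    proof -
      have p: "0 < \<eta> * sqrt (fbm_fourier (Suc m) H / 2)" "0 < \<eta>' * sqrt (fbm_fourier (Suc m) (H - h) / 2)"
        using CL(3)[of "Suc m"] A \<eta>' by auto
      have "(ln (\<eta> * sqrt (fbm_fourier (Suc m) H / 2)) - ln (\<eta>' * sqrt (fbm_fourier (Suc m) (H - h) / 2)))\<^sup>2
          \<le> (h * (\<bar>ln (real (Suc m) / real J)\<bar> + M))\<^sup>2"
        using log_ratio[OF A, of m] A M unfolding \<eta>'_def[symmetric]
        by (intro abs_le_square_iff[THEN iffD1]) simp
      also have "\<dots> \<le> h\<^sup>2 * ((4 + M)\<^sup>2 * (real J / real (Suc m)) powr (1 / 2))"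
        using m by (intro base) auto
      also have "(real J / real (Suc m)) powr (1 / 2) = sqrt (real J) * real (Suc m) powr (- 1 / 2)"
        by (simp add: powr_divide powr_minus_divide powr_half_sqrt)
      finally show ?thesis using relative_square_le'(1)[OF p] by (simp add: mult.assoc)
    qed
    have "(\<Sum>i\<le>2 * J. t i) \<le> h\<^sup>2 * ((4 + M)\<^sup>2 * real J)
        + (\<Sum>m<J. 2 * (h\<^sup>2 * (4 + M)\<^sup>2 * sqrt (real J)) * real (Suc m) powr (- 1 / 2))"
      unfolding sum_up_to_even
    proof (intro add_mono sum_mono t0)
      fix m assume "m \<in> {..<J}"
      with tm[of m] show "t (2 * m + 1) + t (2 * m + 2) \<le> 2 * (h\<^sup>2 * (4 + M)\<^sup>2 * sqrt (real J)) * real (Suc m) powr (- 1 / 2)"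
        unfolding t_def fbm_amp_odd fbm_amp_even by simp
    qed
    also have "\<dots> = h\<^sup>2 * ((4 + M)\<^sup>2 * real J) + 2 * (h\<^sup>2 * (4 + M)\<^sup>2 * sqrt (real J)) * (\<Sum>m<J. real (Suc m) powr (- 1 / 2))"
      by (simp add: sum_distrib_left)
    also have "\<dots> \<le> h\<^sup>2 * ((4 + M)\<^sup>2 * real J) + 2 * (h\<^sup>2 * (4 + M)\<^sup>2 * sqrt (real J)) * (2 * sqrt (real J))"
      by (intro add_left_mono mult_left_mono sum_powr_half_le) auto
    also have "\<dots> = C2 * h\<^sup>2 * real J" by (simp add: C2_def)
    finally show ?thesis by (simp add: t_def \<eta>'_def)
  qed
  \<comment> \<open>Here \<delta> = a/4. The 4 is made of the two amplitudes in the absolute error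
    bound and the two coefficients per frequency; 1/a bounds 1/(2 H - a), as H is at least
    a.\<close>
  define C3 where "C3 = 4 * C * (4 / a + M)\<^sup>2 / a"
  have high: "(\<Sum>i\<in>{2 * J<..2 * (J + K)}. (fbm_amp H \<eta> i - fbm_amp (H - h) (\<eta> * real J powr (- h)) i)\<^sup>2)
        \<le> C3 * \<eta>\<^sup>2 * h\<^sup>2 * real J powr (- 2 * H)"
    if A: "a \<le> H - h" "0 \<le> h" "H \<le> b" "0 < \<eta>" "1 \<le> J" and h4: "4 * h \<le> a" for H h \<eta> J K
  proof -
    define \<eta>' where "\<eta>' = \<eta> * real J powr (- h)"
    have \<eta>': "0 < \<eta>'" using A by (simp add: \<eta>'_def)
    have J: "1 \<le> real J" using A by simp
    define B where "B = 2 * C * \<eta>\<^sup>2 * h\<^sup>2 * (4 / a + M)\<^sup>2"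
    have B: "0 \<le> B" using CL by (simp add: B_def)
    have tm: "(\<eta> * sqrt (fbm_fourier (Suc m) H / 2) - \<eta>' * sqrt (fbm_fourier (Suc m) (H - h) / 2))\<^sup>2
        \<le> B * (real J powr (- a) * real (Suc m) powr (- (2 * H - a) - 1))" if m: "J \<le> m" for m
    proof -
      define x where "x = real (Suc m) / real J"
      have x: "1 \<le> x" using m J by (simp add: x_def)
      have p: "0 < \<eta> * sqrt (fbm_fourier (Suc m) H / 2)" "0 < \<eta>' * sqrt (fbm_fourier (Suc m) (H - h) / 2)"
        using CL(3)[of "Suc m"] A \<eta>' by auto
      have "(ln (\<eta> * sqrt (fbm_fourier (Suc m) H / 2)) - ln (\<eta>' * sqrt (fbm_fourier (Suc m) (H - h) / 2)))\<^sup>2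
          \<le> (h * (\<bar>ln x\<bar> + M))\<^sup>2"
        using log_ratio[OF A, of m] A M unfolding \<eta>'_def[symmetric] x_def
        by (intro abs_le_square_iff[THEN iffD1]) simp
      also have "\<dots> \<le> h\<^sup>2 * ((4 / a + M)\<^sup>2 * x powr (a / 2))"
        using log_square_le[of x "a / 4" M] x M ab by (simp add: power_mult_distrib mult_left_mono)
      finally have 1: "(ln (\<eta> * sqrt (fbm_fourier (Suc m) H / 2)) - ln (\<eta>' * sqrt (fbm_fourier (Suc m) (H - h) / 2)))\<^sup>2
          \<le> h\<^sup>2 * (4 / a + M)\<^sup>2 * x powr (a / 2)" by (simp add: mult.assoc)
      define y where "y = real (Suc m) powr (- 2 * H - 1)"
      have 2: "(\<eta> * sqrt (fbm_fourier (Suc m) H / 2))\<^sup>2 \<le> \<eta>\<^sup>2 * C * (y * x powr (a / 2))"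
      proof -
        have "(\<eta> * sqrt (fbm_fourier (Suc m) H / 2))\<^sup>2 \<le> \<eta>\<^sup>2 * C * y" unfolding y_def using A by (intro amp2) auto
        also have "\<dots> \<le> \<eta>\<^sup>2 * C * (y * x powr (a / 2))"
          using x ab CL ge_one_powr_ge_zero[of x "a / 2"] by (intro mult_left_mono) (auto simp: y_def mult_le_cancel_left1)
        finally show ?thesis .
      qed
      \<comment> \<open>Lowering H to H - h and rescaling by J^(-h) multiplies the variance bound by
        (m/J)^(2h), with m the frequency; 4 h \<le> a keeps this below (m/J)^(a/2).\<close>
      have 3: "(\<eta>' * sqrt (fbm_fourier (Suc m) (H - h) / 2))\<^sup>2 \<le> \<eta>\<^sup>2 * C * (y * x powr (a / 2))"
      proof -
        have "(\<eta>' * sqrt (fbm_fourier (Suc m) (H - h) / 2))\<^sup>2 \<le> \<eta>'\<^sup>2 * C * real (Suc m) powr (- 2 * (H - h) - 1)"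
          using A by (intro amp2) auto
        also have "\<eta>'\<^sup>2 = \<eta>\<^sup>2 * real J powr (- 2 * h)"
          unfolding \<eta>'_def power_mult_distrib power2_eq_square[of "_ powr _"] powr_add[symmetric] by simp
        also have "real (Suc m) powr (- 2 * (H - h) - 1) = y * real (Suc m) powr (2 * h)"
          unfolding y_def powr_add[symmetric] by (simp add: algebra_simps)
        also have "\<eta>\<^sup>2 * real J powr (- 2 * h) * C * (y * real (Suc m) powr (2 * h)) = \<eta>\<^sup>2 * C * (y * x powr (2 * h))"
          using J by (simp add: x_def powr_divide powr_minus_divide)
        also have "\<dots> \<le> \<eta>\<^sup>2 * C * (y * x powr (a / 2))"
          using x h4 CL by (intro mult_left_mono powr_mono) (auto simp: y_def)
        finally show ?thesis .
      qed
      \<comment> \<open>The logarithm and the perturbed decay each cost x^(a/2). After the total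
        loss x^a the tail exponent 2 H - a is still at least a, so the series converges with the
        right power of J.\<close>
      have "(\<eta> * sqrt (fbm_fourier (Suc m) H / 2) - \<eta>' * sqrt (fbm_fourier (Suc m) (H - h) / 2))\<^sup>2
          \<le> (h\<^sup>2 * (4 / a + M)\<^sup>2 * x powr (a / 2)) * (\<eta>\<^sup>2 * C * (y * x powr (a / 2)) + \<eta>\<^sup>2 * C * (y * x powr (a / 2)))"
        using relative_square_le'(2)[OF p] by (rule order_trans) (intro mult_mono 1 add_mono 2 3, auto)
      also have "\<dots> = B * (y * (x powr (a / 2) * x powr (a / 2)))"
        by (simp add: B_def algebra_simps)
      also have "x powr (a / 2) * x powr (a / 2) = real (Suc m) powr a * real J powr (- a)"
        unfolding powr_add[symmetric] using J by (simp add: x_def powr_divide powr_minus_divide)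
      also have "y * (real (Suc m) powr a * real J powr (- a)) = real J powr (- a) * real (Suc m) powr (- (2 * H - a) - 1)"
      proof -
        have "- (2 * H - a) - 1 = (- 2 * H - 1) + a" by simp
        then show ?thesis unfolding y_def by (simp only: powr_add) (simp only: mult_ac)
      qed
      finally show ?thesis .
    qed
    have "(\<Sum>i\<in>{2 * J<..2 * (J + K)}. (fbm_amp H \<eta> i - fbm_amp (H - h) \<eta>' i)\<^sup>2)
        \<le> (\<Sum>m\<in>{J..<J + K}. 2 * (B * real J powr (- a)) * real (Suc m) powr (- (2 * H - a) - 1))"
      unfolding sum_even_tail fbm_amp_odd fbm_amp_even using tm by (intro sum_mono) (auto simp: mult.assoc)
    also have "\<dots> = 2 * (B * real J powr (- a)) * (\<Sum>m\<in>{J..<J + K}. real (Suc m) powr (- (2 * H - a) - 1))"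
      by (simp add: sum_distrib_left)
    also have "\<dots> \<le> 2 * (B * real J powr (- a)) * (real J powr (- (2 * H - a)) / (2 * H - a))"
      using B A ab by (intro mult_left_mono sum_powr_tail_le) auto
    also have "\<dots> \<le> 2 * (B * real J powr (- a)) * (real J powr (- (2 * H - a)) / a)"
      using B A ab by (intro mult_left_mono divide_left_mono) auto
    also have "\<dots> = 2 * B / a * (real J powr (- a) * real J powr (- (2 * H - a)))" by simp
    also have "real J powr (- a) * real J powr (- (2 * H - a)) = real J powr (- 2 * H)"
      unfolding powr_add[symmetric] by simp
    also have "2 * B / a * real J powr (- 2 * H) = C3 * \<eta>\<^sup>2 * h\<^sup>2 * real J powr (- 2 * H)"
      by (simp add: B_def C3_def)
    finally show ?thesis by (simp add: \<eta>'_def)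
  qed
  define C1 where "C1 = 1 + 2 * C * (1 + 1 / (2 * a))"
  have C: "0 < C1" "0 \<le> C2" "0 \<le> C3" using CL(1) ab by (auto simp: C1_def C2_def C3_def intro!: add_pos_nonneg)
  show ?thesis
  proof (rule that[of "C1 + C2 + C3"])
    show "0 < C1 + C2 + C3" using C by simp
    show "fbm_regular H" if "a \<le> H" "H \<le> b" for H by (rule regular[OF that])
    show "(\<Sum>i\<le>2 * K. (fbm_amp H \<eta> i)\<^sup>2) \<le> (C1 + C2 + C3) * \<eta>\<^sup>2" if "a \<le> H" "H \<le> b" "0 < \<eta>" for H \<eta> K
      using C by (intro order_trans[OF energy[OF that, folded C1_def]] mult_right_mono) auto
    show "(\<Sum>i\<le>2 * J. (fbm_amp H \<eta> i - fbm_amp (H - h) (\<eta> * real J powr (- h)) i)\<^sup>2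
         / ((fbm_amp H \<eta> i)\<^sup>2 + (fbm_amp (H - h) (\<eta> * real J powr (- h)) i)\<^sup>2)) \<le> (C1 + C2 + C3) * h\<^sup>2 * real J"
      if "a \<le> H - h" "0 \<le> h" "H \<le> b" "0 < \<eta>" "1 \<le> J" for H h \<eta> J
      using C by (intro order_trans[OF low[OF that]] mult_right_mono) auto
    show "(\<Sum>i\<in>{2 * J<..2 * (J + K)}. (fbm_amp H \<eta> i - fbm_amp (H - h) (\<eta> * real J powr (- h)) i)\<^sup>2)
        \<le> (C1 + C2 + C3) * \<eta>\<^sup>2 * h\<^sup>2 * real J powr (- 2 * H)"
      if "a \<le> H - h" "0 \<le> h" "4 * h \<le> a" "H \<le> b" "0 < \<eta>" "1 \<le> J" for H h \<eta> J K
      using C that by (intro order_trans[OF high] mult_right_mono) auto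
  qed
qed

section \<open>The rough volatility model\<close>

text \<open>The defining property of the process speaks of sums over sets of distinct times. Here
  the times form a family with possible repetitions, so coefficients belonging to the same time are
  added first.\<close>

lemma gaussian_process_iexp:
  assumes X: "centered_gaussian_process M T X C" and K: "finite K" and \<tau>: "\<And>k. k \<in> K \<Longrightarrow> \<tau> k \<in> T"
  shows "(\<integral>\<omega>. iexp (\<Sum>k\<in>K. c k * X (\<tau> k) \<omega>) \<partial>M)
    = complex_of_real (exp (- (\<Sum>k\<in>K. \<Sum>l\<in>K. c k * c l * C (\<tau> k) (\<tau> l)) / 2))"
proof -
  define a where "a = (\<lambda>t. \<Sum>k\<in>{k\<in>K. \<tau> k = t}. c k)"
  define J where "J = \<tau> ` K"
  have J: "finite J" "J \<subseteq> T" using K \<tau> by (auto simp: J_def)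
  have group: "(\<Sum>t\<in>J. a t * f t) = (\<Sum>k\<in>K. c k * f (\<tau> k))" for f :: "_ \<Rightarrow> real"
  proof -
    have "(\<Sum>t\<in>J. a t * f t) = (\<Sum>t\<in>J. \<Sum>k\<in>{k\<in>K. \<tau> k = t}. c k * f (\<tau> k))"
      unfolding a_def sum_distrib_right by (intro sum.cong) auto
    also have "\<dots> = (\<Sum>k\<in>K. c k * f (\<tau> k))"
      by (rule sum.group[OF K J(1)]) (simp add: J_def)
    finally show ?thesis .
  qed
  have [measurable]: "X t \<in> borel_measurable M" if "t \<in> T" for t
    using X that by (auto simp: centered_gaussian_process_def)
  have Y: "(\<lambda>\<omega>. \<Sum>t\<in>J. a t * X t \<omega>) \<in> borel_measurable M"
    using J(2) by (intro borel_measurable_sum borel_measurable_times borel_measurable_const) auto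
  have "char (distr M borel (\<lambda>\<omega>. \<Sum>t\<in>J. a t * X t \<omega>)) 1
      = complex_of_real (exp (- (1\<^sup>2 * (\<Sum>i\<in>J. \<Sum>j\<in>J. a i * a j * C i j)) / 2))"
    using X J unfolding centered_gaussian_process_def by blast
  moreover have "char (distr M borel (\<lambda>\<omega>. \<Sum>t\<in>J. a t * X t \<omega>)) 1 = (\<integral>\<omega>. iexp (\<Sum>t\<in>J. a t * X t \<omega>) \<partial>M)"
    unfolding char_def by (subst integral_distr[OF Y]) auto
  moreover have "(\<Sum>i\<in>J. \<Sum>j\<in>J. a i * a j * C i j) = (\<Sum>k\<in>K. \<Sum>l\<in>K. c k * c l * C (\<tau> k) (\<tau> l))"
  proof -
    have "(\<Sum>i\<in>J. \<Sum>j\<in>J. a i * a j * C i j) = (\<Sum>i\<in>J. a i * (\<Sum>j\<in>J. a j * C i j))"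
      by (simp add: sum_distrib_left mult.assoc)
    also have "\<dots> = (\<Sum>k\<in>K. c k * (\<Sum>l\<in>K. c l * C (\<tau> k) (\<tau> l)))"
      unfolding group by simp
    finally show ?thesis by (simp add: sum_distrib_left mult.assoc)
  qed
  ultimately show ?thesis by (simp add: group)
qed

lemma brownian_increments_iexp:
  assumes B: "brownian_motion M B" and G: "0 < G"
  shows "(\<integral>\<omega>. iexp (\<Sum>k<G. c k * (B (real (Suc k) / real G) \<omega> - B (real k / real G) \<omega>)) \<partial>M)
    = complex_of_real (exp (- (\<Sum>k<G. (c k)\<^sup>2 / real G) / 2))"
proof -
  \<comment> \<open>Every increment is split into its two end points, marked by a Boolean.
    Neighbouring cells share a time, a repetition that \<open>gaussian_process_iexp\<close>
    permits.\<close>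
  define K where "K = {..<G} \<times> (UNIV :: bool set)"
  define \<tau> where "\<tau> = (\<lambda>(k, b). if b then real (Suc k) / real G else real k / real G)"
  define d where "d = (\<lambda>(k, b). if b then c k else - c k)"
  have sumK: "(\<Sum>p\<in>K. f p) = (\<Sum>k<G. f (k, True) + f (k, False))" for f :: "nat \<times> bool \<Rightarrow> real"
  proof -
    have "(\<Sum>p\<in>K. f p) = (\<Sum>k<G. \<Sum>b\<in>UNIV. f (k, b))" unfolding K_def by (simp add: sum.cartesian_product)
    then show ?thesis by (simp add: UNIV_bool add.commute)
  qed
  have gp: "centered_gaussian_process M {0..} B min" using B by (simp add: brownian_motion_def)
  have "(\<integral>\<omega>. iexp (\<Sum>p\<in>K. d p * B (\<tau> p) \<omega>) \<partial>M)
      = complex_of_real (exp (- (\<Sum>p\<in>K. \<Sum>q\<in>K. d p * d q * min (\<tau> p) (\<tau> q)) / 2))"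
    by (rule gaussian_process_iexp[OF gp]) (auto simp: K_def \<tau>_def)
  moreover have "(\<Sum>p\<in>K. d p * B (\<tau> p) \<omega>) = (\<Sum>k<G. c k * (B (real (Suc k) / real G) \<omega> - B (real k / real G) \<omega>))" for \<omega>
    unfolding sumK by (simp add: d_def \<tau>_def right_diff_distrib)
  moreover have "(\<Sum>p\<in>K. \<Sum>q\<in>K. d p * d q * min (\<tau> p) (\<tau> q)) = (\<Sum>k<G. (c k)\<^sup>2 / real G)"
  proof -
    \<comment> \<open>The mixed second difference of min is 1/G on the diagonal and 0 elsewhere:
      increments over disjoint cells are uncorrelated.\<close>
    have mins: "min (real (Suc k) / real G) (real (Suc l) / real G) - min (real (Suc k) / real G) (real l / real G)
        - min (real k / real G) (real (Suc l) / real G) + min (real k / real G) (real l / real G)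
        = (if k = l then 1 / real G else 0)" for k l
    proof -
      have m: "min (real i / real G) (real j / real G) = real (min i j) / real G" for i j
        using G by (simp add: min_def divide_le_cancel)
      have "real (min (Suc k) (Suc l)) - real (min (Suc k) l) - real (min k (Suc l)) + real (min k l) = (if k = l then 1 else 0)"
        by (auto simp: min_def)
      then have "(real (min (Suc k) (Suc l)) - real (min (Suc k) l) - real (min k (Suc l)) + real (min k l)) / real G
          = (if k = l then 1 / real G else 0)" by simp
      then show ?thesis unfolding m by (simp only: add_divide_distrib diff_divide_distrib)
    qed
    have "(\<Sum>p\<in>K. \<Sum>q\<in>K. d p * d q * min (\<tau> p) (\<tau> q))
        = (\<Sum>k<G. \<Sum>l<G. c k * c l * (min (real (Suc k) / real G) (real (Suc l) / real G) - min (real (Suc k) / real G) (real l / real G)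
        - min (real k / real G) (real (Suc l) / real G) + min (real k / real G) (real l / real G)))"
      unfolding sumK sum.distrib[symmetric] by (intro sum.cong refl) (simp add: d_def \<tau>_def algebra_simps)
    also have "\<dots> = (\<Sum>k<G. \<Sum>l<G. if k = l then c k * c k / real G else 0)"
      unfolding mins by (intro sum.cong refl) auto
    finally show ?thesis by (simp add: power2_eq_square)
  qed
  ultimately show ?thesis by simp
qed

definition vol_grid_law :: "'a measure \<Rightarrow> real \<Rightarrow> (real \<Rightarrow> 'a \<Rightarrow> real) \<Rightarrow> nat \<Rightarrow> (nat \<Rightarrow> real) measure" where
  "vol_grid_law M \<eta> W G = distr M (PiM {..<G} (\<lambda>_. borel)) (\<lambda>\<omega>. \<lambda>k\<in>{..<G}. \<eta> * W (real k / real G) \<omega>)"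

lemma rough_vol_modelD:
  assumes "rough_vol_model M H \<eta> S0 B W S"
  shows "prob_space M" "brownian_motion M B" "centered_gaussian_process M {0..} W (fbm_cov H)"
    "\<And>t. 0 \<le> t \<Longrightarrow> B t \<in> borel_measurable M" "\<And>t. 0 \<le> t \<Longrightarrow> W t \<in> borel_measurable M" "\<And>t. 0 \<le> t \<Longrightarrow> S t \<in> borel_measurable M"
  using assms
  by (auto simp: rough_vol_model_def brownian_motion_def fractional_brownian_motion_def centered_gaussian_process_def)

lemma vol_grid_law:
  assumes R: "rough_vol_model M H \<eta> S0 B W S"
  shows "fbm_grid_law H \<eta> G (vol_grid_law M \<eta> W G)"
proof -
  note m = rough_vol_modelD[OF R]
  interpret prob_space M by (rule m(1))
  have meas: "(\<lambda>\<omega>. \<lambda>k\<in>{..<G}. \<eta> * W (real k / real G) \<omega>) \<in> measurable M (PiM {..<G} (\<lambda>_. borel))"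
    using m(5) by (intro measurable_restrict borel_measurable_times) auto
  have "vchar {..<G} (vol_grid_law M \<eta> W G) u = complex_of_real
     (exp (- (\<eta>\<^sup>2 * (\<Sum>k<G. \<Sum>l<G. u k * u l * fbm_cov H (real k / real G) (real l / real G))) / 2))" for u
  proof -
    have "vchar {..<G} (vol_grid_law M \<eta> W G) u = (\<integral>\<omega>. iexp (\<Sum>k<G. (u k * \<eta>) * W (real k / real G) \<omega>) \<partial>M)"
      unfolding vchar_def vol_grid_law_def by (subst integral_distr[OF meas]) (auto simp: mult.assoc)
    also have "\<dots> = complex_of_real (exp (- (\<Sum>k<G. \<Sum>l<G. (u k * \<eta>) * (u l * \<eta>) * fbm_cov H (real k / real G) (real l / real G)) / 2))"
      by (rule gaussian_process_iexp[OF m(3)]) auto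
    also have "(\<Sum>k<G. \<Sum>l<G. (u k * \<eta>) * (u l * \<eta>) * fbm_cov H (real k / real G) (real l / real G))
        = \<eta>\<^sup>2 * (\<Sum>k<G. \<Sum>l<G. u k * u l * fbm_cov H (real k / real G) (real l / real G))"
      by (simp add: sum_distrib_left power2_eq_square mult_ac)
    finally show ?thesis .
  qed
  moreover have "prob_vec {..<G} (vol_grid_law M \<eta> W G)"
    unfolding prob_vec_def vol_grid_law_def using prob_space_distr[OF meas] by simp
  ultimately show ?thesis by (simp add: fbm_grid_law_def)
qed

section \<open>Conditioning on the volatility path\<close>

lemma div_block: "k \<in> block g j \<Longrightarrow> k div g = j"
proof -
  assume "k \<in> block g j"
  then have "j * g \<le> k" "k < Suc j * g" by (auto simp: block_def)
  then show ?thesis by (intro div_nat_eqI) (auto simp: mult.commute)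
qed

text \<open>Given the volatility path, the left-point sums over the blocks are independent centred
  Gaussians with variances \<open>block_var\<close>. Integrating their conditional characteristic
  function over the path gives that of \<open>data_law\<close>.\<close>

lemma riemann_increments_vchar:
  assumes R: "rough_vol_model M H \<eta> S0 B W S" and n: "0 < n" and g: "0 < g"
  shows "(\<integral>\<omega>. iexp (\<Sum>j<n. u j * (\<Sum>k\<in>block g j. sqrt (exp (\<eta> * W (real k / real (n * g)) \<omega>))
      * (B (real (Suc k) / real (n * g)) \<omega> - B (real k / real (n * g)) \<omega>))) \<partial>M)
    = vchar {..<n} (data_law n g (vol_grid_law M \<eta> W (n * g))) u"
proof -
  note m = rough_vol_modelD[OF R]
  interpret prob_space M by (rule m(1))
  define G where "G = n * g"
  have G: "0 < G" using n g by (simp add: G_def)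
  have meas: "(\<lambda>\<omega>. \<lambda>k\<in>{..<G}. \<eta> * W (real k / real G) \<omega>) \<in> measurable M (PiM {..<G} (\<lambda>_. borel))"
    using m(5) by (intro measurable_restrict borel_measurable_times) auto
  define PB where "PB = distr M (PiM {0..} (\<lambda>_. borel)) (\<lambda>\<omega>. \<lambda>t\<in>{0..}. B t \<omega>)"
  define PW where "PW = distr M (PiM {0..} (\<lambda>_. borel)) (\<lambda>\<omega>. \<lambda>t\<in>{0..}. W t \<omega>)"
  have mB[measurable]: "(\<lambda>\<omega>. \<lambda>t\<in>{0..}. B t \<omega>) \<in> measurable M (PiM {0..} (\<lambda>_. borel))"
    and mW[measurable]: "(\<lambda>\<omega>. \<lambda>t\<in>{0..}. W t \<omega>) \<in> measurable M (PiM {0..} (\<lambda>_. borel))"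
    using m(4,5) by (auto intro!: measurable_restrict)
  \<comment> \<open>Independence of the two whole paths makes their joint law a product, so the
    integral over \<open>B\<close> can be taken first with the volatility path frozen.\<close>
  have indep: "distr M (PiM {0..} (\<lambda>_. borel) \<Otimes>\<^sub>M PiM {0..} (\<lambda>_. borel)) (\<lambda>\<omega>. (\<lambda>t\<in>{0..}. B t \<omega>, \<lambda>t\<in>{0..}. W t \<omega>)) = PB \<Otimes>\<^sub>M PW"
    using R unfolding rough_vol_model_def PB_def PW_def indep_var_distribution_eq by simp
  have pB: "prob_space PB" and pW: "prob_space PW" unfolding PB_def PW_def by (auto intro!: prob_space_distr mB mW)
  have [measurable_cong]: "sets PB = sets (PiM {0..} (\<lambda>_. borel))" "sets PW = sets (PiM {0..} (\<lambda>_. borel))"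
    by (auto simp: PB_def PW_def)
  define f :: "(real \<Rightarrow> real) \<Rightarrow> (real \<Rightarrow> real) \<Rightarrow> complex" where
    "f = (\<lambda>b w. iexp (\<Sum>k<G. u (k div g) * sqrt (exp (\<eta> * w (real k / real G))) * (b (real (Suc k) / real G) - b (real k / real G))))"
  have ind: "real k / real G \<in> {0..}" for k by simp
  have comp[measurable]: "(\<lambda>b. b (real k / real G)) \<in> borel_measurable (PiM {0..} (\<lambda>_. borel :: real measure))" for k
    by (rule measurable_component_singleton[OF ind])
  have f[measurable]: "case_prod f \<in> borel_measurable (PB \<Otimes>\<^sub>M PW)"
    unfolding f_def split_beta' by measurable
  have f1: "norm (f b w) \<le> 1" for b w by (simp add: f_def)
  have "(\<integral>\<omega>. iexp (\<Sum>j<n. u j * (\<Sum>k\<in>block g j. sqrt (exp (\<eta> * W (real k / real G) \<omega>))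
      * (B (real (Suc k) / real G) \<omega> - B (real k / real G) \<omega>))) \<partial>M)
      = (\<integral>\<omega>. case_prod f (\<lambda>t\<in>{0..}. B t \<omega>, \<lambda>t\<in>{0..}. W t \<omega>) \<partial>M)"
  proof (rule Bochner_Integration.integral_cong[OF refl])
    fix \<omega>
    have "(\<Sum>j<n. u j * (\<Sum>k\<in>block g j. sqrt (exp (\<eta> * W (real k / real G) \<omega>)) * (B (real (Suc k) / real G) \<omega> - B (real k / real G) \<omega>)))
        = (\<Sum>j<n. \<Sum>k\<in>block g j. u (k div g) * sqrt (exp (\<eta> * W (real k / real G) \<omega>)) * (B (real (Suc k) / real G) \<omega> - B (real k / real G) \<omega>))"
      unfolding sum_distrib_left by (intro sum.cong refl) (simp add: div_block mult.assoc)
    then show "iexp (\<Sum>j<n. u j * (\<Sum>k\<in>block g j. sqrt (exp (\<eta> * W (real k / real G) \<omega>))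
      * (B (real (Suc k) / real G) \<omega> - B (real k / real G) \<omega>))) = case_prod f (\<lambda>t\<in>{0..}. B t \<omega>, \<lambda>t\<in>{0..}. W t \<omega>)"
      unfolding sum_blocks f_def G_def[symmetric] by simp
  qed
  also have "\<dots> = (\<integral>p. case_prod f p \<partial>(PB \<Otimes>\<^sub>M PW))"
    unfolding indep[symmetric] by (subst integral_distr) (use f in \<open>auto simp: indep[symmetric] cong: measurable_cong_sets\<close>)
  also have "\<dots> = (\<integral>w. \<integral>b. f b w \<partial>PB \<partial>PW)"
  proof -
    interpret pair_sigma_finite PB PW by (rule pair_sigma_finite_prob[OF pB pW])
    have "integrable (PB \<Otimes>\<^sub>M PW) (case_prod f)"
      using f1 by (intro integrable_pair_bounded[OF pB pW f, where K=1]) auto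
    then show ?thesis by (rule integral_snd[symmetric])
  qed
  also have "\<dots> = (\<integral>w. complex_of_real (exp (- (\<Sum>k<G. (u (k div g))\<^sup>2 * exp (\<eta> * w (real k / real G)) / real G) / 2)) \<partial>PW)"
  proof (rule Bochner_Integration.integral_cong[OF refl])
    fix w
    have "(\<integral>b. f b w \<partial>PB) = (\<integral>\<omega>. f (\<lambda>t\<in>{0..}. B t \<omega>) w \<partial>M)"
      unfolding PB_def by (rule integral_distr[OF mB]) (unfold f_def, measurable)
    also have "\<dots> = (\<integral>\<omega>. iexp (\<Sum>k<G. (u (k div g) * sqrt (exp (\<eta> * w (real k / real G)))) * (B (real (Suc k) / real G) \<omega> - B (real k / real G) \<omega>)) \<partial>M)"
      by (simp add: f_def)
    also have "\<dots> = complex_of_real (exp (- (\<Sum>k<G. (u (k div g) * sqrt (exp (\<eta> * w (real k / real G))))\<^sup>2 / real G) / 2))"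
      by (rule brownian_increments_iexp[OF m(2) G])
    finally show "(\<integral>b. f b w \<partial>PB) = complex_of_real (exp (- (\<Sum>k<G. (u (k div g))\<^sup>2 * exp (\<eta> * w (real k / real G)) / real G) / 2))"
      by (simp add: power_mult_distrib)
  qed
  also have "\<dots> = (\<integral>\<omega>. complex_of_real (exp (- (\<Sum>k<G. (u (k div g))\<^sup>2 * exp (\<eta> * W (real k / real G) \<omega>) / real G) / 2)) \<partial>M)"
    unfolding PW_def by (subst integral_distr[OF mW]) auto
  also have "\<dots> = (\<integral>\<omega>. complex_of_real (exp (- (\<Sum>j<n. (u j)\<^sup>2 * block_var n g (\<lambda>k\<in>{..<G}. \<eta> * W (real k / real G) \<omega>) j) / 2)) \<partial>M)"
  proof (rule Bochner_Integration.integral_cong[OF refl])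
    fix \<omega>
    have "(\<Sum>j<n. (u j)\<^sup>2 * block_var n g (\<lambda>k\<in>{..<G}. \<eta> * W (real k / real G) \<omega>) j)
        = (\<Sum>j<n. \<Sum>k\<in>block g j. (u (k div g))\<^sup>2 * exp (\<eta> * W (real k / real G) \<omega>) / real G)"
      unfolding block_var_def sum_divide_distrib sum_distrib_left
      using block_subset[of _ n _ g] by (intro sum.cong refl) (simp add: div_block G_def)
    then show "complex_of_real (exp (- (\<Sum>k<G. (u (k div g))\<^sup>2 * exp (\<eta> * W (real k / real G) \<omega>) / real G) / 2))
        = complex_of_real (exp (- (\<Sum>j<n. (u j)\<^sup>2 * block_var n g (\<lambda>k\<in>{..<G}. \<eta> * W (real k / real G) \<omega>) j) / 2))"
      unfolding sum_blocks G_def[symmetric] by simp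
  qed
  also have "\<dots> = vchar {..<n} (data_law n g (vol_grid_law M \<eta> W G)) u"
  proof -
    have pv: "prob_vec {..<n * g} (vol_grid_law M \<eta> W G)" using vol_grid_law[OF R, of G] by (simp add: fbm_grid_law_def G_def)
    have "(\<lambda>x. exp (- (\<Sum>j<n. (u j)\<^sup>2 * block_var n g x j) / 2)) \<in> borel_measurable (PiM {..<n * g} (\<lambda>_. borel))"
      by measurable
    from integral_distr[OF meas this[folded G_def]] show ?thesis
      unfolding data_law(3)[OF pv] unfolding vol_grid_law_def by simp
  qed
  finally show ?thesis by (simp add: G_def)
qed

section \<open>From Riemann sums to the observed increments\<close>

lemma dyadic_riemann_sum_grid:
  "dyadic_riemann_sum sig B (real i / 2 ^ N) (N + l) \<omega>
    = (\<Sum>k<i * 2 ^ l. sig (real k / real (2 ^ N * 2 ^ l)) \<omega> * (B (real (Suc k) / real (2 ^ N * 2 ^ l)) \<omega> - B (real k / real (2 ^ N * 2 ^ l)) \<omega>))"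
proof -
  \<comment> \<open>The time lies on the dyadic grid of level N + l, so the floor is exact and the
    last partial step of the Riemann sum has length zero.\<close>
  have "2 ^ (N + l) * (real i / 2 ^ N) = real (i * 2 ^ l)" by (simp add: power_add)
  then have K: "nat \<lfloor>2 ^ (N + l) * (real i / 2 ^ N)\<rfloor> = i * 2 ^ l" by (simp only: floor_of_nat nat_int)
  have "real (i * 2 ^ l) / 2 ^ (N + l) = real i / 2 ^ N" by (simp add: power_add)
  then show ?thesis
    unfolding dyadic_riemann_sum_def K Let_def by (simp add: power_add)
qed

lemma riemann_increment:
  "dyadic_riemann_sum sig B (real (Suc j) / 2 ^ N) (N + l) \<omega> - dyadic_riemann_sum sig B (real j / 2 ^ N) (N + l) \<omega>
    = (\<Sum>k\<in>block (2 ^ l) j. sig (real k / real (2 ^ N * 2 ^ l)) \<omega> * (B (real (Suc k) / real (2 ^ N * 2 ^ l)) \<omega> - B (real k / real (2 ^ N * 2 ^ l)) \<omega>))"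
proof -
  have "{..<Suc j * 2 ^ l} = {..<j * 2 ^ l} \<union> block (2 ^ l) j" "{..<j * 2 ^ l} \<inter> block (2 ^ l) j = {}"
    by (auto simp: block_def)
  then show ?thesis unfolding dyadic_riemann_sum_grid by (subst (1) \<open>{..<Suc j * 2 ^ l} = _\<close>) (simp add: sum.union_disjoint)
qed

lemma norm_iexp_diff_le: "norm (iexp a - iexp b) \<le> \<bar>a - b\<bar>"
proof -
  have "iexp a = iexp b * iexp (a - b)"
    unfolding exp_add[symmetric] by (simp add: algebra_simps)
  then have "iexp a - iexp b = iexp b * (iexp (a - b) - 1)"
    by (simp add: right_diff_distrib)
  then have "norm (iexp a - iexp b) = norm (iexp (a - b) - 1)" by (simp add: norm_mult)
  also have "\<dots> \<le> \<bar>a - b\<bar>" using iexp_approx1[of "a - b" 0] by simp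
  finally show ?thesis .
qed

definition increments_law :: "'a measure \<Rightarrow> (real \<Rightarrow> 'a \<Rightarrow> real) \<Rightarrow> nat \<Rightarrow> (nat \<Rightarrow> real) measure" where
  "increments_law M S n = distr M (PiM {..<n} (\<lambda>_. borel)) (\<lambda>\<omega>. \<lambda>j\<in>{..<n}. S (real (Suc j) / real n) \<omega> - S (real j / real n) \<omega>)"

lemma increments_measurable:
  assumes R: "rough_vol_model M H \<eta> S0 B W S"
  shows "(\<lambda>\<omega>. \<lambda>j\<in>{..<n}. S (real (Suc j) / real n) \<omega> - S (real j / real n) \<omega>) \<in> measurable M (PiM {..<n} (\<lambda>_. borel))"
  using rough_vol_modelD(6)[OF R] by (intro measurable_restrict borel_measurable_diff) auto

lemma prob_vec_increments_law:
  assumes R: "rough_vol_model M H \<eta> S0 B W S"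
  shows "prob_vec {..<n} (increments_law M S n)"
proof -
  interpret prob_space M by (rule rough_vol_modelD(1)[OF R])
  show ?thesis unfolding prob_vec_def increments_law_def using prob_space_distr[OF increments_measurable[OF R]] by simp
qed

text \<open>Only the finitely many observation times matter. Where all Riemann sums are within
  \<delta> of their limits, the characters differ by at most a multiple of \<delta>; on the
  complementary event they differ by at most 2, and its probability vanishes as the mesh
  does.\<close>

lemma increments_law_limit:
  assumes R: "rough_vol_model M H \<eta> S0 B W S"
  shows "(\<lambda>l. vchar {..<2 ^ N} (data_law (2 ^ N) (2 ^ l) (vol_grid_law M \<eta> W (2 ^ N * 2 ^ l))) u)
    \<longlonglongrightarrow> vchar {..<2 ^ N} (increments_law M S (2 ^ N)) u"
proof -
  note m = rough_vol_modelD[OF R]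
  interpret prob_space M by (rule m(1))
  define sig where "sig = (\<lambda>t \<omega>. sqrt (exp (\<eta> * W t \<omega>)))"
  define E where "E = (\<lambda>l i \<omega>. dyadic_riemann_sum sig B (real i / 2 ^ N) (N + l) \<omega> - (S (real i / 2 ^ N) \<omega> - S0))"
  have sig_m: "sig t \<in> borel_measurable M" if "0 \<le> t" for t
  proof -
    have [measurable]: "W t \<in> borel_measurable M" by (rule m(5)[OF that])
    show ?thesis unfolding sig_def by measurable
  qed
  have R_m[measurable]: "(\<lambda>\<omega>. dyadic_riemann_sum sig B (real i / 2 ^ N) (N + l) \<omega>) \<in> borel_measurable M" for i l
    unfolding dyadic_riemann_sum_grid
    using m(4) by (intro borel_measurable_sum borel_measurable_times borel_measurable_diff sig_m) auto
  have S_m[measurable]: "S (real i / 2 ^ N) \<in> borel_measurable M" for i by (rule m(6)) simp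
  have E_m[measurable]: "E l i \<in> borel_measurable M" for l i unfolding E_def by measurable
  have E_lim: "(\<lambda>l. measure M {\<omega>\<in>space M. \<bar>E l i \<omega>\<bar> > \<delta>}) \<longlonglongrightarrow> 0" if "0 < \<delta>" for i \<delta>
  proof -
    have "(\<lambda>m. measure M {\<omega>\<in>space M. \<bar>dyadic_riemann_sum sig B (real i / 2 ^ N) m \<omega> - (S (real i / 2 ^ N) \<omega> - S0)\<bar> > \<delta>}) \<longlonglongrightarrow> 0"
      using R that unfolding rough_vol_model_def sig_def by simp
    from LIMSEQ_ignore_initial_segment[OF this, of N] show ?thesis by (simp add: E_def add.commute)
  qed
  define X where "X = (\<lambda>\<omega>. \<Sum>j<2 ^ N. u j * (S (real (Suc j) / 2 ^ N) \<omega> - S (real j / 2 ^ N) \<omega>))"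
  define Y where "Y = (\<lambda>l \<omega>. \<Sum>j<2 ^ N. u j * (dyadic_riemann_sum sig B (real (Suc j) / 2 ^ N) (N + l) \<omega> - dyadic_riemann_sum sig B (real j / 2 ^ N) (N + l) \<omega>))"
  have [measurable]: "X \<in> borel_measurable M" "Y l \<in> borel_measurable M" for l unfolding X_def Y_def by measurable
  have lhs: "vchar {..<2 ^ N} (data_law (2 ^ N) (2 ^ l) (vol_grid_law M \<eta> W (2 ^ N * 2 ^ l))) u = (\<integral>\<omega>. iexp (Y l \<omega>) \<partial>M)" for l
    unfolding Y_def riemann_increment sig_def
    by (rule riemann_increments_vchar[OF R, symmetric]) auto
  have rhs: "vchar {..<2 ^ N} (increments_law M S (2 ^ N)) u = (\<integral>\<omega>. iexp (X \<omega>) \<partial>M)"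
    unfolding vchar_def increments_law_def X_def
    by (subst integral_distr[OF increments_measurable[OF R]]) auto
  define U where "U = (\<Sum>j<2 ^ N. \<bar>u j\<bar>)"
  have U: "0 \<le> U" unfolding U_def by (intro sum_nonneg) auto
  have bound: "norm ((\<integral>\<omega>. iexp (Y l \<omega>) \<partial>M) - (\<integral>\<omega>. iexp (X \<omega>) \<partial>M))
      \<le> 2 * \<delta> * U + 2 * (\<Sum>i\<le>2 ^ N. measure M {\<omega>\<in>space M. \<bar>E l i \<omega>\<bar> > \<delta>})" if \<delta>: "0 < \<delta>" for l \<delta>
  proof -
    define T where "T = (\<lambda>\<omega>. 2 * \<delta> * U + 2 * (\<Sum>i\<le>2 ^ N. indicator {\<omega>\<in>space M. \<bar>E l i \<omega>\<bar> > \<delta>} \<omega>) :: real)"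
    have int: "integrable M (\<lambda>\<omega>. iexp (Z \<omega>))" if "Z \<in> borel_measurable M" for Z
      using that by (intro integrable_const_bound[where B=1]) auto
    have pt: "norm (iexp (Y l \<omega>) - iexp (X \<omega>)) \<le> T \<omega>" if \<omega>: "\<omega> \<in> space M" for \<omega>
    proof (cases "\<exists>i\<le>2 ^ N. \<bar>E l i \<omega>\<bar> > \<delta>")
      case True
      then obtain i where i: "i \<le> 2 ^ N" "\<bar>E l i \<omega>\<bar> > \<delta>" by blast
      have "norm (iexp (Y l \<omega>) - iexp (X \<omega>)) \<le> norm (iexp (Y l \<omega>)) + norm (iexp (X \<omega>))" by (rule norm_triangle_ineq4)
      also have "\<dots> = 2 * indicator {\<omega>\<in>space M. \<bar>E l i \<omega>\<bar> > \<delta>} \<omega>" using i \<omega> by simp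
      also have "\<dots> \<le> 2 * (\<Sum>i\<le>2 ^ N. indicator {\<omega>\<in>space M. \<bar>E l i \<omega>\<bar> > \<delta>} \<omega>)"
        using i(1) by (intro mult_left_mono member_le_sum) auto
      finally show ?thesis unfolding T_def using \<delta> U by (simp add: add_increasing)
    next
      case False
      then have small: "\<bar>E l i \<omega>\<bar> \<le> \<delta>" if "i \<le> 2 ^ N" for i using that by force
      have "norm (iexp (Y l \<omega>) - iexp (X \<omega>)) \<le> \<bar>Y l \<omega> - X \<omega>\<bar>" by (rule norm_iexp_diff_le)
      also have "Y l \<omega> - X \<omega> = (\<Sum>j<2 ^ N. u j * (E l (Suc j) \<omega> - E l j \<omega>))"
        unfolding X_def Y_def E_def sum_subtractf[symmetric] by (simp add: algebra_simps)
      also have "\<bar>\<dots>\<bar> \<le> (\<Sum>j<2 ^ N. \<bar>u j * (E l (Suc j) \<omega> - E l j \<omega>)\<bar>)" by (rule sum_abs)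
      also have "\<dots> \<le> (\<Sum>j<2 ^ N. \<bar>u j\<bar> * (2 * \<delta>))"
      proof (rule sum_mono)
        fix j :: nat assume "j \<in> {..<2 ^ N}"
        then have "\<bar>E l (Suc j) \<omega>\<bar> \<le> \<delta>" "\<bar>E l j \<omega>\<bar> \<le> \<delta>" by (auto intro!: small)
        then have "\<bar>E l (Suc j) \<omega> - E l j \<omega>\<bar> \<le> 2 * \<delta>" by linarith
        then show "\<bar>u j * (E l (Suc j) \<omega> - E l j \<omega>)\<bar> \<le> \<bar>u j\<bar> * (2 * \<delta>)" unfolding abs_mult by (intro mult_left_mono) auto
      qed
      also have "\<dots> = 2 * \<delta> * U" by (simp add: U_def sum_distrib_left sum_distrib_right mult_ac)
      also have "\<dots> \<le> T \<omega>" unfolding T_def by (simp add: sum_nonneg)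
      finally show ?thesis .
    qed
    have eq: "(\<integral>\<omega>. iexp (Y l \<omega>) \<partial>M) - (\<integral>\<omega>. iexp (X \<omega>) \<partial>M) = (\<integral>\<omega>. iexp (Y l \<omega>) - iexp (X \<omega>) \<partial>M)"
      by (subst Bochner_Integration.integral_diff) (auto intro!: int)
    have "norm ((\<integral>\<omega>. iexp (Y l \<omega>) \<partial>M) - (\<integral>\<omega>. iexp (X \<omega>) \<partial>M)) \<le> (\<integral>\<omega>. norm (iexp (Y l \<omega>) - iexp (X \<omega>)) \<partial>M)"
      unfolding eq by (rule Bochner_Integration.integral_norm_bound)
    also have "\<dots> \<le> (\<integral>\<omega>. T \<omega> \<partial>M)"
    proof (rule integral_mono)
      show "integrable M (\<lambda>\<omega>. norm (iexp (Y l \<omega>) - iexp (X \<omega>)))"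
        by (intro integrable_norm Bochner_Integration.integrable_diff int) auto
      show "integrable M T" unfolding T_def
        by (intro Bochner_Integration.integrable_add integrable_const integrable_mult_right Bochner_Integration.integrable_sum integrable_real_indicator)
           (auto simp: emeasure_eq_measure)
    qed (rule pt)
    also have "\<dots> = 2 * \<delta> * U + 2 * (\<Sum>i\<le>2 ^ N. measure M {\<omega>\<in>space M. \<bar>E l i \<omega>\<bar> > \<delta>})"
    proof (rule has_bochner_integral_integral_eq)
      have "has_bochner_integral M (\<lambda>_. 2 * \<delta> * U) (2 * \<delta> * U)"
        using prob_space by (simp add: has_bochner_integral_iff)
      then show "has_bochner_integral M T (2 * \<delta> * U + 2 * (\<Sum>i\<le>2 ^ N. measure M {\<omega>\<in>space M. \<bar>E l i \<omega>\<bar> > \<delta>}))"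
        unfolding T_def
        by (rule has_bochner_integral_add)
          (intro has_bochner_integral_mult_right has_bochner_integral_sum has_bochner_integral_real_indicator,
           auto simp: emeasure_eq_measure)
    qed
    finally show ?thesis .
  qed
  show ?thesis
    unfolding lhs rhs
  proof (rule LIMSEQ_I)
    fix r :: real assume r: "0 < r"
    \<comment> \<open>This puts the part of the bound that does not depend on \<open>l\<close> at
      r/2 or less; U + 1 stays positive also when all coefficients \<open>u\<close> vanish.\<close>
    define \<delta> where "\<delta> = r / 4 / (U + 1)"
    have \<delta>: "0 < \<delta>" "2 * \<delta> * U < r"
    proof -
      show "0 < \<delta>" using r U by (simp add: \<delta>_def)
      then have "2 * \<delta> * U \<le> 2 * \<delta> * (U + 1)" by (intro mult_left_mono) auto
      also have "\<dots> = r / 2"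
      proof -
        have "r / 4 / x * x = r / 4" if "x \<noteq> 0" for x :: real using that by simp
        from this[of "U + 1"] U have "\<delta> * (U + 1) = r / 4" by (simp only: \<delta>_def)
        then show ?thesis by (simp only: mult.assoc)
      qed
      finally show "2 * \<delta> * U < r" using r by simp
    qed
    have "(\<lambda>l. 2 * \<delta> * U + 2 * (\<Sum>i\<le>2 ^ N. measure M {\<omega>\<in>space M. \<bar>E l i \<omega>\<bar> > \<delta>})) \<longlonglongrightarrow> 2 * \<delta> * U + 2 * (\<Sum>i\<le>(2 :: nat) ^ N. 0)"
      by (intro tendsto_intros E_lim \<delta>)
    then have "eventually (\<lambda>l. 2 * \<delta> * U + 2 * (\<Sum>i\<le>2 ^ N. measure M {\<omega>\<in>space M. \<bar>E l i \<omega>\<bar> > \<delta>}) < r) sequentially"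
      by (rule order_tendstoD) (use \<delta> in simp)
    then obtain l0 where "\<And>l. l0 \<le> l \<Longrightarrow> 2 * \<delta> * U + 2 * (\<Sum>i\<le>2 ^ N. measure M {\<omega>\<in>space M. \<bar>E l i \<omega>\<bar> > \<delta>}) < r"
      by (auto simp: eventually_sequentially)
    then show "\<exists>l0. \<forall>l\<ge>l0. norm ((\<integral>\<omega>. iexp (Y l \<omega>) \<partial>M) - (\<integral>\<omega>. iexp (X \<omega>) \<partial>M)) < r"
      using bound[OF \<delta>(1)] by (meson le_less_trans)
  qed
qed

text \<open>The second of two nested limits: the series is already exact on each grid, and now the
  mesh tends to 0 with the bound unchanged. Continuous tests are then exchanged for Borel
  sets.\<close>

lemma increments_law_test_bound:
  assumes M: "rough_vol_model M H \<eta> S0 B W S" and M': "rough_vol_model M' H' \<eta>' S0' B' W' S'" and c: "0 < c"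
    and H: "fbm_regular H" "fbm_regular H'" and \<eta>: "0 < \<eta>" "0 < \<eta>'"
    and V: "0 < V" "\<And>K. 4 * (\<Sum>i\<in>{2 * J<..2 * (J + K)}. (fbm_amp H \<eta> i - fbm_amp H' \<eta>' i)\<^sup>2) \<le> V"
    and R: "\<And>K. 16 * (\<Sum>i\<le>2 * K. (fbm_amp H \<eta> i)\<^sup>2 + (fbm_amp H' \<eta>' i)\<^sup>2) \<le> R"
    and Q: "(\<Sum>i\<le>2 * J. (fbm_amp H \<eta> i - fbm_amp H' \<eta>' i)\<^sup>2 / ((fbm_amp H \<eta> i)\<^sup>2 + (fbm_amp H' \<eta>' i)\<^sup>2)) \<le> Q"
    and A: "A \<in> sets (PiM {..<2 ^ N} (\<lambda>_. borel))"
  shows "\<bar>measure (increments_law M S (2 ^ N)) A - measure (increments_law M' S' (2 ^ N)) A\<bar>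
    \<le> 4 * c + Q / c + 4 * real (2 ^ N) * V * exp (R + 1) / c"
proof (rule continuous_test_bound_imp_measure[OF prob_vec_increments_law[OF M] prob_vec_increments_law[OF M'] _ A])
  fix f :: "(nat \<Rightarrow> real) \<Rightarrow> real"
  assume f: "continuous_on UNIV f" "\<And>x. 0 \<le> f x \<and> f x \<le> 1"
  have pv: "prob_vec {..<2 ^ N} (data_law (2 ^ N) (2 ^ l) (vol_grid_law M \<eta> W (2 ^ N * 2 ^ l)))"
    "prob_vec {..<2 ^ N} (data_law (2 ^ N) (2 ^ l) (vol_grid_law M' \<eta>' W' (2 ^ N * 2 ^ l)))" for l
    using vol_grid_law[OF M] vol_grid_law[OF M'] by (auto intro!: data_law(1) simp: fbm_grid_law_def)
  show "\<bar>(\<integral>x. f x \<partial>increments_law M S (2 ^ N)) - (\<integral>x. f x \<partial>increments_law M' S' (2 ^ N))\<bar>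
      \<le> 4 * c + Q / c + 4 * real (2 ^ N) * V * exp (R + 1) / c"
  proof (rule test_bound_limit[OF pv(1) prob_vec_increments_law[OF M] pv(2) prob_vec_increments_law[OF M']
        increments_law_limit[OF M] increments_law_limit[OF M'] _ f])
    fix l and F :: "(nat \<Rightarrow> real) \<Rightarrow> real"
    assume F: "continuous_on UNIV F" "\<And>x. 0 \<le> F x \<and> F x \<le> 1"
    show "\<bar>(\<integral>x. F x \<partial>data_law (2 ^ N) (2 ^ l) (vol_grid_law M \<eta> W (2 ^ N * 2 ^ l)))
        - (\<integral>x. F x \<partial>data_law (2 ^ N) (2 ^ l) (vol_grid_law M' \<eta>' W' (2 ^ N * 2 ^ l)))\<bar>
      \<le> 4 * c + Q / c + 4 * real (2 ^ N) * V * exp (R + 1) / c"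
      by (rule fbm_data_test_bound[OF _ _ c H \<eta> vol_grid_law[OF M] vol_grid_law[OF M'] V R Q F]) auto
  qed
qed

definition recon :: "nat \<Rightarrow> real \<Rightarrow> (nat \<Rightarrow> real) \<Rightarrow> nat \<Rightarrow> real" where
  "recon n S0 d = (\<lambda>i\<in>{..n}. S0 + (\<Sum>j<i. d j))"

lemma measurable_recon: "recon n S0 \<in> measurable (PiM {..<n} (\<lambda>_. borel)) (PiM {..n} (\<lambda>_. borel))"
proof -
  have "(\<lambda>d. \<Sum>j<i. d j) \<in> borel_measurable (PiM {..<n} (\<lambda>_. borel :: real measure))" if "i \<in> {..n}" for i
    using that by (intro borel_measurable_sum measurable_component_singleton) auto
  then show ?thesis
    unfolding recon_def[abs_def] by (intro measurable_restrict borel_measurable_add borel_measurable_const)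
qed

text \<open>The starting value is almost surely \<open>S0\<close>, so the observations are almost
  surely a fixed measurable function of the increments, and closeness of the laws of the increments
  carries over.\<close>

lemma measure_obs_eq_increments:
  assumes R: "rough_vol_model M H \<eta> S0 B W S" and n: "0 < n" and E: "E \<in> sets (PiM {..n} (\<lambda>_. borel))"
  shows "measure M {\<omega>\<in>space M. obs n S \<omega> \<in> E} = measure (increments_law M S n) (recon n S0 -` E \<inter> space (PiM {..<n} (\<lambda>_. borel)))"
proof -
  note m = rough_vol_modelD[OF R]
  interpret prob_space M by (rule m(1))
  have [measurable]: "S t \<in> borel_measurable M" if "0 \<le> t" for t using m(6) that .
  have AE0: "AE \<omega> in M. S 0 \<omega> = S0"
  proof -
    \<comment> \<open>At time 0 the Riemann sum is 0 at every level, so the assumed convergence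
      concerns a constant sequence and its value must be 0.\<close>
    have z: "prob {\<omega>\<in>space M. \<bar>S 0 \<omega> - S0\<bar> > \<epsilon>} = 0" if "0 < \<epsilon>" for \<epsilon>
    proof -
      have "(\<lambda>m. measure M {\<omega>\<in>space M. \<bar>dyadic_riemann_sum (\<lambda>u \<omega>. sqrt (exp (\<eta> * W u \<omega>))) B 0 m \<omega> - (S 0 \<omega> - S0)\<bar> > \<epsilon>}) \<longlonglongrightarrow> 0"
        using R that unfolding rough_vol_model_def by simp
      then have "(\<lambda>m :: nat. prob {\<omega>\<in>space M. \<bar>S 0 \<omega> - S0\<bar> > \<epsilon>}) \<longlonglongrightarrow> 0"
        by (simp add: dyadic_riemann_sum_def abs_minus_commute)
      then show ?thesis by (simp add: LIMSEQ_const_iff)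
    qed
    have "AE \<omega> in M. \<forall>k::nat. \<bar>S 0 \<omega> - S0\<bar> \<le> 1 / real (Suc k)"
    proof (subst AE_all_countable, rule allI)
      fix k :: nat
      have "AE \<omega> in M. \<not> (\<bar>S 0 \<omega> - S0\<bar> > 1 / real (Suc k))"
      proof (rule AE_I[where N="{\<omega>\<in>space M. \<bar>S 0 \<omega> - S0\<bar> > 1 / real (Suc k)}"])
        show "emeasure M {\<omega>\<in>space M. \<bar>S 0 \<omega> - S0\<bar> > 1 / real (Suc k)} = 0"
          using z[of "1 / real (Suc k)"] by (simp add: emeasure_eq_measure)
      qed auto
      then show "AE \<omega> in M. \<bar>S 0 \<omega> - S0\<bar> \<le> 1 / real (Suc k)" by (simp add: not_less)
    qed
    then show ?thesis
    proof (rule AE_mp, intro AE_I2 impI)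
      fix \<omega> assume *: "\<forall>k::nat. \<bar>S 0 \<omega> - S0\<bar> \<le> 1 / real (Suc k)"
      have "\<bar>S 0 \<omega> - S0\<bar> \<le> 0"
      proof (rule LIMSEQ_le_const)
        show "(\<lambda>k. 1 / real (Suc k)) \<longlonglongrightarrow> 0" by (rule LIMSEQ_Suc[OF lim_1_over_n])
      qed (use * in auto)
      then show "S 0 \<omega> = S0" by simp
    qed
  qed
  define D where "D = (\<lambda>\<omega>. \<lambda>j\<in>{..<n}. S (real (Suc j) / real n) \<omega> - S (real j / real n) \<omega>)"
  have D[measurable]: "D \<in> measurable M (PiM {..<n} (\<lambda>_. borel))" unfolding D_def by (rule increments_measurable[OF R])
  have rec: "obs n S \<omega> = recon n S0 (D \<omega>)" if "S 0 \<omega> = S0" for \<omega>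
  proof -
    have "(\<Sum>j<i. D \<omega> j) = S (real i / real n) \<omega> - S 0 \<omega>" if "i \<le> n" for i
      using that by (induction i) (auto simp: D_def)
    then show ?thesis using that by (auto simp: obs_def recon_def)
  qed
  have obs_m: "obs n S \<in> measurable M (PiM {..n} (\<lambda>_. borel))"
    unfolding obs_def[abs_def] by (intro measurable_restrict m(6)) auto
  define A where "A = recon n S0 -` E \<inter> space (PiM {..<n} (\<lambda>_. borel :: real measure))"
  have A: "A \<in> sets (PiM {..<n} (\<lambda>_. borel))" unfolding A_def by (rule measurable_sets[OF measurable_recon E])
  have DA: "D \<omega> \<in> A \<longleftrightarrow> recon n S0 (D \<omega>) \<in> E" for \<omega>
    by (auto simp: A_def D_def space_PiM)
  have "measure M {\<omega>\<in>space M. obs n S \<omega> \<in> E} = measure M (D -` A \<inter> space M)"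
  proof (rule finite_measure_eq_AE)
    show "AE \<omega> in M. \<omega> \<in> {\<omega>\<in>space M. obs n S \<omega> \<in> E} \<longleftrightarrow> \<omega> \<in> D -` A \<inter> space M"
      using AE0 by eventually_elim (auto simp: rec DA)
    show "{\<omega>\<in>space M. obs n S \<omega> \<in> E} \<in> sets M"
      using measurable_sets[OF obs_m E] by (simp add: vimage_def Int_def conj_commute)
    show "D -` A \<inter> space M \<in> sets M" by (rule measurable_sets[OF D A])
  qed
  also have "\<dots> = measure (increments_law M S n) A"
    unfolding increments_law_def D_def[symmetric] by (rule measure_distr[OF D A, symmetric])
  finally show ?thesis by (simp add: A_def)
qed

section \<open>Two-point lower bound\<close>

lemma obs_in_space: "obs n X \<omega> \<in> space (PiM {..n} (\<lambda>_. borel))"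
  by (simp add: obs_def space_PiM)

text \<open>Outside \<open>E\<close> the estimate is within c r of \<open>T\<close>, hence at least
  c r' away from \<open>T'\<close>: the two error events cover the sample space and their masses
  under the second law add up to at least one. Replacing the second law by the first on
  \<open>E\<close> loses at most 1/2. Two radii are kept because the rate depends on the Hurst
  index.\<close>

lemma two_point_risk:
  assumes M: "rough_vol_model M H \<eta> S0 B W S" and M': "rough_vol_model M' H' \<eta>' S0 B' W' S'" and n: "0 < n"
    and tv: "\<And>A. A \<in> sets (PiM {..<n} (\<lambda>_. borel)) \<Longrightarrow>
      \<bar>measure (increments_law M S n) A - measure (increments_law M' S' n) A\<bar> \<le> 1 / 2"
    and f: "f \<in> estimators n" and r: "0 < r" "0 < r'" and sep: "c * r + c * r' \<le> \<bar>T - T'\<bar>"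
  shows "1 / 2 \<le> measure M {\<omega>\<in>space M. \<bar>f (obs n S \<omega>) - T\<bar> / r \<ge> c}
    + measure M' {\<omega>\<in>space M'. \<bar>f (obs n S' \<omega>) - T'\<bar> / r' \<ge> c}"
proof -
  interpret M': prob_space M' by (rule rough_vol_modelD(1)[OF M'])
  define \<Omega> where "\<Omega> = space (PiM {..n} (\<lambda>_. borel :: real measure))"
  have [measurable]: "f \<in> borel_measurable (PiM {..n} (\<lambda>_. borel))" using f by (simp add: estimators_def)
  define E where "E = {x\<in>\<Omega>. \<bar>f x - T\<bar> / r \<ge> c}"
  define E' where "E' = {x\<in>\<Omega>. \<bar>f x - T'\<bar> / r' \<ge> c}"
  have E: "E \<in> sets (PiM {..n} (\<lambda>_. borel))" "E' \<in> sets (PiM {..n} (\<lambda>_. borel))"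
    unfolding E_def E'_def \<Omega>_def by measurable
  have obs: "obs n S \<omega> \<in> \<Omega>" "obs n S' \<omega>' \<in> \<Omega>" for \<omega> \<omega>'
    unfolding \<Omega>_def by (rule obs_in_space)+
  have eq: "{\<omega>\<in>space M. \<bar>f (obs n S \<omega>) - T\<bar> / r \<ge> c} = {\<omega>\<in>space M. obs n S \<omega> \<in> E}"
    and eq': "{\<omega>\<in>space M'. \<bar>f (obs n S' \<omega>) - T'\<bar> / r' \<ge> c} = {\<omega>\<in>space M'. obs n S' \<omega> \<in> E'}"
    using obs by (auto simp: E_def E'_def)
  have obs_m: "obs n S' \<in> measurable M' (PiM {..n} (\<lambda>_. borel))"
    unfolding obs_def[abs_def] using rough_vol_modelD(6)[OF M'] by (intro measurable_restrict) auto
  have sets: "{\<omega>\<in>space M'. obs n S' \<omega> \<in> X} \<in> sets M'" if "X \<in> sets (PiM {..n} (\<lambda>_. borel))" for X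
    using measurable_sets[OF obs_m that] by (simp add: vimage_def Int_def conj_commute)
  have "\<bar>measure M {\<omega>\<in>space M. obs n S \<omega> \<in> E} - measure M' {\<omega>\<in>space M'. obs n S' \<omega> \<in> E}\<bar> \<le> 1 / 2"
    unfolding measure_obs_eq_increments[OF M n E(1)] measure_obs_eq_increments[OF M' n E(1)]
    by (rule tv[OF measurable_sets[OF measurable_recon E(1)]])
  moreover have "1 - measure M' {\<omega>\<in>space M'. obs n S' \<omega> \<in> E} \<le> measure M' {\<omega>\<in>space M'. obs n S' \<omega> \<in> E'}"
  proof -
    have "space M' \<subseteq> {\<omega>\<in>space M'. obs n S' \<omega> \<in> E} \<union> {\<omega>\<in>space M'. obs n S' \<omega> \<in> E'}"
    proof
      fix \<omega> assume \<omega>: "\<omega> \<in> space M'"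
      have "obs n S' \<omega> \<in> E'" if "obs n S' \<omega> \<notin> E"
      proof -
        have "\<bar>f (obs n S' \<omega>) - T\<bar> < c * r"
          using that obs(2)[of \<omega>] r by (auto simp: E_def not_le pos_divide_less_eq)
        then have "c * r' \<le> \<bar>f (obs n S' \<omega>) - T'\<bar>" using sep by linarith
        then show ?thesis using obs(2)[of \<omega>] r by (auto simp: E'_def pos_le_divide_eq)
      qed
      then show "\<omega> \<in> {\<omega>\<in>space M'. obs n S' \<omega> \<in> E} \<union> {\<omega>\<in>space M'. obs n S' \<omega> \<in> E'}" using \<omega> by auto
    qed
    then have "measure M' (space M') \<le> measure M' ({\<omega>\<in>space M'. obs n S' \<omega> \<in> E} \<union> {\<omega>\<in>space M'. obs n S' \<omega> \<in> E'})"
      using sets E by (intro M'.finite_measure_mono) auto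
    also have "\<dots> \<le> measure M' {\<omega>\<in>space M'. obs n S' \<omega> \<in> E} + measure M' {\<omega>\<in>space M'. obs n S' \<omega> \<in> E'}"
      using sets E by (intro measure_Un_le) auto
    finally show ?thesis using M'.prob_space by simp
  qed
  ultimately show ?thesis unfolding eq eq' by linarith
qed

section \<open>Choice of the parameters and rates\<close>

lemma ball_prod_cube:
  fixes x y :: real
  assumes "\<bar>x' - x\<bar> < e / 2" "\<bar>y' - y\<bar> < e / 2"
  shows "(x', y') \<in> ball (x, y) e"
proof -
  have "dist (x, y) (x', y') \<le> \<bar>x - x'\<bar> + \<bar>y - y'\<bar>"
    unfolding dist_Pair_Pair dist_real_def using sqrt_sum_squares_le_sum_abs[of "\<bar>x - x'\<bar>" "\<bar>y - y'\<bar>"] by simp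
  moreover have "\<bar>x - x'\<bar> = \<bar>x' - x\<bar>" "\<bar>y - y'\<bar> = \<bar>y' - y\<bar>" by auto
  ultimately show ?thesis unfolding mem_ball using assms by linarith
qed

text \<open>If the given interior point has first coordinate 1/2, a move by e/4 inside the ball of
  radius e leaves the exceptional value, and a cube of half-width e/4 still fits.\<close>

lemma interior_point_off_half:
  fixes D :: "(real \<times> real) set"
  assumes "interior D \<noteq> {}"
  obtains H \<eta> r where "0 < r" "H \<noteq> 1 / 2"
    "\<And>H' \<eta>'. \<bar>H' - H\<bar> < r \<Longrightarrow> \<bar>\<eta>' - \<eta>\<bar> < r \<Longrightarrow> (H', \<eta>') \<in> D"
proof -
  obtain p where "p \<in> interior D" using assms by blast
  then obtain e where e: "0 < e" "ball p e \<subseteq> D" by (auto simp: mem_interior)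
  obtain x y where p: "p = (x, y)" by (cases p)
  define H where "H = (if x = 1 / 2 then 1 / 2 + e / 4 else x)"
  show ?thesis
  proof (rule that[of "e / 4" H y])
    show "0 < e / 4" "H \<noteq> 1 / 2" using e(1) by (auto simp: H_def)
    fix H' \<eta>' assume "\<bar>H' - H\<bar> < e / 4" "\<bar>\<eta>' - y\<bar> < e / 4"
    moreover have "\<bar>H - x\<bar> \<le> e / 4" using e(1) by (auto simp: H_def)
    ultimately have "(H', \<eta>') \<in> ball (x, y) e" by (intro ball_prod_cube) linarith+
    then show "(H', \<eta>') \<in> D" using e(2) p by auto
  qed
qed

text \<open>The square of \<open>rate_v\<close> is n^(-1/(2H+1)), so the cutoff \<open>J\<close>
  keeps both v^2 J and n v^2 J^(-2H) bounded; these are the costs of the low and the high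
  frequencies. That ln J is comparable to ln n is the origin of the logarithm in
  \<open>rate_w\<close>.\<close>

lemma rate_facts:
  fixes H :: real
  assumes H: "0 < H" and n: "1 \<le> n"
  defines "J \<equiv> nat \<lceil>real n powr (1 / (2 * H + 1))\<rceil>"
  shows "1 \<le> J" "(rate_v n H)\<^sup>2 * real J \<le> 2" "(rate_v n H)\<^sup>2 * real J powr (- 2 * H) \<le> 1 / real n"
    "ln (real J) \<le> 1 + ln (real n)" "ln (real n) / (2 * H + 1) \<le> ln (real J)"
proof -
  define y where "y = real n powr (1 / (2 * H + 1))"
  have y: "1 \<le> y" unfolding y_def using n H by (intro ge_one_powr_ge_zero) auto
  have J: "y \<le> real J" "real J \<le> y + 1"
    unfolding J_def y_def[symmetric] using y by linarith+
  show "1 \<le> J" using J(1) y by linarith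
  have v2: "(rate_v n H)\<^sup>2 = 1 / y"
  proof -
    have "(rate_v n H)\<^sup>2 = real n powr (- 1 / (4 * H + 2) + - 1 / (4 * H + 2))"
      unfolding rate_v_def power2_eq_square powr_add by simp
    also have "- 1 / (4 * H + 2) + - 1 / (4 * H + 2) = - (1 / (2 * H + 1))"
      using H by (simp add: field_simps)
    finally show ?thesis by (simp add: y_def powr_minus_divide)
  qed
  show "(rate_v n H)\<^sup>2 * real J \<le> 2" unfolding v2 using J y by (simp add: divide_le_eq)
  have "real J powr (- 2 * H) \<le> y powr (- 2 * H)" using J y H by (intro powr_mono2') auto
  then have "(rate_v n H)\<^sup>2 * real J powr (- 2 * H) \<le> y powr (- 1) * y powr (- 2 * H)"
  proof -
    assume *: "real J powr (- 2 * H) \<le> y powr (- 2 * H)"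
    have "1 / y = y powr (- 1)" using y by (simp add: powr_minus_divide)
    then show ?thesis unfolding v2 using * by (simp only:) (rule mult_left_mono, simp_all)
  qed
  also have "\<dots> = y powr (- (2 * H + 1))"
    unfolding powr_add[symmetric] by (rule arg_cong[where f="\<lambda>e. y powr e"]) simp
  also have "\<dots> = real n powr (- 1)"
  proof -
    have "1 / x * (- x) = - 1" if "0 < x" for x :: real using that by simp
    from this[of "2 * H + 1"] H have "1 / (2 * H + 1) * (- (2 * H + 1)) = - 1" by linarith
    then show ?thesis unfolding y_def powr_powr by (simp only:)
  qed
  finally show "(rate_v n H)\<^sup>2 * real J powr (- 2 * H) \<le> 1 / real n" using n by (simp add: powr_minus_divide)
  have ln_y: "ln y = ln (real n) / (2 * H + 1)" using n by (simp add: y_def ln_powr)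
  show "ln (real n) / (2 * H + 1) \<le> ln (real J)" unfolding ln_y[symmetric] using J y by simp
  have "ln (real J) \<le> ln (2 * y)" using J y by simp
  also have "\<dots> = ln 2 + ln y" using y by (simp add: ln_mult)
  also have "ln 2 \<le> (1::real)" using ln_le_minus_one[of 2] by simp
  also have "ln y \<le> ln (real n)"
  proof -
    have "ln (real n) / (2 * H + 1) \<le> ln (real n) / 1" using H n by (intro divide_left_mono) auto
    then show ?thesis unfolding ln_y by simp
  qed
  finally show "ln (real J) \<le> 1 + ln (real n)" by simp
qed

lemma rate_v_tendsto_0: "0 < H \<Longrightarrow> (\<lambda>N. rate_v (2 ^ N) H) \<longlonglongrightarrow> 0"
  and rate_v_ln_tendsto_0: "0 < H \<Longrightarrow> (\<lambda>N. rate_v (2 ^ N) H * (1 + ln (real (2 ^ N)))) \<longlonglongrightarrow> 0"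
proof -
  assume H: "0 < H"
  have sub: "strict_mono (\<lambda>N :: nat. 2 ^ N :: nat)" by (intro strict_monoI) simp
  have 1: "(\<lambda>n. rate_v n H) \<longlonglongrightarrow> 0"
    unfolding rate_v_def using H by (intro tendsto_neg_powr filterlim_real_sequentially) auto
  have 2: "(\<lambda>n. rate_v n H * ln (real n)) \<longlonglongrightarrow> 0"
  proof -
    have "(\<lambda>n. ln (real n) / real n powr (1 / (4 * H + 2))) \<longlonglongrightarrow> 0"
      using H by (intro lim_ln_over_power) simp
    moreover have "ln (real n) / real n powr (1 / (4 * H + 2)) = rate_v n H * ln (real n)" for n
      by (simp add: rate_v_def powr_minus_divide)
    ultimately show ?thesis by simp
  qed
  show "(\<lambda>N. rate_v (2 ^ N) H) \<longlonglongrightarrow> 0" using LIMSEQ_subseq_LIMSEQ[OF 1 sub] by (simp add: o_def)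
  have "(\<lambda>n. rate_v n H * (1 + ln (real n))) \<longlonglongrightarrow> 0"
    using tendsto_add[OF 1 2] by (simp add: distrib_left)
  from LIMSEQ_subseq_LIMSEQ[OF this sub]
  show "(\<lambda>N. rate_v (2 ^ N) H * (1 + ln (real (2 ^ N)))) \<longlonglongrightarrow> 0" by (simp add: o_def)
qed

lemma rate_v_mono: "0 < H' \<Longrightarrow> H' \<le> H \<Longrightarrow> 1 \<le> n \<Longrightarrow> rate_v n H' \<le> rate_v n H"
  unfolding rate_v_def by (intro powr_mono) (auto simp: divide_simps)

lemma liminf_minimax_gt_0:
  assumes ev: "eventually (\<lambda>N. \<forall>f\<in>F N. \<exists>x\<in>D. 1 / 4 \<le> p N f x) sequentially"
  shows "0 < liminf (\<lambda>N. INF f\<in>F N. SUP x\<in>D. ereal (p N f x))"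
proof -
  have "ereal (1 / 4) \<le> liminf (\<lambda>N. INF f\<in>F N. SUP x\<in>D. ereal (p N f x))"
  proof (rule Liminf_bounded)
    show "eventually (\<lambda>N. ereal (1 / 4) \<le> (INF f\<in>F N. SUP x\<in>D. ereal (p N f x))) sequentially"
      using ev
    proof eventually_elim
      case (elim N)
      show ?case
      proof (rule INF_greatest)
        fix f assume "f \<in> F N"
        with elim obtain x where "x \<in> D" "1 / 4 \<le> p N f x" by blast
        then show "ereal (1 / 4) \<le> (SUP x\<in>D. ereal (p N f x))" by (intro SUP_upper2) auto
      qed
    qed
  qed
  then show ?thesis by (rule less_le_trans[rotated]) simp
qed

theorem theorem3:
  fixes D :: "(real \<times> real) set"
    and M :: "real \<Rightarrow> real \<Rightarrow> 'a measure"
    and B W S :: "real \<Rightarrow> real \<Rightarrow> real \<Rightarrow> 'a \<Rightarrow> real"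
    and S0 :: real
  assumes "compact D"
    and "D \<subseteq> {0<..<3/4} \<times> {0<..}"
    and "interior D \<noteq> {}"
    and "\<forall>(H, \<eta>)\<in>D. rough_vol_model (M H \<eta>) H \<eta> S0 (B H \<eta>) (W H \<eta>) (S H \<eta>)"
  shows "\<exists>c>0.
    liminf (\<lambda>N. INF g\<in>estimators (2^N). SUP (H, \<eta>)\<in>D.
        ereal (measure (M H \<eta>) {\<omega>\<in>space (M H \<eta>).
          \<bar>g (obs (2^N) (S H \<eta>) \<omega>) - H\<bar> / rate_v (2^N) H \<ge> c})) > 0
    \<and> liminf (\<lambda>N. INF g\<in>estimators (2^N). SUP (H, \<eta>)\<in>D.
        ereal (measure (M H \<eta>) {\<omega>\<in>space (M H \<eta>).
          \<bar>g (obs (2^N) (S H \<eta>) \<omega>) - \<eta>\<bar> / rate_w (2^N) H \<ge> c})) > 0"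
proof -
  obtain H \<eta> r where r: "0 < r" "H \<noteq> 1 / 2"
    "\<And>H' \<eta>'. \<bar>H' - H\<bar> < r \<Longrightarrow> \<bar>\<eta>' - \<eta>\<bar> < r \<Longrightarrow> (H', \<eta>') \<in> D"
    by (rule interior_point_off_half[OF assms(3)]) (rule that)
  have HD: "(H, \<eta>) \<in> D" using r by simp
  then have H: "0 < H" "H < 3 / 4" and \<eta>: "0 < \<eta>" using assms(2) by auto
  \<comment> \<open>The three terms keep [H - t, H] inside the cube contained in \<open>D\<close>,
    away from 0, and on one side of 1/2.\<close>
  define t where "t = min (r / 2) (min (H / 2) (\<bar>H - 1 / 2\<bar> / 2))"
  define a where "a = H - t"
  have t: "0 < t" "t < r" using r H by (auto simp: t_def)
  have a: "0 < a" "a \<le> H" using H t by (auto simp: a_def t_def)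
  have "t \<le> \<bar>H - 1 / 2\<bar> / 2"
    unfolding t_def by (rule order_trans[OF min.cobounded2 min.cobounded2])
  then have half: "H < 1 / 2 \<or> 1 / 2 < a" unfolding a_def using r(2) by (cases "H < 1 / 2") auto
  have H1: "H < 1" using H by simp
  obtain C where C: "0 < C" "\<And>H'. a \<le> H' \<Longrightarrow> H' \<le> H \<Longrightarrow> fbm_regular H'"
    "\<And>H' \<eta> K. a \<le> H' \<Longrightarrow> H' \<le> H \<Longrightarrow> 0 < \<eta> \<Longrightarrow> (\<Sum>i\<le>2 * K. (fbm_amp H' \<eta> i)\<^sup>2) \<le> C * \<eta>\<^sup>2"
    "\<And>H' h \<eta> J. a \<le> H' - h \<Longrightarrow> 0 \<le> h \<Longrightarrow> H' \<le> H \<Longrightarrow> 0 < \<eta> \<Longrightarrow> 1 \<le> J \<Longrightarrow>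
      (\<Sum>i\<le>2 * J. (fbm_amp H' \<eta> i - fbm_amp (H' - h) (\<eta> * real J powr (- h)) i)\<^sup>2
         / ((fbm_amp H' \<eta> i)\<^sup>2 + (fbm_amp (H' - h) (\<eta> * real J powr (- h)) i)\<^sup>2)) \<le> C * h\<^sup>2 * real J"
    "\<And>H' h \<eta> J K. a \<le> H' - h \<Longrightarrow> 0 \<le> h \<Longrightarrow> 4 * h \<le> a \<Longrightarrow> H' \<le> H \<Longrightarrow> 0 < \<eta> \<Longrightarrow> 1 \<le> J \<Longrightarrow>
      (\<Sum>i\<in>{2 * J<..2 * (J + K)}. (fbm_amp H' \<eta> i - fbm_amp (H' - h) (\<eta> * real J powr (- h)) i)\<^sup>2)
        \<le> C * \<eta>\<^sup>2 * h\<^sup>2 * real J powr (- 2 * H')"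
    by (rule fbm_amp_perturbation[OF a H1 half]) (rule that)
  \<comment> \<open>The constant 16 of the exponent bound times the two energies, each at most C
    \<eta>^2 because the second amplitude parameter is at most \<eta>.\<close>
  define R where "R = 32 * C * \<eta>\<^sup>2"
  \<comment> \<open>With the Young weight 1/16, the low frequencies cost 16 times 2 C \<epsilon>^2
    and the high ones 64 exp(R + 1) times 4 C \<eta>^2 \<epsilon>^2: together \<epsilon>^2 X. The
    choice of \<open>\<epsilon>\<close> makes this 1/4, and four times the weight is the other 1/4
    of the total 1/2.\<close>
  define X where "X = 32 * C + 256 * C * \<eta>\<^sup>2 * exp (R + 1)"
  have X: "0 < X" using C(1) by (simp add: X_def add_pos_nonneg)
  define \<epsilon> where "\<epsilon> = 1 / (2 * sqrt X)"
  have \<epsilon>: "0 < \<epsilon>" "\<epsilon>\<^sup>2 * X = 1 / 4" using X by (auto simp: \<epsilon>_def power_divide power_mult_distrib)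
  define h where "h = (\<lambda>N. \<epsilon> * rate_v (2 ^ N) H)"
  define J where "J = (\<lambda>N :: nat. nat \<lceil>real (2 ^ N) powr (1 / (2 * H + 1))\<rceil>)"
  define \<eta>' where "\<eta>' = (\<lambda>N. \<eta> * real (J N) powr (- h N))"
  \<comment> \<open>The rate at the smaller Hurst index is the smaller one, so \<epsilon>/2 suffices
    to separate the two values of H, which differ by \<epsilon> times the rate. The 10 combines the
    two radii, the factor 1/2 in 1 - exp(-x) \<ge> x/2, and ln J \<ge> (2/5) ln n, valid as H <
    3/4.\<close>
  define c where "c = min (\<epsilon> / 2) (\<eta> * \<epsilon> / 10)"
  have c: "0 < c" "c \<le> \<epsilon> / 2" "c \<le> \<eta> * \<epsilon> / 10" using \<epsilon> \<eta> by (auto simp: c_def)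
  have rate: "1 \<le> J N" "(rate_v (2 ^ N) H)\<^sup>2 * real (J N) \<le> 2"
    "(rate_v (2 ^ N) H)\<^sup>2 * real (J N) powr (- 2 * H) \<le> 1 / real (2 ^ N)"
    "ln (real (J N)) \<le> 1 + ln (real (2 ^ N))" "ln (real (2 ^ N)) / (2 * H + 1) \<le> ln (real (J N))" for N
    using rate_facts[OF H(1), of "2 ^ N"] by (auto simp: J_def)
  have v_pos: "0 < rate_v (2 ^ N) H'" for N H' by (simp add: rate_v_def)
  have h_pos: "0 < h N" for N using \<epsilon> v_pos by (simp add: h_def)
  have hlnJ: "0 \<le> h N * ln (real (J N))" "h N * ln (real (J N)) \<le> \<epsilon> * (rate_v (2 ^ N) H * (1 + ln (real (2 ^ N))))" for N
  proof -
    show "0 \<le> h N * ln (real (J N))" using h_pos[of N] rate(1)[of N] by simp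
    have "h N * ln (real (J N)) \<le> h N * (1 + ln (real (2 ^ N)))"
      using h_pos[of N] rate(4)[of N] by (intro mult_left_mono) auto
    then show "h N * ln (real (J N)) \<le> \<epsilon> * (rate_v (2 ^ N) H * (1 + ln (real (2 ^ N))))"
      by (simp add: h_def mult.assoc)
  qed
  have \<eta>'_eq: "\<eta>' N = \<eta> * exp (- (h N * ln (real (J N))))" for N
    using rate(1)[of N] by (simp add: \<eta>'_def powr_def)
  \<comment> \<open>The last quantity dominates x = h ln J. Its bound 1 is for the linear lower
    estimate of 1 - exp(-x), its bound r/\<eta> keeps the second parameter in
    \<open>D\<close>.\<close>
  have ev: "eventually (\<lambda>N. 1 \<le> N \<and> h N < t \<and> 4 * h N < a \<and> \<epsilon> * (rate_v (2 ^ N) H * (1 + ln (real (2 ^ N)))) < min 1 (r / \<eta>)) sequentially"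
  proof -
    have hl: "h \<longlonglongrightarrow> \<epsilon> * 0" unfolding h_def by (intro tendsto_mult tendsto_const rate_v_tendsto_0 H)
    have "(\<lambda>N. \<epsilon> * (rate_v (2 ^ N) H * (1 + ln (real (2 ^ N))))) \<longlonglongrightarrow> \<epsilon> * 0"
      by (intro tendsto_mult tendsto_const rate_v_ln_tendsto_0 H)
    then have "eventually (\<lambda>N. \<epsilon> * (rate_v (2 ^ N) H * (1 + ln (real (2 ^ N)))) < min 1 (r / \<eta>)) sequentially"
      by (rule order_tendstoD(2)) (use r \<eta> in auto)
    moreover have "eventually (\<lambda>N. h N < t) sequentially" "eventually (\<lambda>N. h N < a / 4) sequentially"
      using order_tendstoD(2)[OF hl, of t] order_tendstoD(2)[OF hl, of "a / 4"] t a by auto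
    moreover have "eventually (\<lambda>N. 1 \<le> N) sequentially" by (rule eventually_ge_at_top)
    ultimately show ?thesis by eventually_elim auto
  qed
  have main: "(H - h N, \<eta>' N) \<in> D \<and> (\<forall>f\<in>estimators (2 ^ N).
      1 / 2 \<le> measure (M H \<eta>) {\<omega>\<in>space (M H \<eta>). \<bar>f (obs (2 ^ N) (S H \<eta>) \<omega>) - H\<bar> / rate_v (2 ^ N) H \<ge> c}
        + measure (M (H - h N) (\<eta>' N)) {\<omega>\<in>space (M (H - h N) (\<eta>' N)).
            \<bar>f (obs (2 ^ N) (S (H - h N) (\<eta>' N)) \<omega>) - (H - h N)\<bar> / rate_v (2 ^ N) (H - h N) \<ge> c} \<and>
      1 / 2 \<le> measure (M H \<eta>) {\<omega>\<in>space (M H \<eta>). \<bar>f (obs (2 ^ N) (S H \<eta>) \<omega>) - \<eta>\<bar> / rate_w (2 ^ N) H \<ge> c}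
        + measure (M (H - h N) (\<eta>' N)) {\<omega>\<in>space (M (H - h N) (\<eta>' N)).
            \<bar>f (obs (2 ^ N) (S (H - h N) (\<eta>' N)) \<omega>) - \<eta>' N\<bar> / rate_w (2 ^ N) (H - h N) \<ge> c})"
    if N: "1 \<le> N" and ht: "h N < t" and ha: "4 * h N < a"
      and small: "\<epsilon> * (rate_v (2 ^ N) H * (1 + ln (real (2 ^ N)))) < min 1 (r / \<eta>)" for N
  proof -
    define x where "x = h N * ln (real (J N))"
    have x: "0 \<le> x" "x < 1" "x < r / \<eta>" using hlnJ[of N] small by (auto simp: x_def)
    have \<eta>'_pos: "0 < \<eta>' N" using \<eta> by (simp add: \<eta>'_eq)
    have \<eta>'_le: "\<eta>' N \<le> \<eta>" using \<eta> x by (simp add: \<eta>'_eq x_def[symmetric])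
    have \<eta>_diff: "\<eta> - \<eta>' N = \<eta> * (1 - exp (- x))" by (simp add: \<eta>'_eq x_def[symmetric] right_diff_distrib)
    have "1 - exp (- x) \<le> x" using exp_ge_add_one_self[of "- x"] by linarith
    then have "\<eta> - \<eta>' N \<le> \<eta> * x" unfolding \<eta>_diff using \<eta> by (intro mult_left_mono) auto
    also have "\<dots> < r" using x \<eta> by (simp add: pos_less_divide_eq mult.commute)
    finally have inD: "(H - h N, \<eta>' N) \<in> D" using \<eta>'_le ht t h_pos[of N] by (intro r(3)) auto
    note m0 = assms(4)[rule_format, OF HD, unfolded prod.case]
    note m1 = assms(4)[rule_format, OF inD, unfolded prod.case]
    have aH: "a \<le> H - h N" using ht by (simp add: a_def)
    have h0: "0 \<le> h N" using h_pos[of N] by simp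
    have tv: "\<bar>measure (increments_law (M H \<eta>) (S H \<eta>) (2 ^ N)) A
        - measure (increments_law (M (H - h N) (\<eta>' N)) (S (H - h N) (\<eta>' N)) (2 ^ N)) A\<bar> \<le> 1 / 2"
      if A: "A \<in> sets (PiM {..<2 ^ N} (\<lambda>_. borel))" for A
    proof -
      define V where "V = 4 * (C * \<eta>\<^sup>2 * (h N)\<^sup>2 * real (J N) powr (- 2 * H))"
      define Q where "Q = C * (h N)\<^sup>2 * real (J N)"
      have V: "0 < V" using C(1) \<eta> h_pos[of N] rate(1)[of N] by (simp add: V_def)
      have "\<bar>measure (increments_law (M H \<eta>) (S H \<eta>) (2 ^ N)) A
          - measure (increments_law (M (H - h N) (\<eta>' N)) (S (H - h N) (\<eta>' N)) (2 ^ N)) A\<bar>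
        \<le> 4 * (1 / 16) + Q / (1 / 16) + 4 * real (2 ^ N) * V * exp (R + 1) / (1 / 16)"
      proof (rule increments_law_test_bound[OF m0 m1 _ _ _ \<eta> \<eta>'_pos V _ _ _ A])
        show "fbm_regular H" "fbm_regular (H - h N)" using C(2) a aH h0 by auto
        show "4 * (\<Sum>i\<in>{2 * J N<..2 * (J N + K)}. (fbm_amp H \<eta> i - fbm_amp (H - h N) (\<eta>' N) i)\<^sup>2) \<le> V" for K
          unfolding V_def \<eta>'_def using C(5)[OF aH h0 _ _ \<eta> rate(1)] ha by (intro mult_left_mono) auto
        show "(\<Sum>i\<le>2 * J N. (fbm_amp H \<eta> i - fbm_amp (H - h N) (\<eta>' N) i)\<^sup>2
            / ((fbm_amp H \<eta> i)\<^sup>2 + (fbm_amp (H - h N) (\<eta>' N) i)\<^sup>2)) \<le> Q"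
          unfolding Q_def \<eta>'_def using C(4)[OF aH h0 _ \<eta> rate(1)] by auto
        show "16 * (\<Sum>i\<le>2 * K. (fbm_amp H \<eta> i)\<^sup>2 + (fbm_amp (H - h N) (\<eta>' N) i)\<^sup>2) \<le> R" for K
        proof -
          have "(\<Sum>i\<le>2 * K. (fbm_amp H \<eta> i)\<^sup>2) \<le> C * \<eta>\<^sup>2" using C(3)[of H \<eta>] a \<eta> by auto
          moreover have "(\<Sum>i\<le>2 * K. (fbm_amp (H - h N) (\<eta>' N) i)\<^sup>2) \<le> C * (\<eta>' N)\<^sup>2"
            using C(3)[OF aH _ \<eta>'_pos] h0 by auto
          moreover have "C * (\<eta>' N)\<^sup>2 \<le> C * \<eta>\<^sup>2" using C(1) \<eta>'_le \<eta>'_pos by (intro mult_left_mono power_mono) auto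
          moreover have "R = 32 * (C * \<eta>\<^sup>2)" by (simp add: R_def)
          ultimately show ?thesis unfolding sum.distrib distrib_left by linarith
        qed
      qed simp
      also have "\<dots> \<le> 1 / 2"
      proof -
        have hh: "(h N)\<^sup>2 = \<epsilon>\<^sup>2 * (rate_v (2 ^ N) H)\<^sup>2" by (simp add: h_def power_mult_distrib)
        have "Q = C * \<epsilon>\<^sup>2 * ((rate_v (2 ^ N) H)\<^sup>2 * real (J N))" by (simp add: Q_def hh mult_ac)
        also have "\<dots> \<le> C * \<epsilon>\<^sup>2 * 2" using C(1) by (intro mult_left_mono rate) auto
        finally have Q: "Q \<le> 2 * C * \<epsilon>\<^sup>2" by simp
        have "real (2 ^ N) * V = 4 * C * \<eta>\<^sup>2 * \<epsilon>\<^sup>2 * (real (2 ^ N) * ((rate_v (2 ^ N) H)\<^sup>2 * real (J N) powr (- 2 * H)))"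
          by (simp add: V_def hh mult_ac)
        also have "\<dots> \<le> 4 * C * \<eta>\<^sup>2 * \<epsilon>\<^sup>2 * (real (2 ^ N) * (1 / real (2 ^ N)))"
          using C(1) by (intro mult_left_mono rate) auto
        finally have "real (2 ^ N) * V \<le> 4 * C * \<eta>\<^sup>2 * \<epsilon>\<^sup>2" by simp
        then have "64 * exp (R + 1) * (real (2 ^ N) * V) \<le> 64 * exp (R + 1) * (4 * C * \<eta>\<^sup>2 * \<epsilon>\<^sup>2)"
          by (intro mult_left_mono) auto
        moreover have "16 * (2 * C * \<epsilon>\<^sup>2) + 64 * exp (R + 1) * (4 * C * \<eta>\<^sup>2 * \<epsilon>\<^sup>2) = \<epsilon>\<^sup>2 * X"
          by (simp add: X_def algebra_simps)
        moreover have "4 * real (2 ^ N) * V * exp (R + 1) / (1 / 16) = 64 * exp (R + 1) * (real (2 ^ N) * V)" by simp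
        moreover have "4 * (1 / 16) + q / (1 / 16) + w \<le> 1 / 2"
          if "s \<le> s'" "16 * q' + s' = e" "w = s" "q \<le> q'" "e = 1 / 4" for q q' s s' w e :: real
          using that by simp
        ultimately show ?thesis using Q \<epsilon>(2) by blast
      qed
      finally show ?thesis .
    qed
    define v v' where "v = rate_v (2 ^ N) H" and "v' = rate_v (2 ^ N) (H - h N)"
    have v: "0 < v" "0 < v'" "v' \<le> v" using v_pos rate_v_mono[of "H - h N" H "2 ^ N"] aH a h0 by (auto simp: v_def v'_def)
    define l where "l = ln (real (2 ^ N))"
    have l: "0 < l" using N by (simp add: l_def ln_realpow)
    have w: "rate_w (2 ^ N) H = v * l" "rate_w (2 ^ N) (H - h N) = v' * l"
      by (simp_all add: rate_w_def rate_v_def v_def v'_def l_def)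
    have sep1: "c * v + c * v' \<le> \<bar>H - (H - h N)\<bar>"
    proof -
      have "c * v + c * v' \<le> \<epsilon> / 2 * v + \<epsilon> / 2 * v" using c v \<epsilon> by (intro add_mono mult_mono) auto
      then show ?thesis using h0 by (simp add: h_def v_def)
    qed
    have sep2: "c * (v * l) + c * (v' * l) \<le> \<bar>\<eta> - \<eta>' N\<bar>"
    proof -
      have "c * (v * l) + c * (v' * l) \<le> \<eta> * \<epsilon> / 10 * (v * l) + \<eta> * \<epsilon> / 10 * (v * l)"
        using c v l \<epsilon> \<eta> by (intro add_mono mult_mono) auto
      also have "\<dots> = \<eta> * (\<epsilon> * v * (l * (2 / 5)) / 2)" by simp
      also have "\<dots> \<le> \<eta> * (x / 2)"
      proof -
        have "l * (2 / 5) \<le> ln (real (J N))"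
        proof -
          have "l / (5 / 2) \<le> l / (2 * H + 1)" using H l by (intro divide_left_mono) auto
          also have "\<dots> \<le> ln (real (J N))" using rate(5)[of N] unfolding l_def .
          finally show ?thesis by simp
        qed
        then have le: "\<epsilon> * v * (l * (2 / 5)) \<le> x" unfolding x_def h_def v_def[symmetric] using \<epsilon> v by (intro mult_left_mono) auto
        show ?thesis by (rule mult_left_mono[OF divide_right_mono[OF le]]) (use \<eta> in auto)
      qed
      also have "\<dots> \<le> \<eta> * (1 - exp (- x))"
      proof -
        have "exp (- x) \<le> 1 / (1 + x)"
          using exp_ge_add_one_self[of x] x by (simp add: exp_minus field_simps)
        \<comment> \<open>This uses x \<le> 1: the product (1 - x/2)(1 + x) equals 1 + x (1 -
          x)/2.\<close>
        also have "1 / (1 + x) \<le> 1 - x / 2"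
        proof -
          have "1 \<le> (1 - x / 2) * (1 + x)"
          proof -
            have "(1 - x / 2) * (1 + x) = 1 + x * (1 - x) / 2" by (simp add: field_simps)
            then show ?thesis using x by simp
          qed
          then show ?thesis using x by (simp add: pos_divide_le_eq)
        qed
        finally show ?thesis using \<eta> by (intro mult_left_mono) auto
      qed
      also have "\<dots> \<le> \<bar>\<eta> - \<eta>' N\<bar>" unfolding \<eta>_diff by simp
      finally show ?thesis .
    qed
    show ?thesis
      unfolding w v_def[symmetric] v'_def[symmetric]
      using inD two_point_risk[OF m0 m1 _ tv _ v(1,2) sep1] two_point_risk[OF m0 m1 _ tv _ _ _ sep2] v l by auto
  qed
  have quarter: "\<exists>p\<in>D. 1 / 4 \<le> \<rho> p" if "(H - h N, \<eta>' N) \<in> D" "1 / 2 \<le> \<rho> (H, \<eta>) + \<rho> (H - h N, \<eta>' N)" for \<rho> :: "real \<times> real \<Rightarrow> real" and N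
  proof (cases "1 / 4 \<le> \<rho> (H, \<eta>)")
    case True
    with HD show ?thesis by blast
  next
    case False
    with that show ?thesis by (intro bexI[of _ "(H - h N, \<eta>' N)"]) auto
  qed
  show ?thesis
  proof (intro exI[of _ c] conjI c(1))
    show "0 < liminf (\<lambda>N. INF g\<in>estimators (2^N). SUP (H, \<eta>)\<in>D.
        ereal (measure (M H \<eta>) {\<omega>\<in>space (M H \<eta>).
          \<bar>g (obs (2^N) (S H \<eta>) \<omega>) - H\<bar> / rate_v (2^N) H \<ge> c}))"
      unfolding split_beta'
    proof (rule liminf_minimax_gt_0)
      show "eventually (\<lambda>N. \<forall>g\<in>estimators (2^N). \<exists>p\<in>D. 1 / 4 \<le> measure (M (fst p) (snd p)) {\<omega>\<in>space (M (fst p) (snd p)).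
          \<bar>g (obs (2^N) (S (fst p) (snd p)) \<omega>) - fst p\<bar> / rate_v (2^N) (fst p) \<ge> c}) sequentially"
        using ev
      proof eventually_elim
        case (elim N)
        show ?case
        proof
          fix g assume g: "g \<in> estimators (2 ^ N)"
          show "\<exists>p\<in>D. 1 / 4 \<le> measure (M (fst p) (snd p)) {\<omega>\<in>space (M (fst p) (snd p)).
            \<bar>g (obs (2^N) (S (fst p) (snd p)) \<omega>) - fst p\<bar> / rate_v (2^N) (fst p) \<ge> c}"
            by (rule quarter[of N]) (use main[of N] elim g in auto)
        qed
      qed
    qed
    show "0 < liminf (\<lambda>N. INF g\<in>estimators (2^N). SUP (H, \<eta>)\<in>D.
        ereal (measure (M H \<eta>) {\<omega>\<in>space (M H \<eta>).
          \<bar>g (obs (2^N) (S H \<eta>) \<omega>) - \<eta>\<bar> / rate_w (2^N) H \<ge> c}))"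
      unfolding split_beta'
    proof (rule liminf_minimax_gt_0)
      show "eventually (\<lambda>N. \<forall>g\<in>estimators (2^N). \<exists>p\<in>D. 1 / 4 \<le> measure (M (fst p) (snd p)) {\<omega>\<in>space (M (fst p) (snd p)).
          \<bar>g (obs (2^N) (S (fst p) (snd p)) \<omega>) - snd p\<bar> / rate_w (2^N) (fst p) \<ge> c}) sequentially"
        using ev
      proof eventually_elim
        case (elim N)
        show ?case
        proof
          fix g assume g: "g \<in> estimators (2 ^ N)"
          show "\<exists>p\<in>D. 1 / 4 \<le> measure (M (fst p) (snd p)) {\<omega>\<in>space (M (fst p) (snd p)).
            \<bar>g (obs (2^N) (S (fst p) (snd p)) \<omega>) - snd p\<bar> / rate_w (2^N) (fst p) \<ge> c}"
            by (rule quarter[of N]) (use main[of N] elim g in auto)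
        qed
      qed
    qed
  qed
qed

end
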